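(* Let $d\geq2$ and let $\theta$ be an antisymmetric real $d\times d$ matrix. For all $0\leq b\in C(\mathbb{T}^d_\theta)$ we have $$\lim_{t\to\infty}t\,\mu\big(t,(1-\Delta)^{-\frac{d}{4}}\rho(b)(1-\Delta)^{-\frac{d}{4}}\big)=\frac{\mathrm{Vol}(S^{d-1})}{d}\,\tau(b).$$
   Context: For a compact operator $T$ and $t\geq 0$, $\mu(t,T)=\inf\{s\geq 0: \mathrm{Tr}(\chi_{(s,\infty)}(|T|))\leq t\}$; thus $\{\mu(n,T)\}_{n\ge 0}$ is the sequence of eigenvalues of $|T|$ in non-increasing order with multiplicities. The noncommutative torus: $C(\mathbb{T}^d_\theta)$ is the universal $C^*$-algebra generated by unitaries $U_1,\ldots,U_d$ with $U_jU_k=e^{2\pi i\theta_{j,k}}U_kU_j$. Write $U^n=U_1^{n_1}\cdots U_d^{n_d}$ for $n\in\mathbb{Z}^d$. $\tau$ is the tracial state on $C(\mathbb{T}^d_\theta)$ determined by $\tau(U^n)=0$ for $n\neq0$ and $\tau(1)=1$. $L_2(\mathbb{T}^d_\theta)$ is the GNS Hilbert space of $\tau$, in which $\{U^n\}_{n\in\mathbb{Z}^d}$ is an orthonormal basis. $\rho(x)$ denotes the operator on $L_2(\mathbb{T}^d_\theta)$ of left multiplication by $x$. The Laplace operator $\Delta$ acts by $\Delta U^n=-|n|^2U^n$, $|n|^2=n_1^2+\cdots+n_d^2$, and $(1-\Delta)^{\frac{s}{2}}U^n=(1+|n|^2)^{\frac{s}{2}}U^n$ for $s\in\mathbb{R}$.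 $\mathrm{Vol}(S^{d-1})$ is the surface area of the unit sphere in $\mathbb{R}^d$. *)

theory Defs
  imports "HOL-Analysis.Analysis" "HOL-Algebra.Module" "HOL-Algebra.Subrings"
begin

section \<open>Unital $C^*$-algebras\<close>

definition complex_ring :: "complex ring" where
  "complex_ring = \<lparr>carrier = UNIV, mult = (*), one = 1, zero = 0, add = (+)\<rparr>"

record 'a cstar = "(complex, 'a) module" +
  star :: "'a \<Rightarrow> 'a"
  anorm :: "'a \<Rightarrow> real"

definition norm_limit :: "'a cstar \<Rightarrow> (nat \<Rightarrow> 'a) \<Rightarrow> 'a \<Rightarrow> bool" where
  "norm_limit A X l \<longleftrightarrow> (\<lambda>n. anorm A (X n \<ominus>\<^bsub>A\<^esub> l)) \<longlonglongrightarrow> 0"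

text \<open>The zero algebra is not excluded.\<close>

locale cstar_algebra = ring A + Module.module complex_ring A for A :: "'a cstar" (structure) +
  assumes smult_mult_left:
      "\<lbrakk>x \<in> carrier A; y \<in> carrier A\<rbrakk> \<Longrightarrow> (c \<odot> x) \<otimes> y = c \<odot> (x \<otimes> y)"
    and smult_mult_right:
      "\<lbrakk>x \<in> carrier A; y \<in> carrier A\<rbrakk> \<Longrightarrow> x \<otimes> (c \<odot> y) = c \<odot> (x \<otimes> y)"
    and star_closed: "x \<in> carrier A \<Longrightarrow> star A x \<in> carrier A"
    and star_star: "x \<in> carrier A \<Longrightarrow> star A (star A x) = x"
    and star_add:
      "\<lbrakk>x \<in> carrier A; y \<in> carrier A\<rbrakk> \<Longrightarrow> star A (x \<oplus> y) = star A x \<oplus> star A y"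
    and star_smult: "x \<in> carrier A \<Longrightarrow> star A (c \<odot> x) = cnj c \<odot> star A x"
    and star_mult:
      "\<lbrakk>x \<in> carrier A; y \<in> carrier A\<rbrakk> \<Longrightarrow> star A (x \<otimes> y) = star A y \<otimes> star A x"
    and anorm_nonneg: "x \<in> carrier A \<Longrightarrow> 0 \<le> anorm A x"
    and anorm_eq_0_iff: "x \<in> carrier A \<Longrightarrow> anorm A x = 0 \<longleftrightarrow> x = \<zero>"
    and anorm_triangle:
      "\<lbrakk>x \<in> carrier A; y \<in> carrier A\<rbrakk> \<Longrightarrow> anorm A (x \<oplus> y) \<le> anorm A x + anorm A y"
    and anorm_smult: "x \<in> carrier A \<Longrightarrow> anorm A (c \<odot> x) = cmod c * anorm A x"
    and anorm_mult:
      "\<lbrakk>x \<in> carrier A; y \<in> carrier A\<rbrakk> \<Longrightarrow> anorm A (x \<otimes> y) \<le> anorm A x * anorm A y"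
    and anorm_star_mult: "x \<in> carrier A \<Longrightarrow> anorm A (star A x \<otimes> x) = (anorm A x)\<^sup>2"
    and complete:
      "\<lbrakk>range X \<subseteq> carrier A;
        \<And>e. 0 < e \<Longrightarrow> \<exists>N. \<forall>m\<ge>N. \<forall>n\<ge>N. anorm A (X m \<ominus> X n) < e\<rbrakk>
       \<Longrightarrow> \<exists>l\<in>carrier A. norm_limit A X l"

definition star_hom :: "'a cstar \<Rightarrow> 'b cstar \<Rightarrow> ('a \<Rightarrow> 'b) \<Rightarrow> bool" where
  "star_hom A B h \<longleftrightarrow> h \<in> ring_hom A B \<and>
     (\<forall>c. \<forall>x\<in>carrier A. h (c \<odot>\<^bsub>A\<^esub> x) = c \<odot>\<^bsub>B\<^esub> h x) \<and>
     (\<forall>x\<in>carrier A. h (star A x) = star B (h x))"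

definition cstar_subalgebra :: "'a set \<Rightarrow> 'a cstar \<Rightarrow> bool" where
  "cstar_subalgebra S A \<longleftrightarrow> subring S A \<and>
     (\<forall>c. \<forall>x\<in>S. c \<odot>\<^bsub>A\<^esub> x \<in> S) \<and> (\<forall>x\<in>S. star A x \<in> S) \<and>
     (\<forall>X. \<forall>l\<in>carrier A. range X \<subseteq> S \<and> norm_limit A X l \<longrightarrow> l \<in> S)"

definition cstar_generated_by :: "'a cstar \<Rightarrow> 'a set \<Rightarrow> bool" where
  "cstar_generated_by A G \<longleftrightarrow> G \<subseteq> carrier A \<and>
     (\<forall>S. cstar_subalgebra S A \<and> G \<subseteq> S \<longrightarrow> S = carrier A)"

definition unitary_in :: "'a cstar \<Rightarrow> 'a \<Rightarrow> bool" where
  "unitary_in A u \<longleftrightarrow> u \<in> carrier A \<and>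
     star A u \<otimes>\<^bsub>A\<^esub> u = \<one>\<^bsub>A\<^esub> \<and> u \<otimes>\<^bsub>A\<^esub> star A u = \<one>\<^bsub>A\<^esub>"

definition positive_elements :: "'a cstar \<Rightarrow> 'a set" where
  "positive_elements A = {star A x \<otimes>\<^bsub>A\<^esub> x | x. x \<in> carrier A}"

definition tracial_state :: "'a cstar \<Rightarrow> ('a \<Rightarrow> complex) \<Rightarrow> bool" where
  "tracial_state A \<tau> \<longleftrightarrow>
     (\<forall>x\<in>carrier A. \<forall>y\<in>carrier A. \<tau> (x \<oplus>\<^bsub>A\<^esub> y) = \<tau> x + \<tau> y) \<and>
     (\<forall>c. \<forall>x\<in>carrier A. \<tau> (c \<odot>\<^bsub>A\<^esub> x) = c * \<tau> x) \<and>
     (\<forall>x\<in>positive_elements A. \<tau> x \<in> \<real>\<^sub>\<ge>\<^sub>0) \<and>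
     \<tau> \<one>\<^bsub>A\<^esub> = 1 \<and>
     (\<forall>x\<in>carrier A. cmod (\<tau> x) \<le> anorm A x) \<and>
     (\<forall>x\<in>carrier A. \<forall>y\<in>carrier A. \<tau> (x \<otimes>\<^bsub>A\<^esub> y) = \<tau> (y \<otimes>\<^bsub>A\<^esub> x))"


section \<open>The noncommutative torus\<close>

text \<open>The index type \<open>'d\<close> plays the role of $\{1,\dots,d\}$; its linear order fixes the order
  of the factors in $U^n$.\<close>

definition nc_torus_relations ::
    "real^('d::{finite,linorder})^('d::{finite,linorder}) \<Rightarrow> 'a cstar \<Rightarrow> ('d::{finite,linorder} \<Rightarrow> 'a) \<Rightarrow> bool" where
  "nc_torus_relations \<theta> A U \<longleftrightarrow>
     (\<forall>j. unitary_in A (U j)) \<and>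
     (\<forall>j k. U j \<otimes>\<^bsub>A\<^esub> U k =
        exp (2 * of_real pi * \<i> * of_real (\<theta> $ j $ k)) \<odot>\<^bsub>A\<^esub> (U k \<otimes>\<^bsub>A\<^esub> U j))"

text \<open>The test algebras \<open>B\<close> are all $C^*$-algebras with carrier in the type of \<open>A\<close>. This loses
  nothing: it suffices to map into the $C^*$-subalgebra of \<open>B\<close> generated by the countable set
  \<open>range V\<close>, which is separable and so has at most the cardinality of the continuum, whereas a
  type carrying a nonzero \<open>A\<close> has at least that cardinality.\<close>

definition universal_nc_torus ::
    "real^('d::{finite,linorder})^('d::{finite,linorder}) \<Rightarrow> 'a cstar \<Rightarrow> ('d::{finite,linorder} \<Rightarrow> 'a) \<Rightarrow> bool" where
  "universal_nc_torus \<theta> A U \<longleftrightarrow>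
     cstar_algebra A \<and> nc_torus_relations \<theta> A U \<and> cstar_generated_by A (range U) \<and>
     (\<forall>(B::'a cstar) V. cstar_algebra B \<and> nc_torus_relations \<theta> B V \<longrightarrow>
        (\<exists>h. star_hom A B h \<and> (\<forall>j. h (U j) = V j)))"

definition torus_monomial ::
    "'a cstar \<Rightarrow> ('d::{finite,linorder} \<Rightarrow> 'a) \<Rightarrow> int^('d::{finite,linorder}) \<Rightarrow> 'a" where
  "torus_monomial A U n =
     foldr (\<lambda>j x. U j [^]\<^bsub>A\<^esub> (n $ j) \<otimes>\<^bsub>A\<^esub> x) (sorted_list_of_set UNIV) \<one>\<^bsub>A\<^esub>"


section \<open>Complex Hilbert spaces\<close>

text \<open>The inner product is linear in the second argument.\<close>

class chilbert_space = real_inner + complete_space +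
  fixes scaleC :: "complex \<Rightarrow> 'a \<Rightarrow> 'a" (infixr \<open>*\<^sub>C\<close> 75)
    and cinner :: "'a \<Rightarrow> 'a \<Rightarrow> complex"
  assumes scaleC_of_real: "of_real r *\<^sub>C x = r *\<^sub>R x"
    and scaleC_scaleC: "a *\<^sub>C b *\<^sub>C x = (a * b) *\<^sub>C x"
    and scaleC_add_left: "(a + b) *\<^sub>C x = a *\<^sub>C x + b *\<^sub>C x"
    and scaleC_add_right: "a *\<^sub>C (x + y) = a *\<^sub>C x + a *\<^sub>C y"
    and cinner_commute: "cinner x y = cnj (cinner y x)"
    and cinner_add_right: "cinner x (y + z) = cinner x y + cinner x z"
    and cinner_scaleC_right: "cinner x (a *\<^sub>C y) = a * cinner x y"
    and Re_cinner: "Re (cinner x y) = inner x y"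

definition bounded_clinear :: "('h::chilbert_space \<Rightarrow> 'h) \<Rightarrow> bool" where
  "bounded_clinear T \<longleftrightarrow> bounded_linear T \<and> (\<forall>c x. T (c *\<^sub>C x) = c *\<^sub>C T x)"

definition adjoint_op :: "('h::chilbert_space \<Rightarrow> 'h) \<Rightarrow> 'h \<Rightarrow> 'h" where
  "adjoint_op T = (THE S. \<forall>x y. cinner (S x) y = cinner x (T y))"

text \<open>$|T|$ is the positive square root of $T^*T$.\<close>

definition abs_op :: "('h::chilbert_space \<Rightarrow> 'h) \<Rightarrow> 'h \<Rightarrow> 'h" where
  "abs_op T = (THE R. bounded_clinear R \<and> (\<forall>x. cinner x (R x) \<in> \<real>\<^sub>\<ge>\<^sub>0) \<and>
                 R \<circ> R = adjoint_op T \<circ> T)"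

definition orth_proj :: "'h::chilbert_space set \<Rightarrow> 'h \<Rightarrow> 'h" where
  "orth_proj M x = (THE y. y \<in> M \<and> (\<forall>z\<in>M. cinner z (x - y) = 0))"

text \<open>The spectral projection $\chi_S(R)$ of a compact self-adjoint operator \<open>R\<close>, that is,
  $\sum_{\lambda \in S} P_\lambda$ with $P_\lambda$ the projection onto the
  $\lambda$-eigenspace. It is not meaningful for operators with continuous spectrum. The set of
  eigenvectors is invariant under complex scalars, so its real span is its complex span.\<close>

definition spectral_proj :: "('h::chilbert_space \<Rightarrow> 'h) \<Rightarrow> real set \<Rightarrow> 'h \<Rightarrow> 'h" where
  "spectral_proj R S = orth_proj (closure (span {v. \<exists>r\<in>S. R v = r *\<^sub>R v}))"

definition orthonormal_basis :: "'h::chilbert_space set \<Rightarrow> bool" where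
  "orthonormal_basis E \<longleftrightarrow>
     (\<forall>e\<in>E. \<forall>f\<in>E. cinner e f = (if e = f then 1 else 0)) \<and>
     (\<forall>v. (\<forall>e\<in>E. cinner e v = 0) \<longrightarrow> v = 0)"

text \<open>The trace of a positive operator, which does not depend on the chosen basis.\<close>

definition trace_pos :: "('h::chilbert_space \<Rightarrow> 'h) \<Rightarrow> ennreal" where
  "trace_pos T = (\<Sum>\<^sub>\<infinity>e\<in>(SOME E. orthonormal_basis E). ennreal (Re (cinner e (T e))))"

definition singular_value_fn :: "real \<Rightarrow> ('h::chilbert_space \<Rightarrow> 'h) \<Rightarrow> real" where
  "singular_value_fn t T =
     Inf {s. 0 \<le> s \<and> trace_pos (spectral_proj (abs_op T) {s<..}) \<le> ennreal t}"


section \<open>The GNS space of the trace and its operators\<close>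

text \<open>A GNS space of \<open>\<tau>\<close> is a Hilbert space \<open>'h\<close> with the canonical map \<open>\<Lambda>\<close> from \<open>A\<close> onto a dense
  subspace; these data are unique up to a unitary intertwining the maps \<open>\<Lambda>\<close>.\<close>

definition gns_space ::
    "'a cstar \<Rightarrow> ('a \<Rightarrow> complex) \<Rightarrow> ('a \<Rightarrow> 'h::chilbert_space) \<Rightarrow> bool" where
  "gns_space A \<tau> \<Lambda> \<longleftrightarrow>
     (\<forall>x\<in>carrier A. \<forall>y\<in>carrier A. \<Lambda> (x \<oplus>\<^bsub>A\<^esub> y) = \<Lambda> x + \<Lambda> y) \<and>
     (\<forall>c. \<forall>x\<in>carrier A. \<Lambda> (c \<odot>\<^bsub>A\<^esub> x) = c *\<^sub>C \<Lambda> x) \<and>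
     (\<forall>x\<in>carrier A. \<forall>y\<in>carrier A. cinner (\<Lambda> x) (\<Lambda> y) = \<tau> (star A x \<otimes>\<^bsub>A\<^esub> y)) \<and>
     closure (\<Lambda> ` carrier A) = UNIV"

definition left_mult ::
    "'a cstar \<Rightarrow> ('a \<Rightarrow> 'h::chilbert_space) \<Rightarrow> 'a \<Rightarrow> 'h \<Rightarrow> 'h" where
  "left_mult A \<Lambda> x =
     (THE T. bounded_clinear T \<and> (\<forall>y\<in>carrier A. T (\<Lambda> y) = \<Lambda> (x \<otimes>\<^bsub>A\<^esub> y)))"

text \<open>The operator $(1-\Delta)^r$, diagonal in the orthonormal basis $(U^n)$ with eigenvalues
  $(1+|n|^2)^r$. For $r > 0$ it is unbounded, and the series gives it only on the vectors for
  which it converges; for $r \le 0$ this is all of \<open>'h\<close>.\<close>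

definition one_minus_laplace_powr ::
    "'a cstar \<Rightarrow> ('d::{finite,linorder} \<Rightarrow> 'a) \<Rightarrow> ('a \<Rightarrow> 'h::chilbert_space) \<Rightarrow> real \<Rightarrow> 'h \<Rightarrow> 'h"
  where
  "one_minus_laplace_powr A U \<Lambda> r v =
     (\<Sum>\<^sub>\<infinity>n\<in>(UNIV :: (int^('d::{finite,linorder})) set).
        ((1 + (\<Sum>j\<in>UNIV. (real_of_int (n $ j))\<^sup>2)) powr r) *\<^sub>R
          (cinner (\<Lambda> (torus_monomial A U n)) v *\<^sub>C \<Lambda> (torus_monomial A U n)))"


section \<open>Surface area\<close>

text \<open>Surface area of a compact smooth hypersurface, as its Minkowski content.\<close>

definition surface_area :: "(real^'n) set \<Rightarrow> real" where
  "surface_area S =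
     Lim (at_right 0) (\<lambda>\<epsilon>. measure lebesgue (\<Union>x\<in>S. cball x \<epsilon>) / (2 * \<epsilon>))"

end

theory Submission
  imports Defs
begin

text \<open>
  Let $B = \rho(b)$, $D = (1-\Delta)^{-d/4}$ and $T = DBD$. By the min-max principle, the number of
  eigenvalues of $T$ above $s$ is the number of positive eigenvalues of the quadratic form
  $\langle u, Bu\rangle - s\,\langle u, (1-\Delta)^{d/2}u\rangle$. Cut the index lattice of the basis
  $(U^n)$ into cubes of side $L$ and shrink each cube by a margin $K$. Since $b$ is a norm limit of
  trigonometric polynomials, which act as banded matrices, different shrunken cubes are decoupled up
  to an error $\epsilon$ for large $K$, and the margins contain only a proportion $O(K/L)$ of the
  lattice points. Right multiplication by $U^k$ commutes with $B$ and translates the basis up to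
  phases, so the compressions of $B$ to all shrunken cubes have the same eigenvalues
  $r_1, \dots, r_m$ with $m = (L-2K)^d$, and every diagonal entry of $B$ being $\tau(b)$, their sum
  is $m\,\tau(b)$. On the cube $q$ the factor $(1+|n|^2)^{d/2}$ is essentially $(L|q|)^d$, so the
  eigenvalue $r_j$ contributes the number of lattice points $q$ with $(L|q|)^d < r_j/s$, which is
  asymptotic to $\omega_d\, r_j / (s L^d)$, where $\omega_d$ is the volume of the unit ball. Summing
  over $j$ and letting $L \to \infty$ and $\epsilon \to 0$ gives $\omega_d\,\tau(b)/s$.
\<close>

section \<open>Complex Hilbert spaces\<close>

text \<open>The eigenvalue count is only ever bounded: from below by trial spaces, from above by
  imposing linear constraints. In the lower bound the margins cost just their share of the trace. In
  the upper bound each margin point of the cells in a large ball costs one constraint, and all cells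
  outside that ball form one further piece, on which the norm bound of B suffices; hence a block has
  to be decoupled from everything outside its cell, not only from other blocks. A decoupling costs
  \<open>2 * \<epsilon>\<close>, because B is replaced by a banded operator once in the whole form
  and once in its pieces. That the eigenvalues r_j agree on all cubes turns the count into a finite
  sum of lattice point counts. The weight is not constant on a cube, but its variation moves the
  radii in these counts by a bounded amount only, which is invisible as s tends to 0 with L fixed.
  So \<epsilon> is chosen first, then K, then L, and s last. The asymptotics are proved in s and
  inverted at the end.\<close>

instance chilbert_space \<subseteq> banach ..

lemma cinner_add_left: "cinner (x + y) z = cinner x z + cinner y (z :: 'h::chilbert_space)"
  by (metis cinner_add_right cinner_commute complex_cnj_add)

lemma cinner_scaleC_left: "cinner (a *\<^sub>C x) y = cnj a * cinner x (y :: 'h::chilbert_space)"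
  by (metis cinner_commute cinner_scaleC_right complex_cnj_mult)

lemma cinner_scaleR_right: "cinner x (r *\<^sub>R y) = of_real r * cinner x (y :: 'h::chilbert_space)"
  by (metis cinner_scaleC_right scaleC_of_real)

lemma cinner_scaleR_left: "cinner (r *\<^sub>R x) y = of_real r * cinner x (y :: 'h::chilbert_space)"
  by (metis cinner_scaleC_left complex_cnj_complex_of_real scaleC_of_real)

lemma cinner_self: "cinner x x = of_real ((norm (x :: 'h::chilbert_space))\<^sup>2)"
proof -
  have "Im (cinner x x) = 0"
    by (metis cinner_commute cnj.sel(2) equal_neg_zero)
  moreover have "Re (cinner x x) = (norm x)\<^sup>2"
    by (simp add: Re_cinner dot_square_norm)
  ultimately show ?thesis by (simp add: complex_eq_iff)
qed

lemma Re_cinner_self [simp]: "Re (cinner x x) = (norm (x :: 'h::chilbert_space))\<^sup>2"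
  by (simp add: cinner_self)

lemma scaleC_one [simp]: "1 *\<^sub>C (x :: 'h::chilbert_space) = x"
  using scaleC_of_real[of 1 x] by simp

lemma norm_scaleC: "norm (a *\<^sub>C (x :: 'h::chilbert_space)) = cmod a * norm x"
proof -
  have "cinner (a *\<^sub>C x) (a *\<^sub>C x) = (cnj a * a) * cinner x x"
    by (simp add: cinner_scaleC_left cinner_scaleC_right)
  also have "cnj a * a = of_real ((cmod a)\<^sup>2)"
    by (metis complex_norm_square mult.commute)
  finally have "of_real ((norm (a *\<^sub>C x))\<^sup>2) = (of_real ((cmod a)\<^sup>2 * (norm x)\<^sup>2) :: complex)"
    by (simp add: cinner_self)
  then have "(norm (a *\<^sub>C x))\<^sup>2 = (cmod a * norm x)\<^sup>2"
    by (simp only: of_real_eq_iff power_mult_distrib)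
  then show ?thesis by (simp add: power2_eq_iff_nonneg)
qed

text \<open>Rotating \<open>y\<close> by the phase \<open>a\<close> makes the inner product real and
  nonnegative, and the real Cauchy-Schwarz inequality applies to the rotated vector.\<close>

lemma cinner_Cauchy_Schwarz: "cmod (cinner x y) \<le> norm x * norm (y :: 'h::chilbert_space)"
proof (cases "cinner x y = 0")
  case False
  define a where "a = cnj (cinner x y) / of_real (cmod (cinner x y))"
  have a: "cmod a = 1" using False by (simp add: a_def norm_divide)
  have "a * cinner x y = of_real (cmod (cinner x y))"
    using False by (simp add: a_def mult.commute complex_norm_square[symmetric] power2_eq_square)
  then have "Re (cinner x (a *\<^sub>C y)) = cmod (cinner x y)"
    by (simp add: cinner_scaleC_right)
  moreover have "Re (cinner x (a *\<^sub>C y)) \<le> norm x * norm (a *\<^sub>C y)"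
    by (simp add: Re_cinner norm_cauchy_schwarz)
  ultimately show ?thesis using a by (simp add: norm_scaleC)
qed simp

lemma bounded_bilinear_cinner: "bounded_bilinear (cinner :: 'h::chilbert_space \<Rightarrow> _)"
  by unfold_locales
     (auto simp: cinner_add_left cinner_add_right cinner_scaleR_left cinner_scaleR_right
        scaleR_conv_of_real intro!: exI[of _ 1] cinner_Cauchy_Schwarz)

lemma bounded_bilinear_scaleC: "bounded_bilinear (scaleC :: complex \<Rightarrow> 'h::chilbert_space \<Rightarrow> 'h)"
proof
  fix a b :: complex and x y :: 'h and r :: real
  show "(a + b) *\<^sub>C x = a *\<^sub>C x + b *\<^sub>C x" by (rule scaleC_add_left)
  show "a *\<^sub>C (x + y) = a *\<^sub>C x + a *\<^sub>C y" by (rule scaleC_add_right)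
  show "(r *\<^sub>R a) *\<^sub>C x = r *\<^sub>R a *\<^sub>C x"
    by (metis scaleC_of_real scaleC_scaleC scaleR_conv_of_real)
  show "a *\<^sub>C r *\<^sub>R x = r *\<^sub>R a *\<^sub>C x"
    by (metis mult.commute scaleC_of_real scaleC_scaleC)
  show "\<exists>K. \<forall>a (x :: 'h). norm (a *\<^sub>C x) \<le> norm a * norm x * K"
    by (intro exI[of _ 1]) (simp add: norm_scaleC)
qed

lemmas cinner_zero_left [simp] = bounded_bilinear.zero_left[OF bounded_bilinear_cinner]
  and cinner_zero_right [simp] = bounded_bilinear.zero_right[OF bounded_bilinear_cinner]
  and cinner_minus_right = bounded_bilinear.minus_right[OF bounded_bilinear_cinner]
  and cinner_diff_left = bounded_bilinear.diff_left[OF bounded_bilinear_cinner]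
  and cinner_diff_right = bounded_bilinear.diff_right[OF bounded_bilinear_cinner]
  and cinner_sum_left = bounded_bilinear.sum_left[OF bounded_bilinear_cinner]
  and cinner_sum_right = bounded_bilinear.sum_right[OF bounded_bilinear_cinner]
  and bounded_linear_cinner_right = bounded_bilinear.bounded_linear_right[OF bounded_bilinear_cinner]

lemmas scaleC_zero_left [simp] = bounded_bilinear.zero_left[OF bounded_bilinear_scaleC]
  and scaleC_zero_right [simp] = bounded_bilinear.zero_right[OF bounded_bilinear_scaleC]
  and scaleC_minus_left = bounded_bilinear.minus_left[OF bounded_bilinear_scaleC]
  and scaleC_diff_right = bounded_bilinear.diff_right[OF bounded_bilinear_scaleC]
  and scaleC_sum_right = bounded_bilinear.sum_right[OF bounded_bilinear_scaleC]
  and bounded_linear_scaleC_right = bounded_bilinear.bounded_linear_right[OF bounded_bilinear_scaleC]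

lemma scaleR_as_scaleC: "r *\<^sub>R (x :: 'h::chilbert_space) = of_real r *\<^sub>C x"
  by (rule scaleC_of_real[symmetric])

lemma scaleC_scaleR_commute: "a *\<^sub>C r *\<^sub>R (x :: 'h::chilbert_space) = r *\<^sub>R a *\<^sub>C x"
  by (rule bounded_bilinear.scaleR_right[OF bounded_bilinear_scaleC])

lemma norm_diff_square:
  "(norm (x - y :: 'h::chilbert_space))\<^sup>2 = (norm x)\<^sup>2 - 2 * Re (cinner x y) + (norm y)\<^sup>2"
  by (simp add: Re_cinner power2_norm_eq_inner inner_diff_left inner_diff_right inner_commute)

lemma norm_add_square:
  "(norm (x + y :: 'h::chilbert_space))\<^sup>2 = (norm x)\<^sup>2 + 2 * Re (cinner x y) + (norm y)\<^sup>2"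
  by (simp add: Re_cinner power2_norm_eq_inner inner_add_left inner_add_right inner_commute)

lemma cinner_eqI: "(\<And>z. cinner z x = cinner z y) \<Longrightarrow> x = (y :: 'h::chilbert_space)"
proof -
  assume "\<And>z. cinner z x = cinner z y"
  then have "cinner (x - y) (x - y) = 0" by (simp add: cinner_diff_right)
  then show "x = y" by (simp add: cinner_self)
qed

lemma cinner_eq_0_sym: "cinner x y = 0 \<longleftrightarrow> cinner y (x :: 'h::chilbert_space) = 0"
  by (metis cinner_commute complex_cnj_zero)

lemma cmod_cinner_commute: "cmod (cinner x y) = cmod (cinner y (x :: 'h::chilbert_space))"
  by (metis cinner_commute complex_mod_cnj)

section \<open>Bounded complex-linear operators\<close>

lemma bounded_clinear_imp_bounded_linear: "bounded_clinear T \<Longrightarrow> bounded_linear T"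
  by (simp add: bounded_clinear_def)

lemma bounded_clinear_scaleC: "bounded_clinear T \<Longrightarrow> T (c *\<^sub>C x) = c *\<^sub>C T x"
  by (simp add: bounded_clinear_def)

lemma bounded_clinearI:
  assumes "\<And>x y. T (x + y) = T x + T (y :: 'h::chilbert_space)" "\<And>c x. T (c *\<^sub>C x) = c *\<^sub>C T x"
    "\<And>x. norm (T x) \<le> norm x * K"
  shows "bounded_clinear T"
  unfolding bounded_clinear_def
proof (intro conjI allI)
  show "bounded_linear T"
    by (rule bounded_linear_intro) (use assms in \<open>auto simp: scaleR_as_scaleC\<close>)
qed (rule assms(2))

lemma bounded_clinear_compose:
  assumes "bounded_clinear S" "bounded_clinear T"
  shows "bounded_clinear (\<lambda>x. S (T x))"
  using assms bounded_linear_compose[of S T] by (simp add: bounded_clinear_def)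

lemmas bounded_clinear_add = linear_add[OF bounded_linear.linear[OF bounded_clinear_imp_bounded_linear]]
  and bounded_clinear_diff = linear_diff[OF bounded_linear.linear[OF bounded_clinear_imp_bounded_linear]]
  and bounded_clinear_sum = linear_sum[OF bounded_linear.linear[OF bounded_clinear_imp_bounded_linear]]
  and bounded_clinear_zero = linear_0[OF bounded_linear.linear[OF bounded_clinear_imp_bounded_linear]]

subsection \<open>Orthonormal families\<close>

text \<open>An indexed family rather than a set: the index runs over lattice points, over a set of
  vectors itself (\<open>\<lambda>g. g\<close>), or over pairs of a cell and a block
  eigenvector.\<close>

definition orthonormal_on :: "'i set \<Rightarrow> ('i \<Rightarrow> 'h::chilbert_space) \<Rightarrow> bool" where
  "orthonormal_on I e \<longleftrightarrow> (\<forall>i\<in>I. \<forall>j\<in>I. cinner (e i) (e j) = (if i = j then 1 else 0))"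

lemma orthonormal_onD:
  "orthonormal_on I e \<Longrightarrow> i \<in> I \<Longrightarrow> j \<in> I \<Longrightarrow> cinner (e i) (e j) = (if i = j then 1 else 0)"
  by (simp add: orthonormal_on_def)

lemma orthonormal_on_subset: "orthonormal_on I e \<Longrightarrow> J \<subseteq> I \<Longrightarrow> orthonormal_on J e"
  unfolding orthonormal_on_def by blast

lemma orthonormal_on_norm: "orthonormal_on I e \<Longrightarrow> i \<in> I \<Longrightarrow> norm (e i) = 1"
  by (metis orthonormal_onD cinner_self of_real_eq_1_iff norm_ge_zero power2_eq_1_iff
      order_less_le_trans not_less zero_less_one neg_less_0_iff_less)

lemma orthonormal_coeff:
  assumes "orthonormal_on I e" "finite F" "F \<subseteq> I" "j \<in> I"
  shows "cinner (e j) (\<Sum>i\<in>F. c i *\<^sub>C e i) = (if j \<in> F then c j else 0)"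
proof -
  have "cinner (e j) (\<Sum>i\<in>F. c i *\<^sub>C e i) = (\<Sum>i\<in>F. if j = i then c i else 0)"
    unfolding cinner_sum_right
    by (rule sum.cong) (use assms in \<open>auto simp: cinner_scaleC_right orthonormal_onD subset_iff\<close>)
  then show ?thesis using assms by (simp add: sum.delta)
qed

lemma cinner_orthonormal_sums:
  assumes "orthonormal_on I e" "finite F" "F \<subseteq> I"
  shows "cinner (\<Sum>i\<in>F. c i *\<^sub>C e i) (\<Sum>i\<in>F. d i *\<^sub>C e i) = (\<Sum>i\<in>F. cnj (c i) * d i)"
proof -
  have "cinner (c i *\<^sub>C e i) (\<Sum>i\<in>F. d i *\<^sub>C e i) = cnj (c i) * d i" if "i \<in> F" for i
    using assms that by (simp add: cinner_scaleC_left orthonormal_coeff subset_iff)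
  then show ?thesis by (simp add: cinner_sum_left)
qed

lemma norm_orthonormal_sum:
  assumes "orthonormal_on I e" "finite F" "F \<subseteq> I"
  shows "(norm (\<Sum>i\<in>F. c i *\<^sub>C e i))\<^sup>2 = (\<Sum>i\<in>F. (cmod (c i))\<^sup>2)"
proof -
  have "complex_of_real ((norm (\<Sum>i\<in>F. c i *\<^sub>C e i))\<^sup>2) = (\<Sum>i\<in>F. cnj (c i) * c i)"
    using cinner_orthonormal_sums[OF assms, of c c] by (simp add: cinner_self)
  also have "\<dots> = of_real (\<Sum>i\<in>F. (cmod (c i))\<^sup>2)"
    by (simp add: mult.commute flip: complex_norm_square)
  finally show ?thesis by (simp only: of_real_eq_iff)
qed

lemma norm_diff_orthonormal_proj:
  assumes "orthonormal_on I e" "finite F" "F \<subseteq> I"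
  shows "(norm (v - (\<Sum>i\<in>F. cinner (e i) v *\<^sub>C e i)))\<^sup>2
    = (norm v)\<^sup>2 - (\<Sum>i\<in>F. (cmod (cinner (e i) v))\<^sup>2)"
proof -
  have "cinner v (\<Sum>i\<in>F. cinner (e i) v *\<^sub>C e i) = (\<Sum>i\<in>F. cinner (e i) v * cnj (cinner (e i) v))"
    unfolding cinner_sum_right by (simp add: cinner_scaleC_right cinner_commute[of v])
  also have "\<dots> = of_real (\<Sum>i\<in>F. (cmod (cinner (e i) v))\<^sup>2)"
    by (simp flip: complex_norm_square)
  finally show ?thesis
    by (simp add: norm_diff_square norm_orthonormal_sum[OF assms])
qed

lemma Bessel_inequality:
  assumes "orthonormal_on I e" "finite F" "F \<subseteq> I"
  shows "(\<Sum>i\<in>F. (cmod (cinner (e i) v))\<^sup>2) \<le> (norm v)\<^sup>2"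
  using norm_diff_orthonormal_proj[OF assms, of v] by (smt (verit) zero_le_power2)

text \<open>By Pythagoras the squared distance of two nested partial sums is a difference of partial
  sums of the convergent series of squared moduli, so the net of partial sums is Cauchy.\<close>

lemma orthonormal_has_sum_exists:
  fixes e :: "'i \<Rightarrow> 'h::chilbert_space"
  assumes "orthonormal_on I e" and bd: "\<And>F. finite F \<Longrightarrow> F \<subseteq> I \<Longrightarrow> (\<Sum>i\<in>F. (cmod (c i))\<^sup>2) \<le> K"
  shows "(\<lambda>i. c i *\<^sub>C e i) summable_on I"
proof -
  let ?f = "\<lambda>i. c i *\<^sub>C e i" and ?g = "\<lambda>i. (cmod (c i))\<^sup>2"
  have "?g summable_on I"
    by (rule nonneg_bdd_above_summable_on) (use bd in \<open>auto simp: bdd_above_def\<close>)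
  then obtain L where L: "(?g has_sum L) I" by (auto simp: summable_on_def)
  have "\<exists>P. eventually P (finite_subsets_at_top I) \<and>
              (\<forall>F F'. P F \<and> P F' \<longrightarrow> dist (sum ?f F) (sum ?f F') < a)" if "a > 0" for a
  proof -
    have ev: "\<forall>\<^sub>F F in finite_subsets_at_top I. dist (sum ?g F) L < (a/2)\<^sup>2"
      using L that by (auto simp: has_sum_def tendsto_iff)
    then obtain F0 where F0: "finite F0" "F0 \<subseteq> I"
      "\<And>F. finite F \<Longrightarrow> F \<supseteq> F0 \<Longrightarrow> F \<subseteq> I \<Longrightarrow> dist (sum ?g F) L < (a/2)\<^sup>2"
      by (auto simp: eventually_finite_subsets_at_top)
    have *: "dist (sum ?f F) (sum ?f F0) < a/2" if F: "finite F" "F \<supseteq> F0" "F \<subseteq> I" for F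
    proof -
      have "(dist (sum ?f F) (sum ?f F0))\<^sup>2 = (norm (sum ?f (F - F0)))\<^sup>2"
        using F by (simp add: dist_norm sum_diff)
      also have "\<dots> = sum ?g (F - F0)"
        by (rule norm_orthonormal_sum[OF assms(1)]) (use F in auto)
      also have "\<dots> = sum ?g F - sum ?g F0" using F by (simp add: sum_diff)
      also have "\<dots> \<le> L - sum ?g F0"
        using finite_sum_le_has_sum[OF L F(1,3)] by simp
      also have "\<dots> < (a/2)\<^sup>2" using F0(3)[OF F0(1) order_refl F0(2)] by (simp add: dist_real_def abs_less_iff)
      finally show ?thesis by (rule power2_less_imp_less) (use \<open>a > 0\<close> in simp)
    qed
    show ?thesis
    proof (intro exI[of _ "\<lambda>F. finite F \<and> F \<supseteq> F0 \<and> F \<subseteq> I"] conjI allI impI)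
      show "\<forall>\<^sub>F F in finite_subsets_at_top I. finite F \<and> F0 \<subseteq> F \<and> F \<subseteq> I"
        unfolding eventually_finite_subsets_at_top using F0 by blast
    next
      fix F F' assume "(finite F \<and> F0 \<subseteq> F \<and> F \<subseteq> I) \<and> (finite F' \<and> F0 \<subseteq> F' \<and> F' \<subseteq> I)"
      then show "dist (sum ?f F) (sum ?f F') < a"
        using *[of F] *[of F'] dist_triangle_half_l[of "sum ?f F" "sum ?f F0" a "sum ?f F'"]
        by (simp add: dist_commute)
    qed
  qed
  then have "cauchy_filter (filtermap (sum ?f) (finite_subsets_at_top I))"
    by (simp add: cauchy_filter_metric_filtermap)
  moreover have "complete (UNIV::'h set)"
    by (meson Cauchy_convergent UNIV_I complete_def convergent_def)
  ultimately obtain L' where "(sum ?f \<longlongrightarrow> L') (finite_subsets_at_top I)"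
    using complete_uniform[where S=UNIV] by (force simp add: filterlim_def)
  then show ?thesis using summable_on_def has_sum_def by blast
qed

definition total_family :: "'i set \<Rightarrow> ('i \<Rightarrow> 'h::chilbert_space) \<Rightarrow> bool" where
  "total_family I e \<longleftrightarrow> (\<forall>v. (\<forall>i\<in>I. cinner (e i) v = 0) \<longrightarrow> v = 0)"

lemma has_sum_cinner:
  assumes "(f has_sum s) I"
  shows "((\<lambda>i. cinner w (f i)) has_sum cinner w (s :: 'h::chilbert_space)) I"
  by (rule has_sum_bounded_linear[OF bounded_linear_cinner_right assms])

lemma orthonormal_coeff_has_sum:
  assumes "orthonormal_on I e" "((\<lambda>i. c i *\<^sub>C e i) has_sum s) I" "j \<in> I"
  shows "cinner (e j) s = c j"
proof -
  have "((\<lambda>i. cinner (e j) (c i *\<^sub>C e i)) has_sum cinner (e j) s) I"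
    by (rule has_sum_cinner) (rule assms)
  moreover have "((\<lambda>i. cinner (e j) (c i *\<^sub>C e i)) has_sum c j) I"
    by (rule has_sum_finite_neutralI[of "{j}"])
       (use assms in \<open>auto simp: cinner_scaleC_right orthonormal_onD\<close>)
  ultimately show ?thesis by (metis has_sum_unique)
qed

lemma orthonormal_expansion:
  assumes "orthonormal_on I e" "total_family I e"
  shows "((\<lambda>i. cinner (e i) v *\<^sub>C e i) has_sum v) I"
proof -
  have "(\<lambda>i. cinner (e i) v *\<^sub>C e i) summable_on I"
    by (rule orthonormal_has_sum_exists[OF assms(1)]) (rule Bessel_inequality[OF assms(1)])
  then obtain y where y: "((\<lambda>i. cinner (e i) v *\<^sub>C e i) has_sum y) I"
    by (auto simp: summable_on_def)
  have "cinner (e i) (v - y) = 0" if "i \<in> I" for i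
    using orthonormal_coeff_has_sum[OF assms(1) y that] by (simp add: cinner_diff_right)
  then have "v - y = 0" using assms(2) unfolding total_family_def by blast
  then show ?thesis using y by simp
qed

lemma Parseval_cinner:
  assumes "orthonormal_on I e" "total_family I e"
  shows "((\<lambda>i. cnj (cinner (e i) w) * cinner (e i) v) has_sum cinner w v) I"
proof -
  have "((\<lambda>i. cinner w (cinner (e i) v *\<^sub>C e i)) has_sum cinner w v) I"
    by (rule has_sum_cinner) (rule orthonormal_expansion[OF assms])
  then show ?thesis
    by (simp add: cinner_scaleC_right cinner_commute[of w] mult.commute)
qed

lemma Parseval:
  assumes "orthonormal_on I e" "total_family I e"
  shows "((\<lambda>i. (cmod (cinner (e i) v))\<^sup>2) has_sum (norm v)\<^sup>2) I"
proof -
  have "((\<lambda>i. Re (cnj (cinner (e i) v) * cinner (e i) v)) has_sum Re (cinner v v)) I"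
    by (rule has_sum_bounded_linear[OF bounded_linear_Re]) (rule Parseval_cinner[OF assms])
  moreover have "Re (cnj z * z) = (cmod z)\<^sup>2" for z
    by (simp add: cmod_power2 flip: power2_eq_square)
  ultimately show ?thesis by simp
qed

subsection \<open>Orthogonal projections\<close>

definition csubspace :: "'h::chilbert_space set \<Rightarrow> bool" where
  "csubspace M \<longleftrightarrow> 0 \<in> M \<and> (\<forall>x\<in>M. \<forall>y\<in>M. x + y \<in> M) \<and> (\<forall>c. \<forall>x\<in>M. c *\<^sub>C x \<in> M)"

lemma csubspaceI:
  assumes "0 \<in> M" "\<And>x y. x \<in> M \<Longrightarrow> y \<in> M \<Longrightarrow> x + y \<in> M" "\<And>c x. x \<in> M \<Longrightarrow> c *\<^sub>C x \<in> M"
  shows "csubspace M"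
  using assms by (auto simp: csubspace_def)

lemma csubspaceD:
  assumes "csubspace M"
  shows "0 \<in> M" "x \<in> M \<Longrightarrow> y \<in> M \<Longrightarrow> x + y \<in> M" "x \<in> M \<Longrightarrow> c *\<^sub>C x \<in> M"
    "x \<in> M \<Longrightarrow> r *\<^sub>R x \<in> M" "x \<in> M \<Longrightarrow> y \<in> M \<Longrightarrow> x - y \<in> M"
proof -
  show "0 \<in> M" "x \<in> M \<Longrightarrow> y \<in> M \<Longrightarrow> x + y \<in> M" "x \<in> M \<Longrightarrow> c *\<^sub>C x \<in> M"
    using assms by (auto simp: csubspace_def)
  show "x \<in> M \<Longrightarrow> r *\<^sub>R x \<in> M" using assms by (auto simp: csubspace_def scaleR_as_scaleC)
  assume "x \<in> M" "y \<in> M"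
  then have "x + (-1) *\<^sub>C y \<in> M" using assms by (auto simp: csubspace_def)
  then show "x - y \<in> M" by (simp add: scaleC_minus_left)
qed

lemma csubspace_sum:
  assumes "csubspace M" "\<And>i. i \<in> I \<Longrightarrow> f i \<in> M"
  shows "sum f I \<in> M"
  using assms(2) by (induction I rule: infinite_finite_induct) (auto intro: csubspaceD[OF assms(1)])

lemma csubspace_orthogonal: "csubspace {x. \<forall>y\<in>S. cinner y x = 0}"
  by (rule csubspaceI) (auto simp: cinner_add_right cinner_scaleC_right)

lemma closed_orthogonal: "closed {x. \<forall>y\<in>S. cinner y (x :: 'h::chilbert_space) = 0}"
proof -
  have "{x. \<forall>y\<in>S. cinner y x = 0} = (\<Inter>y\<in>S. {x. cinner y x = 0})" by auto
  moreover have "closed {x. cinner y x = 0}" for y :: 'h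
    by (intro closed_Collect_eq continuous_intros
        linear_continuous_on bounded_linear_cinner_right)
  ultimately show ?thesis by auto
qed

text \<open>Multiplication by \<open>c\<close> is real-linear and continuous, so it preserves the
  closed real span of a set that it preserves. Needed because \<open>spectral_proj\<close> takes the
  real span.\<close>

lemma closed_cone_span:
  assumes "\<And>c x. x \<in> V \<Longrightarrow> c *\<^sub>C x \<in> V"
  shows "csubspace (closure (span (V :: 'h::chilbert_space set)))"
proof (rule csubspaceI)
  have s: "subspace (closure (span V))"
    unfolding subspace_def
  proof (intro conjI ballI allI)
    show "0 \<in> closure (span V)" using closure_subset span_zero by blast
    fix x y assume "x \<in> closure (span V)" "y \<in> closure (span V)"
    then obtain X Y where "\<And>n. X n \<in> span V" "X \<longlonglongrightarrow> x" "\<And>n. Y n \<in> span V" "Y \<longlonglongrightarrow> y"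
      by (metis closure_sequential)
    then show "x + y \<in> closure (span V)"
      unfolding closure_sequential by (intro exI[of _ "\<lambda>n. X n + Y n"]) (auto intro: tendsto_add span_add)
  next
    fix x and c :: real assume "x \<in> closure (span V)"
    then obtain X where "\<And>n. X n \<in> span V" "X \<longlonglongrightarrow> x"
      by (metis closure_sequential)
    then show "c *\<^sub>R x \<in> closure (span V)"
      unfolding closure_sequential
      by (intro exI[of _ "\<lambda>n. c *\<^sub>R X n"]) (auto intro: tendsto_intros span_mul)
  qed
  show "0 \<in> closure (span V)" using s by (rule subspace_0)
  show "x + y \<in> closure (span V)" if "x \<in> closure (span V)" "y \<in> closure (span V)" for x y
    using s that by (rule subspace_add)
  fix c x assume x: "x \<in> closure (span V)"
  have lin: "bounded_linear (\<lambda>x :: 'h. c *\<^sub>C x)" by (rule bounded_linear_scaleC_right)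
  have "(\<lambda>x. c *\<^sub>C x) ` span V \<subseteq> span V"
    unfolding linear_span_image[OF bounded_linear.linear[OF lin], symmetric]
    by (rule span_mono) (use assms in auto)
  then have "(\<lambda>x. c *\<^sub>C x) ` closure (span V) \<subseteq> closure (span V)"
    by (intro image_closure_subset linear_continuous_on[OF lin] closed_closure)
       (use closure_subset in blast)
  then show "c *\<^sub>C x \<in> closure (span V)" using x by blast
qed

lemma orthogonal_closure_span:
  assumes "\<And>z. z \<in> V \<Longrightarrow> cinner z w = 0" "z \<in> closure (span V)"
  shows "cinner z (w :: 'h::chilbert_space) = 0"
proof -
  let ?N = "{x. \<forall>y\<in>{w}. cinner y x = 0}"
  have sub: "subspace ?N" using csubspace_orthogonal[of "{w}"]
    by (auto simp: subspace_def csubspace_def scaleR_as_scaleC)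
  have "V \<subseteq> ?N" using assms(1) by (auto simp: cinner_eq_0_sym[of w])
  then have "span V \<subseteq> ?N" using sub by (simp add: span_minimal)
  then have "closure (span V) \<subseteq> ?N" by (rule closure_minimal) (rule closed_orthogonal)
  then show ?thesis using assms(2) by (auto simp: cinner_eq_0_sym[of w])
qed

text \<open>A minimising sequence for the distance is Cauchy by the parallelogram law, and
  minimality makes the residual of its limit orthogonal to \<open>M\<close>.\<close>

lemma projection_exists:
  fixes M :: "'h::chilbert_space set"
  assumes M: "csubspace M" "closed M"
  shows "\<exists>y\<in>M. \<forall>z\<in>M. cinner z (x - y) = 0"
proof -
  define d where "d = (INF y\<in>M. (norm (x - y))\<^sup>2)"
  have bdd: "bdd_below ((\<lambda>y. (norm (x - y))\<^sup>2) ` M)" by (auto intro!: bdd_belowI[of _ 0])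
  have ne: "M \<noteq> {}" using csubspaceD(1)[OF M(1)] by auto
  have dle: "d \<le> (norm (x - y))\<^sup>2" if "y \<in> M" for y
    unfolding d_def by (rule cINF_lower[OF bdd that])
  have "\<exists>y\<in>M. (norm (x - y))\<^sup>2 < d + 1 / real (Suc n)" for n
    using cINF_less_iff[OF ne bdd, of "d + 1 / real (Suc n)"] by (simp add: d_def)
  then obtain Y where Y: "\<And>n. Y n \<in> M" "\<And>n. (norm (x - Y n))\<^sup>2 < d + 1 / real (Suc n)" by metis
  have par: "(norm (Y m - Y n))\<^sup>2 \<le> 2 / real (Suc m) + 2 / real (Suc n)" for m n
  proof -
    let ?a = "x - Y m" and ?b = "x - Y n"
    \<comment> \<open>The midpoint of two approximants lies in \<open>M\<close>, so its distance
      from \<open>x\<close> bounds \<open>?a + ?b\<close> from below.\<close>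
    have mid: "(1/2) *\<^sub>R (Y m + Y n) \<in> M" by (intro csubspaceD[OF M(1)] Y)
    have "?a + ?b = 2 *\<^sub>R (x - (1/2) *\<^sub>R (Y m + Y n))"
      by (simp add: scaleR_diff_right scaleR_2)
    then have "(norm (?a + ?b))\<^sup>2 = 4 * (norm (x - (1/2) *\<^sub>R (Y m + Y n)))\<^sup>2"
      by (simp add: power_mult_distrib)
    then have 1: "(norm (?a + ?b))\<^sup>2 \<ge> 4 * d" using dle[OF mid] by simp
    have "(norm (?a + ?b))\<^sup>2 + (norm (?b - ?a))\<^sup>2 = 2 * (norm ?a)\<^sup>2 + 2 * (norm ?b)\<^sup>2"
      unfolding norm_add_square[of ?a ?b] norm_diff_square[of ?b ?a]
      unfolding Re_cinner inner_commute[of ?b ?a] by simp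
    then show ?thesis using 1 Y(2)[of m] Y(2)[of n] by simp
  qed
  have "Cauchy Y"
  proof (rule metric_CauchyI)
    fix e :: real assume e: "0 < e"
    obtain N where N: "4 / e\<^sup>2 < real N" using reals_Archimedean2 by blast
    show "\<exists>N. \<forall>m\<ge>N. \<forall>n\<ge>N. dist (Y m) (Y n) < e"
    proof (intro exI[of _ N] allI impI)
      fix m n assume mn: "N \<le> m" "N \<le> n"
      have N0: "0 < real N" using N e by (smt (verit) divide_nonneg_pos zero_less_power)
      have "2 / real (Suc m) \<le> 2 / real N" "2 / real (Suc n) \<le> 2 / real N"
        using mn N0 by (intro divide_left_mono; simp)+
      then have "(norm (Y m - Y n))\<^sup>2 \<le> 4 / real N" using par[of m n] by simp
      also have "\<dots> < e\<^sup>2" using N N0 e by (simp add: field_simps)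
      finally show "dist (Y m) (Y n) < e" unfolding dist_norm by (rule power2_less_imp_less) (use e in simp)
    qed
  qed
  then obtain y where y: "Y \<longlonglongrightarrow> y" using Cauchy_convergent convergent_def by blast
  have yM: "y \<in> M" using closed_sequentially[OF M(2) _ y] Y(1) by blast
  have "(\<lambda>n. (norm (x - Y n))\<^sup>2) \<longlonglongrightarrow> (norm (x - y))\<^sup>2" by (intro tendsto_intros y)
  moreover have "(\<lambda>n. d + 1 / real (Suc n)) \<longlonglongrightarrow> d + 0"
    by (intro tendsto_intros LIMSEQ_inverse_real_of_nat[unfolded inverse_eq_divide])
  ultimately have "(norm (x - y))\<^sup>2 \<le> d + 0"
    by (rule LIMSEQ_le) (use Y(2) less_imp_le in blast)
  then have yd: "(norm (x - y))\<^sup>2 \<le> d" by simp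
  have "cinner z (x - y) = 0" if z: "z \<in> M" for z
  proof (cases "z = 0")
    case False
    \<comment> \<open>Moving \<open>y\<close> along \<open>z\<close> by \<open>t * a\<close> is the
      optimal step. It would lower the squared distance by \<open>t * (cmod a)\<^sup>2\<close>,
      which minimality forbids unless \<open>a\<close> is 0.\<close>
    define a where "a = cinner z (x - y)"
    define t where "t = 1 / (norm z)\<^sup>2"
    have t: "t * (norm z)\<^sup>2 = 1" using False by (simp add: t_def)
    have "y + (of_real t * a) *\<^sub>C z \<in> M" by (intro csubspaceD[OF M(1)] yM z)
    then have "d \<le> (norm ((x - y) - (of_real t * a) *\<^sub>C z))\<^sup>2"
      using dle by (simp add: algebra_simps)
    also have "\<dots> = (norm (x - y))\<^sup>2 - 2 * Re (cinner (x - y) ((of_real t * a) *\<^sub>C z))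
        + (norm ((of_real t * a) *\<^sub>C z))\<^sup>2" by (rule norm_diff_square)
    also have "cinner (x - y) ((of_real t * a) *\<^sub>C z) = of_real t * (a * cnj a)"
      by (simp add: cinner_scaleC_right cinner_commute[of "x - y" z] a_def)
    also have "Re (of_real t * (a * cnj a)) = t * (cmod a)\<^sup>2"
      by (simp add: cmod_power2 flip: power2_eq_square)
    also have "(norm ((of_real t * a) *\<^sub>C z))\<^sup>2 = t * (cmod a)\<^sup>2 * (t * (norm z)\<^sup>2)"
      by (simp add: norm_scaleC norm_mult power_mult_distrib power2_eq_square)
    finally have "t * (cmod a)\<^sup>2 \<le> 0" using yd t by simp
    moreover have "t > 0" using False by (simp add: t_def)
    ultimately have "(cmod a)\<^sup>2 \<le> 0" by (simp add: mult_le_0_iff not_less)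
    then show ?thesis by (simp add: a_def)
  qed simp
  then show ?thesis using yM by blast
qed

lemma orth_proj_eqI:
  assumes "csubspace M" "y \<in> M" "\<And>z. z \<in> M \<Longrightarrow> cinner z (x - y) = 0"
  shows "orth_proj M x = y"
  unfolding orth_proj_def
proof (rule the_equality)
  fix y' assume y': "y' \<in> M \<and> (\<forall>z\<in>M. cinner z (x - y') = 0)"
  then have m: "y' - y \<in> M" using assms by (blast intro: csubspaceD)
  have "cinner (y' - y) ((x - y) - (x - y')) = 0"
    using y' assms(3)[OF m] m by (simp only: cinner_diff_right[of _ "x - y" "x - y'"]) simp
  then show "y' = y" by (simp add: cinner_self)
qed (use assms in auto)

section \<open>Compact positive operators\<close>

text \<open>Gaussian elimination, one equation at a time. It supplies the dimension comparison in
  both halves of the min-max principle: more vectors than constraints leave a nontrivial combination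
  that satisfies the constraints.\<close>

lemma homogeneous_system_nontrivial:
  fixes a :: "'j \<Rightarrow> 'i \<Rightarrow> 'f::field"
  assumes "finite J" "finite I" "card J < card I"
  shows "\<exists>c. (\<exists>i\<in>I. c i \<noteq> 0) \<and> (\<forall>j\<in>J. (\<Sum>i\<in>I. c i * a j i) = 0)"
  using assms
proof (induction J arbitrary: I a rule: finite_induct)
  case empty
  then have "I \<noteq> {}" by auto
  then show ?case by (intro exI[of _ "\<lambda>_. 1"]) auto
next
  case (insert j J)
  show ?case
  proof (cases "\<forall>i\<in>I. a j i = 0")
    case True
    have "card J < card I" using insert by simp
    then obtain c where "\<exists>i\<in>I. c i \<noteq> 0" "\<forall>j\<in>J. (\<Sum>i\<in>I. c i * a j i) = 0"
      using insert.IH[OF insert.prems(1)] by blast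
    then show ?thesis using True by (intro exI[of _ c]) auto
  next
    case False
    then obtain p where p: "p \<in> I" "a j p \<noteq> 0" by blast
    define I' where "I' = I - {p}"
    have I': "finite I'" "card J < card I'" "p \<notin> I'" "I = insert p I'"
      using insert p by (auto simp: I'_def)
    obtain c where c: "\<exists>i\<in>I'. c i \<noteq> 0"
      "\<forall>k\<in>J. (\<Sum>i\<in>I'. c i * (a k i - a k p * a j i / a j p)) = 0"
      using insert.IH[OF I'(1,2), of "\<lambda>k i. a k i - a k p * a j i / a j p"] by blast
    define S where "S = (\<Sum>i\<in>I'. c i * a j i)"
    \<comment> \<open>The value at \<open>p\<close> makes equation \<open>j\<close> hold; the
      coefficients passed to the induction hypothesis already contain the resulting correction of
      the other equations.\<close>
    define c' where "c' i = (if i = p then - S / a j p else c i)" for i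
    have sum: "(\<Sum>i\<in>I. c' i * a k i) = (\<Sum>i\<in>I'. c i * a k i) - S / a j p * a k p" for k
    proof -
      have "(\<Sum>i\<in>I. c' i * a k i) = c' p * a k p + (\<Sum>i\<in>I'. c' i * a k i)"
        using I' by simp
      also have "(\<Sum>i\<in>I'. c' i * a k i) = (\<Sum>i\<in>I'. c i * a k i)"
        by (rule sum.cong) (use I' in \<open>auto simp: c'_def\<close>)
      finally show ?thesis by (simp add: c'_def)
    qed
    have "(\<Sum>i\<in>I. c' i * a k i) = 0" if k: "k \<in> J" for k
    proof -
      have "(\<Sum>i\<in>I'. c i * (a k i - a k p * a j i / a j p))
          = (\<Sum>i\<in>I'. c i * a k i - a k p / a j p * (c i * a j i))"
        by (rule sum.cong) (auto simp: algebra_simps)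
      also have "\<dots> = (\<Sum>i\<in>I'. c i * a k i) - S / a j p * a k p"
        by (simp only: sum_subtractf sum_distrib_left[symmetric] S_def[symmetric]) simp
      finally show ?thesis using c(2) k by (simp add: sum)
    qed
    moreover have "(\<Sum>i\<in>I. c' i * a j i) = 0" unfolding sum using p by (simp add: S_def)
    moreover have "\<exists>i\<in>I. c' i \<noteq> 0"
      using c(1) I' by (force simp: c'_def)
    ultimately show ?thesis by (intro exI[of _ c']) auto
  qed
qed

text \<open>Polarization: that the form is real at \<open>x + y\<close> settles the imaginary part
  of the claim, that it is real at \<open>x + \<i> *\<^sub>C y\<close> the real part.\<close>

lemma symmetric_if_real_form:
  fixes T :: "'h::chilbert_space \<Rightarrow> 'h"
  assumes "bounded_clinear T" "\<And>x. cinner x (T x) \<in> \<real>"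
  shows "cinner (T x) y = cinner x (T y)"
proof -
  define s where "s x y = cinner x (T y)" for x y
  have im: "Im (s x x) = 0" for x using assms(2)[of x] by (simp add: s_def complex_is_Real_iff)
  note lin = s_def cinner_add_left cinner_add_right bounded_clinear_add[OF assms(1)]
    bounded_clinear_scaleC[OF assms(1)] cinner_scaleC_left cinner_scaleC_right
  have "s (x + y) (x + y) = s x x + s x y + s y x + s y y" by (simp add: lin)
  then have 1: "Im (s x y) + Im (s y x) = 0" using im[of "x + y"] im[of x] im[of y] by simp
  have "s (x + \<i> *\<^sub>C y) (x + \<i> *\<^sub>C y) = s x x + \<i> * s x y - \<i> * s y x + s y y"
    by (simp add: lin algebra_simps)
  then have 2: "Re (s x y) - Re (s y x) = 0"
    using im[of "x + \<i> *\<^sub>C y"] im[of x] im[of y] by simp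
  have "s x y = cnj (s y x)" using 1 2 by (simp add: complex_eq_iff)
  then show ?thesis by (simp add: s_def cinner_commute[of "T x"])
qed

lemma adjoint_op_self:
  assumes "\<And>x y. cinner (T x) y = cinner x (T y)"
  shows "adjoint_op T = (T :: 'h::chilbert_space \<Rightarrow> 'h)"
  unfolding adjoint_op_def
proof (rule the_equality)
  fix S assume S: "\<forall>x y. cinner (S x) y = cinner x (T y)"
  show "S = T"
  proof
    fix x show "S x = T x"
      by (rule cinner_eqI) (metis S assms cinner_commute)
  qed
qed (use assms in simp)

text \<open>The largest size of such a family is the number of eigenvalues above \<open>s\<close>,
  with multiplicity. The strict bound \<open>s < r\<close> matches the half-line
  \<open>{s<..}\<close> in \<open>singular_value_fn\<close>.\<close>

definition eigen_family :: "('h::chilbert_space \<Rightarrow> 'h) \<Rightarrow> real \<Rightarrow> 'h set \<Rightarrow> bool" where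
  "eigen_family T s G \<longleftrightarrow> finite G \<and> orthonormal_on G (\<lambda>g. g) \<and> (\<forall>g\<in>G. \<exists>r>s. T g = r *\<^sub>R g)"

lemma eigen_family_empty [simp]: "eigen_family T s {}"
  by (simp add: eigen_family_def orthonormal_on_def)

lemma eigen_family_mono: "eigen_family T s G \<Longrightarrow> s' \<le> s \<Longrightarrow> eigen_family T s' G"
  unfolding eigen_family_def by (meson order_le_less_trans)

lemma eigen_family_insert:
  assumes "eigen_family T s G" "norm w = 1" "\<And>g. g \<in> G \<Longrightarrow> cinner g w = 0" "T w = r *\<^sub>R w" "s < r"
  shows "eigen_family T s (insert w G)" "w \<notin> G"
proof -
  have ww: "cinner w w = 1" using assms(2) by (simp add: cinner_self)
  have "cinner w g = 0" if "g \<in> G" for g using assms(3)[OF that] by (simp add: cinner_eq_0_sym)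
  then show "eigen_family T s (insert w G)"
    using assms ww by (auto simp: eigen_family_def orthonormal_on_def)
  show "w \<notin> G" using ww assms(3) by force
qed

definition spectral_space :: "('h::chilbert_space \<Rightarrow> 'h) \<Rightarrow> real set \<Rightarrow> 'h set" where
  "spectral_space T S = closure (span {v. \<exists>r\<in>S. T v = r *\<^sub>R v})"

lemma spectral_proj_eq: "spectral_proj T S = orth_proj (spectral_space T S)"
  by (simp add: spectral_proj_def spectral_space_def)

lemma csubspace_spectral_space:
  assumes "bounded_clinear T"
  shows "csubspace (spectral_space T S)"
  unfolding spectral_space_def
  by (rule closed_cone_span)
     (auto simp: bounded_clinear_scaleC[OF assms] scaleC_scaleR_commute)

lemma eigenvector_in_spectral_space: "T v = r *\<^sub>R v \<Longrightarrow> r \<in> S \<Longrightarrow> v \<in> spectral_space T S"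
  unfolding spectral_space_def by (rule subsetD[OF closure_subset]) (auto intro: span_base)

text \<open>Compactness is put in the sequential form in which it is applied to a maximising
  sequence in \<open>eigenvector_exists\<close>.\<close>

locale compact_positive =
  fixes T :: "'h::chilbert_space \<Rightarrow> 'h"
  assumes clinear: "bounded_clinear T"
    and positive: "\<And>x. cinner x (T x) \<in> \<real>\<^sub>\<ge>\<^sub>0"
    and compact: "\<And>X :: nat \<Rightarrow> 'h. (\<And>n. norm (X n) \<le> 1) \<Longrightarrow>
      \<exists>r l. strict_mono r \<and> (\<lambda>n. T (X (r n))) \<longlonglongrightarrow> l"
begin

lemma form_nonneg: "0 \<le> Re (cinner x (T x))"
  using positive[of x] by (simp add: complex_nonneg_Reals_iff)

lemma symmetric: "cinner (T x) y = cinner x (T y)"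
  by (rule symmetric_if_real_form[OF clinear]) (use positive nonneg_Reals_subset_Reals in blast)

lemmas T_add = bounded_clinear_add[OF clinear] and T_diff = bounded_clinear_diff[OF clinear]
  and T_scaleC = bounded_clinear_scaleC[OF clinear] and T_sum = bounded_clinear_sum[OF clinear]
  and T_zero = bounded_clinear_zero[OF clinear]

lemma T_scaleR: "T (r *\<^sub>R x) = r *\<^sub>R T x"
  by (simp add: scaleR_as_scaleC T_scaleC)

lemma form_scaleR: "Re (cinner (r *\<^sub>R x) (T (r *\<^sub>R x))) = r\<^sup>2 * Re (cinner x (T x))"
  by (simp add: T_scaleR cinner_scaleR_left cinner_scaleR_right power2_eq_square)

text \<open>A maximising sequence of the Rayleigh quotient consists of approximate eigenvectors.\<close>

lemma eigenvector_exists: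
  assumes V: "csubspace V" "closed V" "\<And>x. x \<in> V \<Longrightarrow> T x \<in> V"
    and v: "v \<in> V" "0 \<le> s" "s * (norm v)\<^sup>2 < Re (cinner v (T v))"
  shows "\<exists>w\<in>V. norm w = 1 \<and> (\<exists>r>s. T w = r *\<^sub>R w)"
proof -
  define R where "R = (\<lambda>v. Re (cinner v (T v)))"
  define N where "N = {v\<in>V. norm v = 1}"
  define r where "r = (SUP v\<in>N. R v)"
  obtain K where K: "\<And>x. norm (T x) \<le> norm x * K"
    using bounded_linear.bounded[OF bounded_clinear_imp_bounded_linear[OF clinear]] by blast
  have bdd: "bdd_above (R ` N)"
  proof (rule bdd_aboveI2)
    fix x assume "x \<in> N"
    then have x: "norm x = 1" by (simp add: N_def)
    have "R x \<le> cmod (cinner x (T x))" unfolding R_def by (rule complex_Re_le_cmod)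
    also have "\<dots> \<le> norm x * norm (T x)" by (rule cinner_Cauchy_Schwarz)
    also have "\<dots> \<le> K" using K[of x] x by simp
    finally show "R x \<le> K" .
  qed
  have v0: "v \<noteq> 0" using v(3) by auto
  define v1 where "v1 = (1 / norm v) *\<^sub>R v"
  have v1: "v1 \<in> N" using v0 csubspaceD(4)[OF V(1) v(1)] by (simp add: v1_def N_def)
  have "R v1 = R v / (norm v)\<^sup>2" unfolding R_def v1_def form_scaleR by (simp add: power_divide)
  then have "s * (norm v)\<^sup>2 < R v1 * (norm v)\<^sup>2" using v(3) v0 by (simp add: R_def)
  then have "s < R v1" using v0 by (simp add: mult_less_cancel_right_pos)
  moreover have Rle: "R x \<le> r" if "x \<in> N" for x unfolding r_def by (rule cSUP_upper[OF that bdd])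
  ultimately have sr: "s < r" using v1 by force
  then have r0: "0 < r" using v(2) by simp
  have Rle': "R x \<le> r * (norm x)\<^sup>2" if "x \<in> V" for x
  proof (cases "x = 0")
    case False
    then have "(1 / norm x) *\<^sub>R x \<in> N" using csubspaceD(4)[OF V(1) that] by (simp add: N_def)
    from Rle[OF this] have "R x / (norm x)\<^sup>2 \<le> r" unfolding R_def form_scaleR by (simp add: power_divide)
    then show ?thesis using False by (simp add: field_simps)
  qed (simp add: R_def T_zero)
  have TT: "(norm (T x))\<^sup>2 \<le> r * R x" if x: "x \<in> V" for x
  proof -
    \<comment> \<open>Nonnegativity of the form at \<open>?y\<close>, together with the bound
      \<open>Rle'\<close> at \<open>T x\<close>, turns the bound on the quadratic form into one on
      the norm of \<open>T x\<close>.\<close>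
    let ?y = "x - (1/r) *\<^sub>R T x"
    have "0 \<le> Re (cinner ?y (T ?y))" by (rule form_nonneg)
    also have "Re (cinner ?y (T ?y)) = R x - 2 / r * (norm (T x))\<^sup>2 + R (T x) / r\<^sup>2"
      by (simp add: R_def T_diff T_scaleR cinner_diff_left cinner_diff_right cinner_scaleR_left
          cinner_scaleR_right symmetric[symmetric, of x] power2_eq_square diff_divide_distrib)
    also have "\<dots> \<le> R x - 2 / r * (norm (T x))\<^sup>2 + (r * (norm (T x))\<^sup>2) / r\<^sup>2"
      using Rle'[OF V(3)[OF x]] by (simp add: divide_right_mono)
    also have "\<dots> = R x - (norm (T x))\<^sup>2 / r"
      using r0 by (simp add: power2_eq_square)
    finally show ?thesis using r0 by (simp add: field_simps)
  qed
  have "\<exists>x\<in>N. r - 1 / real (Suc n) < R x" for n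
    using less_cSUP_iff[OF _ bdd, of "r - 1 / real (Suc n)"] v1 by (auto simp: r_def)
  then obtain X where X: "\<And>n. X n \<in> N" "\<And>n. r - 1 / real (Suc n) < R (X n)" by metis
  then have Xn: "norm (X n) = 1" and XV: "X n \<in> V" for n by (auto simp: N_def)
  obtain \<phi> l where \<phi>: "strict_mono \<phi>" "(\<lambda>n. T (X (\<phi> n))) \<longlonglongrightarrow> l"
    using compact[of X] Xn by auto
  have near: "(norm (T (X n) - r *\<^sub>R X n))\<^sup>2 \<le> r * (1 / real (Suc n))" for n
  proof -
    have "(norm (T (X n) - r *\<^sub>R X n))\<^sup>2 = (norm (T (X n)))\<^sup>2 - 2 * r * R (X n) + r\<^sup>2"
      by (simp add: norm_diff_square cinner_scaleR_right R_def symmetric Xn power_mult_distrib)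
    also have "\<dots> \<le> r * (r - R (X n))" using TT[OF XV, of n] by (simp add: algebra_simps power2_eq_square)
    also have "\<dots> \<le> r * (1 / real (Suc n))" using X(2)[of n] r0 by (intro mult_left_mono) auto
    finally show ?thesis .
  qed
  have lim0: "(\<lambda>n. T (X n) - r *\<^sub>R X n) \<longlonglongrightarrow> 0"
  proof -
    define d where "d n = norm (T (X n) - r *\<^sub>R X n)" for n
    have "(\<lambda>n. r * (1 / real (Suc n))) \<longlonglongrightarrow> r * 0"
      by (intro tendsto_intros LIMSEQ_inverse_real_of_nat[unfolded inverse_eq_divide])
    then have lim: "(\<lambda>n. r * (1 / real (Suc n))) \<longlonglongrightarrow> 0" by (simp only: mult_zero_right)
    have "(\<lambda>n. (d n)\<^sup>2) \<longlonglongrightarrow> 0"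
    proof (rule tendsto_sandwich[OF always_eventually always_eventually tendsto_const lim])
      show "\<forall>n. (d n)\<^sup>2 \<le> r * (1 / real (Suc n))" unfolding d_def using near by blast
    qed simp
    then have "(\<lambda>n. sqrt ((d n)\<^sup>2)) \<longlonglongrightarrow> sqrt 0" by (rule tendsto_real_sqrt)
    moreover have "sqrt ((d n)\<^sup>2) = d n" for n by (simp add: d_def)
    ultimately have "d \<longlonglongrightarrow> 0" by simp
    then show ?thesis unfolding d_def by (rule tendsto_norm_zero_cancel)
  qed
  define w where "w = (1/r) *\<^sub>R l"
  \<comment> \<open>\<open>X (\<phi> n)\<close> is recovered from the convergent
    \<open>T (X (\<phi> n))\<close> and the vanishing residual; one can divide by \<open>r\<close>
    because \<open>0 \<le> s\<close> and \<open>s < r\<close>.\<close>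
  have "(\<lambda>n. (1/r) *\<^sub>R (T (X (\<phi> n)) - (T (X (\<phi> n)) - r *\<^sub>R X (\<phi> n)))) \<longlonglongrightarrow> (1/r) *\<^sub>R (l - 0)"
    by (intro tendsto_scaleR tendsto_const tendsto_diff \<phi>(2)
        LIMSEQ_subseq_LIMSEQ[OF lim0 \<phi>(1), unfolded o_def])
  then have Xw: "(\<lambda>n. X (\<phi> n)) \<longlonglongrightarrow> w" using r0 by (simp add: w_def)
  have wV: "w \<in> V" using closed_sequentially[OF V(2) _ Xw] XV by blast
  have "(\<lambda>n. norm (X (\<phi> n))) \<longlonglongrightarrow> norm w" by (intro tendsto_norm Xw)
  then have wn: "norm w = 1" using Xn by (simp add: LIMSEQ_const_iff)
  have "(\<lambda>n. T (X (\<phi> n))) \<longlonglongrightarrow> T w"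
    by (rule bounded_linear.tendsto[OF bounded_clinear_imp_bounded_linear[OF clinear] Xw])
  then have "T w = l" using \<phi>(2) LIMSEQ_unique by blast
  then have "T w = r *\<^sub>R w" using r0 by (simp add: w_def)
  then show ?thesis using wV wn sr by blast
qed

text \<open>By symmetry of \<open>T\<close> the orthogonal complement of a set of eigenvectors is
  invariant, so \<open>eigenvector_exists\<close> works inside it. This is how an eigenfamily gets
  enlarged.\<close>

lemma eigenvector_orthogonal_exists:
  assumes G: "\<And>g. g \<in> G \<Longrightarrow> \<exists>r. T g = r *\<^sub>R g"
    and v: "\<And>g. g \<in> G \<Longrightarrow> cinner g v = 0" "0 \<le> s" "s * (norm v)\<^sup>2 < Re (cinner v (T v))"
  shows "\<exists>w r. norm w = 1 \<and> s < r \<and> T w = r *\<^sub>R w \<and> (\<forall>g\<in>G. cinner g w = 0)"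
proof -
  let ?V = "{x. \<forall>g\<in>G. cinner g x = 0}"
  have "cinner g (T x) = 0" if x: "x \<in> ?V" and g: "g \<in> G" for x g
  proof -
    obtain r where "T g = r *\<^sub>R g" using G[OF g] by blast
    then have "cinner g (T x) = of_real r * cinner g x"
      by (simp add: cinner_scaleR_left flip: symmetric)
    then show ?thesis using x g by simp
  qed
  then have "\<exists>w\<in>?V. norm w = 1 \<and> (\<exists>r>s. T w = r *\<^sub>R w)"
    by (intro eigenvector_exists csubspace_orthogonal closed_orthogonal) (use v in auto)
  then show ?thesis by auto
qed

text \<open>A family of greatest size exists because the sizes are bounded; an eigenvector
  orthogonal to it would enlarge it.\<close>

lemma maximal_eigen_family:
  assumes "\<And>G. eigen_family T s G \<Longrightarrow> card G \<le> m"
  obtains G where "eigen_family T s G"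
    and "\<And>w r. norm w = 1 \<Longrightarrow> T w = r *\<^sub>R w \<Longrightarrow> s < r \<Longrightarrow> \<exists>g\<in>G. cinner g w \<noteq> 0"
proof -
  have "\<exists>G. eigen_family T s G \<and> (\<forall>H. eigen_family T s H \<longrightarrow> card H \<le> card G)"
    by (rule ex_has_greatest_nat[where k = "{}" and b = "Suc m"])
       (use assms in \<open>auto simp: less_Suc_eq_le\<close>)
  then obtain G where G: "eigen_family T s G" "\<And>H. eigen_family T s H \<Longrightarrow> card H \<le> card G" by blast
  have "\<exists>g\<in>G. cinner g w \<noteq> 0" if "norm w = 1" "T w = r *\<^sub>R w" "s < r" for w r
  proof (rule ccontr)
    assume "\<not> (\<exists>g\<in>G. cinner g w \<noteq> 0)"
    then have "eigen_family T s (insert w G)" "w \<notin> G"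
      using eigen_family_insert[OF G(1)] that by blast+
    moreover have "finite G" using G(1) by (simp add: eigen_family_def)
    ultimately show False using G(2)[of "insert w G"] by simp
  qed
  then show ?thesis using that G(1) by blast
qed

text \<open>Lower half of the min-max principle. A maximal eigenfamily smaller than \<open>I\<close>
  would be orthogonal to a nontrivial combination of the \<open>x i\<close>, on which the form
  exceeds \<open>s\<close>, and so could be enlarged. The strict inequality in \<open>form\<close>
  fails at 0, so \<open>form\<close> also contains the linear independence of the
  \<open>x i\<close>.\<close>

lemma eigen_family_large:
  assumes s: "0 \<le> s" and I: "finite I"
    and form: "\<And>c v. v = (\<Sum>i\<in>I. c i *\<^sub>C x i) \<Longrightarrow> \<exists>i\<in>I. c i \<noteq> 0 \<Longrightarrow>
       s * (norm v)\<^sup>2 < Re (cinner v (T v))"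
  shows "\<exists>G. eigen_family T s G \<and> card I \<le> card G"
proof (rule ccontr)
  assume "\<not> ?thesis"
  then have less: "card G < card I" if "eigen_family T s G" for G using that not_less by blast
  then obtain G where G: "eigen_family T s G"
    and max: "\<And>w r. norm w = 1 \<Longrightarrow> T w = r *\<^sub>R w \<Longrightarrow> s < r \<Longrightarrow> \<exists>g\<in>G. cinner g w \<noteq> 0"
    using maximal_eigen_family[of s "card I"] by (metis less_imp_le)
  have fG: "finite G" and eG: "\<And>g. g \<in> G \<Longrightarrow> \<exists>r. T g = r *\<^sub>R g"
    using G by (auto simp: eigen_family_def)
  obtain c where c: "\<exists>i\<in>I. c i \<noteq> 0" "\<forall>g\<in>G. (\<Sum>i\<in>I. c i * cinner g (x i)) = 0"
    using homogeneous_system_nontrivial[OF fG I less[OF G], of "\<lambda>g i. cinner g (x i)"] by blast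
  define v where "v = (\<Sum>i\<in>I. c i *\<^sub>C x i)"
  have "cinner g v = 0" if "g \<in> G" for g
    using c(2) that by (simp add: v_def cinner_sum_right cinner_scaleC_right)
  then obtain w r where "norm w = 1" "s < r" "T w = r *\<^sub>R w" "\<forall>g\<in>G. cinner g w = 0"
    using eigenvector_orthogonal_exists[OF eG _ s form[OF v_def c(1)]] by blast
  then show False using max by blast
qed

text \<open>Upper half of the min-max principle. More eigenvectors than constraints would leave a
  nontrivial combination of eigenvectors satisfying all constraints, and on it the form exceeds
  \<open>s\<close>.\<close>

lemma eigen_family_small:
  assumes K: "finite K"
    and form: "\<And>v. (\<And>k. k \<in> K \<Longrightarrow> cinner (y k) v = 0) \<Longrightarrow> Re (cinner v (T v)) \<le> s * (norm v)\<^sup>2"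
    and G: "eigen_family T s G"
  shows "card G \<le> card K"
proof (rule ccontr)
  assume "\<not> ?thesis"
  then have less: "card K < card G" by simp
  have fG: "finite G" and on: "orthonormal_on G (\<lambda>g. g)" using G by (auto simp: eigen_family_def)
  obtain r where r: "\<And>g. g \<in> G \<Longrightarrow> s < r g" "\<And>g. g \<in> G \<Longrightarrow> T g = r g *\<^sub>R g"
    using G unfolding eigen_family_def by metis
  obtain c where c: "\<exists>g\<in>G. c g \<noteq> 0" "\<forall>k\<in>K. (\<Sum>g\<in>G. c g * cinner (y k) g) = 0"
    using homogeneous_system_nontrivial[OF K fG less, of "\<lambda>k g. cinner (y k) g"] by blast
  define v where "v = (\<Sum>g\<in>G. c g *\<^sub>C g)"
  have "cinner (y k) v = 0" if "k \<in> K" for k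
    using c(2) that by (simp add: v_def cinner_sum_right cinner_scaleC_right)
  then have le: "Re (cinner v (T v)) \<le> s * (norm v)\<^sup>2" by (rule form)
  have Tv: "T v = (\<Sum>g\<in>G. (of_real (r g) * c g) *\<^sub>C g)"
    unfolding v_def T_sum
    by (rule sum.cong)
       (auto simp: T_scaleC r(2) scaleR_as_scaleC scaleC_scaleC mult.commute)
  have "cinner v (T v) = (\<Sum>g\<in>G. cnj (c g) * (of_real (r g) * c g))"
    unfolding Tv unfolding v_def by (rule cinner_orthonormal_sums[OF on fG]) simp
  then have "Re (cinner v (T v)) = (\<Sum>g\<in>G. Re (cnj (c g) * (of_real (r g) * c g)))"
    by simp
  also have "\<dots> = (\<Sum>g\<in>G. r g * (cmod (c g))\<^sup>2)"
    unfolding cmod_power2 by (rule sum.cong) (auto simp: power2_eq_square algebra_simps)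
  finally have "Re (cinner v (T v)) = (\<Sum>g\<in>G. r g * (cmod (c g))\<^sup>2)" .
  moreover have "s * (norm v)\<^sup>2 = (\<Sum>g\<in>G. s * (cmod (c g))\<^sup>2)"
    unfolding v_def norm_orthonormal_sum[OF on fG order_refl] by (simp add: sum_distrib_left)
  moreover have "(\<Sum>g\<in>G. s * (cmod (c g))\<^sup>2) < (\<Sum>g\<in>G. r g * (cmod (c g))\<^sup>2)"
  proof (rule sum_strict_mono_ex1[OF fG])
    show "\<forall>g\<in>G. s * (cmod (c g))\<^sup>2 \<le> r g * (cmod (c g))\<^sup>2"
      by (intro ballI mult_right_mono) (auto intro: less_imp_le r(1))
    show "\<exists>g\<in>G. s * (cmod (c g))\<^sup>2 < r g * (cmod (c g))\<^sup>2"
    proof -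
      obtain g where g: "g \<in> G" "c g \<noteq> 0" using c(1) by blast
      then have "s * (cmod (c g))\<^sup>2 < r g * (cmod (c g))\<^sup>2"
        using r(1)[OF g(1)] by simp
      then show ?thesis using g(1) by blast
    qed
  qed
  ultimately show False using le by simp
qed

text \<open>Cauchy-Schwarz for a semidefinite form: the form at \<open>x - t *\<^sub>R z\<close> is
  a nonnegative quadratic polynomial in \<open>t\<close> without constant term, so its linear
  coefficient vanishes.\<close>

lemma form_zero:
  assumes zero: "Re (cinner x (T x)) = 0"
  shows "T x = 0"
proof -
  have *: "Re (cinner x (T z)) = 0" for z
  proof -
    define a b where "a = Re (cinner x (T z))" and "b = Re (cinner z (T z))"
    have q: "0 \<le> - 2 * t * a + t\<^sup>2 * b" for t
    proof -
      have "0 \<le> Re (cinner (x - t *\<^sub>R z) (T (x - t *\<^sub>R z)))" by (rule form_nonneg)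
      also have "\<dots> = Re (cinner x (T x)) - t * Re (cinner z (T x))
          - t * Re (cinner x (T z)) + t\<^sup>2 * Re (cinner z (T z))"
        by (simp add: T_diff T_scaleR cinner_diff_left cinner_diff_right cinner_scaleR_left
            cinner_scaleR_right power2_eq_square algebra_simps)
      also have "Re (cinner z (T x)) = Re (cinner x (T z))"
        by (metis symmetric cinner_commute cnj.sel(1))
      finally show ?thesis using zero by (simp add: a_def b_def)
    qed
    have b: "0 \<le> b" unfolding b_def by (rule form_nonneg)
    \<comment> \<open>The minimiser would be \<open>a / b\<close>; the denominator
      \<open>b + 1\<close> is positive even if \<open>b\<close> is 0.\<close>
    define t where "t = a / (b + 1)"
    have tb: "t * (b + 1) = a" using b by (simp add: t_def)
    have "t\<^sup>2 * b \<le> t\<^sup>2 * (b + 1)" by (simp add: mult_left_mono)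
    also have "\<dots> = t * a" by (simp add: power2_eq_square mult.assoc tb)
    finally have "t * a \<le> 0" using q[of t] by simp
    then have "a\<^sup>2 \<le> 0"
      using b by (simp add: t_def divide_le_0_iff power2_eq_square mult_le_0_iff)
    then show ?thesis by (simp add: a_def)
  qed
  have "Re (cinner (T x) (T x)) = 0" using *[of "T x"] by (simp only: symmetric)
  then show ?thesis by simp
qed

text \<open>Uniqueness of the positive root without functional calculus: \<open>R\<close> agrees
  with \<open>T\<close> on each eigenvector of positive eigenvalue, hence on the closed span
  \<open>M\<close>, and on the orthogonal complement of \<open>M\<close> both vanish.\<close>

lemma abs_op_self: "abs_op T = T"
  unfolding abs_op_def adjoint_op_self[of T, OF symmetric]
proof (rule the_equality)
  show "bounded_clinear T \<and> (\<forall>x. cinner x (T x) \<in> \<real>\<^sub>\<ge>\<^sub>0) \<and> T \<circ> T = T \<circ> T"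
    using clinear positive by blast
next
  fix R assume R: "bounded_clinear R \<and> (\<forall>x. cinner x (R x) \<in> \<real>\<^sub>\<ge>\<^sub>0) \<and> R \<circ> R = T \<circ> T"
  then have Rlin: "bounded_clinear R" and Rpos: "\<And>x. cinner x (R x) \<in> \<real>\<^sub>\<ge>\<^sub>0" and RR: "\<And>x. R (R x) = T (T x)"
    by (auto simp: fun_eq_iff)
  have Rsym: "cinner (R x) y = cinner x (R y)" for x y
    by (rule symmetric_if_real_form[OF Rlin]) (use Rpos nonneg_Reals_subset_Reals in blast)
  define M where "M = spectral_space T {0<..}"
  have Msub: "csubspace M" unfolding M_def by (rule csubspace_spectral_space[OF clinear])
  have Mcl: "closed M" by (simp add: M_def spectral_space_def)
  have eig: "R v = T v" if v: "T v = r *\<^sub>R v" "0 < r" for v r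
  proof -
    \<comment> \<open>If nonzero, \<open>w\<close> would be an eigenvector of the positive operator
      \<open>R\<close> with the negative eigenvalue \<open>- r\<close>.\<close>
    define w where "w = R v - r *\<^sub>R v"
    have "R w = (r * r) *\<^sub>R v - r *\<^sub>R R v"
      using RR[of v] v(1) by (simp add: w_def bounded_clinear_diff[OF Rlin] scaleR_as_scaleC
          bounded_clinear_scaleC[OF Rlin] T_scaleC scaleC_scaleC)
    then have "R w = (- r) *\<^sub>R w" by (simp add: w_def algebra_simps)
    then have "cinner w (R w) = of_real (- r * (norm w)\<^sup>2)"
      by (simp add: cinner_scaleR_right cinner_self cinner_minus_right)
    then have "0 \<le> - r * (norm w)\<^sup>2" using Rpos[of w] by (simp add: complex_nonneg_Reals_iff)
    then have "w = 0" using v(2) by (simp add: zero_le_mult_iff mult_le_0_iff)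
    then show ?thesis using v(1) by (simp add: w_def)
  qed
  show "R = T"
  proof
    fix x
    obtain y where y: "y \<in> M" "\<forall>z\<in>M. cinner z (x - y) = 0"
      using projection_exists[OF Msub Mcl] by blast
    have "Re (cinner (x - y) (T (x - y))) = 0"
    proof (rule ccontr)
      assume "Re (cinner (x - y) (T (x - y))) \<noteq> 0"
      then have "0 * (norm (x - y))\<^sup>2 < Re (cinner (x - y) (T (x - y)))"
        using form_nonneg[of "x - y"] by simp
      moreover have "cinner g (x - y) = 0" if "g \<in> {v. \<exists>r\<in>{0<..}. T v = r *\<^sub>R v}" for g
        using y(2) eigenvector_in_spectral_space[of T g _ "{0<..}"] that by (auto simp: M_def)
      ultimately obtain w r where w: "norm w = 1" "0 < r" "T w = r *\<^sub>R w"
        "\<forall>g\<in>{v. \<exists>r\<in>{0<..}. T v = r *\<^sub>R v}. cinner g w = 0"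
        using eigenvector_orthogonal_exists[of "{v. \<exists>r\<in>{0<..}. T v = r *\<^sub>R v}" "x - y" 0] by blast
      then have "cinner w w = 0" by auto
      then show False using w(1) by (simp add: cinner_self)
    qed
    then have Tz: "T (x - y) = 0" by (rule form_zero)
    have "R (R (x - y)) = 0" unfolding RR Tz by (rule T_zero)
    then have "cinner (R (x - y)) (R (x - y)) = 0" by (simp only: Rsym cinner_zero_right)
    then have Rz: "R (x - y) = 0" by (simp add: cinner_self)
    have "subspace {v. R v = T v}"
      by (auto simp: subspace_def bounded_clinear_add[OF Rlin] T_add bounded_clinear_zero[OF Rlin] T_zero
          scaleR_as_scaleC bounded_clinear_scaleC[OF Rlin] T_scaleC)
    then have "span {v. \<exists>r\<in>{0<..}. T v = r *\<^sub>R v} \<subseteq> {v. R v = T v}"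
      by (intro span_minimal) (use eig in auto)
    moreover have "closed {v. R v = T v}"
      by (intro closed_Collect_eq linear_continuous_on bounded_clinear_imp_bounded_linear Rlin clinear)
    ultimately have "M \<subseteq> {v. R v = T v}"
      unfolding M_def spectral_space_def by (intro closure_minimal)
    then have "R y = T y" using y(1) by blast
    then show "R x = T x"
      using Rz Tz by (simp add: bounded_clinear_diff[OF Rlin] T_diff)
  qed
qed

text \<open>A maximal eigenfamily spans every eigenvector above \<open>s\<close>: subtracting the
  projection leaves an eigenvector for the same eigenvalue, because eigenvectors for different
  eigenvalues are orthogonal, and maximality forces it to be 0.\<close>

lemma spectral_proj_eigen_family:
  assumes G: "eigen_family T s G"
    and max: "\<And>w r. norm w = 1 \<Longrightarrow> T w = r *\<^sub>R w \<Longrightarrow> s < r \<Longrightarrow> \<exists>g\<in>G. cinner g w \<noteq> 0"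
  shows "spectral_proj T {s<..} x = (\<Sum>g\<in>G. cinner g x *\<^sub>C g)"
  unfolding spectral_proj_eq
proof (rule orth_proj_eqI[OF csubspace_spectral_space[OF clinear]])
  have fG: "finite G" and on: "orthonormal_on G (\<lambda>g. g)"
    and eG: "\<And>g. g \<in> G \<Longrightarrow> \<exists>r>s. T g = r *\<^sub>R g"
    using G by (auto simp: eigen_family_def)
  have GM: "g \<in> spectral_space T {s<..}" if g: "g \<in> G" for g
    using eG[OF g] by (auto intro: eigenvector_in_spectral_space)
  show "(\<Sum>g\<in>G. cinner g x *\<^sub>C g) \<in> spectral_space T {s<..}"
    by (intro csubspace_sum csubspaceD csubspace_spectral_space clinear GM)
  have orth: "cinner g (u - (\<Sum>g\<in>G. cinner g u *\<^sub>C g)) = 0" if "g \<in> G" for g u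
    using orthonormal_coeff[OF on fG order_refl that, of "\<lambda>g. cinner g u"] that
    by (simp add: cinner_diff_right)
  have eig0: "z = (\<Sum>g\<in>G. cinner g z *\<^sub>C g)" if z: "T z = r *\<^sub>R z" "s < r" for z r
  proof (rule ccontr)
    assume ne: "z \<noteq> (\<Sum>g\<in>G. cinner g z *\<^sub>C g)"
    define u where "u = z - (\<Sum>g\<in>G. cinner g z *\<^sub>C g)"
    have u0: "u \<noteq> 0" using ne by (simp add: u_def)
    have "T (cinner g z *\<^sub>C g) = r *\<^sub>R (cinner g z *\<^sub>C g)" if g: "g \<in> G" for g
    proof -
      obtain p where p: "T g = p *\<^sub>R g" using eG[OF g] by blast
      have "of_real p * cinner g z = of_real r * cinner g z"
        using symmetric[of g z] z(1) p by (simp add: cinner_scaleR_left cinner_scaleR_right)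
      then have "p = r \<or> cinner g z = 0" by (simp add: disj_commute)
      then show ?thesis by (auto simp: T_scaleC p scaleC_scaleR_commute)
    qed
    then have "T u = r *\<^sub>R u"
      by (simp add: u_def T_diff T_sum z(1) scaleR_diff_right scaleR_sum_right)
    then have "T ((1 / norm u) *\<^sub>R u) = r *\<^sub>R ((1 / norm u) *\<^sub>R u)" by (simp add: T_scaleR)
    moreover have "norm ((1 / norm u) *\<^sub>R u) = 1" using u0 by simp
    ultimately obtain g where g: "g \<in> G" "cinner g ((1 / norm u) *\<^sub>R u) \<noteq> 0" using max z(2) by blast
    then show False using orth[OF g(1), of z] by (simp add: cinner_scaleR_right flip: u_def)
  qed
  fix z assume z: "z \<in> spectral_space T {s<..}"
  show "cinner z (x - (\<Sum>g\<in>G. cinner g x *\<^sub>C g)) = 0"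
  proof (rule orthogonal_closure_span[OF _ z[unfolded spectral_space_def]])
    fix z assume "z \<in> {v. \<exists>r\<in>{s<..}. T v = r *\<^sub>R v}"
    then have "z = (\<Sum>g\<in>G. cinner g z *\<^sub>C g)" using eig0 by auto
    then have "cinner z (x - (\<Sum>g\<in>G. cinner g x *\<^sub>C g))
       = cinner (\<Sum>g\<in>G. cinner g z *\<^sub>C g) (x - (\<Sum>g\<in>G. cinner g x *\<^sub>C g))"
      by (rule arg_cong[where f = "\<lambda>w. cinner w (x - (\<Sum>g\<in>G. cinner g x *\<^sub>C g))"])
    also have "\<dots> = 0"
      unfolding cinner_sum_left by (rule sum.neutral) (simp add: cinner_scaleC_left orth)
    finally show "cinner z (x - (\<Sum>g\<in>G. cinner g x *\<^sub>C g)) = 0" .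
  qed
qed

end

section \<open>Traces of projections\<close>

lemma some_orthonormal_basis:
  assumes "\<exists>E :: 'h::chilbert_space set. orthonormal_basis E"
  shows "orthonormal_on (SOME E :: 'h set. orthonormal_basis E) (\<lambda>e. e)"
    "total_family (SOME E :: 'h set. orthonormal_basis E) (\<lambda>e. e)"
proof -
  have "orthonormal_basis (SOME E :: 'h set. orthonormal_basis E)" by (rule someI_ex[OF assms])
  then show "orthonormal_on (SOME E :: 'h set. orthonormal_basis E) (\<lambda>e. e)"
    "total_family (SOME E :: 'h set. orthonormal_basis E) (\<lambda>e. e)"
    unfolding orthonormal_basis_def orthonormal_on_def total_family_def by blast+
qed

text \<open>Bessel's inequality for each \<open>g\<close> after exchanging the sums. The basis is
  the one picked by \<open>SOME\<close> in \<open>trace_pos\<close>, so the existence of some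
  orthonormal basis stays a hypothesis until \<open>orthonormal_basis_exists\<close>.\<close>

lemma trace_pos_finite_rank_le:
  fixes G :: "'h::chilbert_space set"
  assumes ex: "\<exists>E :: 'h set. orthonormal_basis E"
    and fG: "finite G" and on: "orthonormal_on G (\<lambda>g. g)"
    and P: "\<And>x. P x = (\<Sum>g\<in>G. cinner g x *\<^sub>C g)"
  shows "trace_pos P \<le> of_nat (card G)"
proof -
  define E where "E = (SOME E :: 'h set. orthonormal_basis E)"
  have onE: "orthonormal_on E (\<lambda>e. e)" unfolding E_def by (rule some_orthonormal_basis(1)[OF ex])
  have form: "Re (cinner e (P e)) = (\<Sum>g\<in>G. (cmod (cinner e g))\<^sup>2)" for e
  proof -
    have "cinner e (P e) = (\<Sum>g\<in>G. cinner g e * cnj (cinner g e))"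
      unfolding P cinner_sum_right cinner_scaleC_right by (simp add: cinner_commute[of e])
    also have "\<dots> = of_real (\<Sum>g\<in>G. (cmod (cinner g e))\<^sup>2)" by (simp flip: complex_norm_square)
    finally show ?thesis by (simp add: cmod_cinner_commute[of e])
  qed
  have "infsum (\<lambda>e. ennreal (Re (cinner e (P e)))) E \<le> of_nat (card G)"
    unfolding form
  proof (rule infsum_le_finite_sums)
    fix F assume F: "finite F" "F \<subseteq> E"
    have "(\<Sum>e\<in>F. ennreal (\<Sum>g\<in>G. (cmod (cinner e g))\<^sup>2)) = ennreal (\<Sum>e\<in>F. \<Sum>g\<in>G. (cmod (cinner e g))\<^sup>2)"
      by (rule sum_ennreal) (auto intro: sum_nonneg)
    also have "(\<Sum>e\<in>F. \<Sum>g\<in>G. (cmod (cinner e g))\<^sup>2) = (\<Sum>g\<in>G. \<Sum>e\<in>F. (cmod (cinner e g))\<^sup>2)"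
      by (rule sum.swap)
    also have "\<dots> \<le> (\<Sum>g\<in>G. 1)"
    proof (rule sum_mono)
      fix g assume "g \<in> G"
      then have "norm g = 1" using orthonormal_on_norm[OF on] by simp
      then show "(\<Sum>e\<in>F. (cmod (cinner e g))\<^sup>2) \<le> 1"
        using Bessel_inequality[OF onE F, of g] by simp
    qed
    finally show "(\<Sum>e\<in>F. ennreal (\<Sum>g\<in>G. (cmod (cinner e g))\<^sup>2)) \<le> of_nat (card G)"
      by (simp add: ennreal_of_nat_eq_real_of_nat ennreal_leI)
  qed (simp add: nonneg_summable_on_complete)
  then show ?thesis by (simp add: trace_pos_def E_def)
qed

text \<open>The diagonal entry of a projection at \<open>e\<close> is the squared norm of the
  projected \<open>e\<close>, which dominates the Bessel sum over \<open>G\<close>; Parseval sums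
  these to \<open>card G\<close>. The trace may be infinite, so the comparison runs over finite sums
  in \<open>ennreal\<close>.\<close>

lemma trace_pos_orth_proj_ge:
  fixes G :: "'h::chilbert_space set"
  assumes ex: "\<exists>E :: 'h set. orthonormal_basis E"
    and M: "csubspace M" "closed M" and GM: "G \<subseteq> M"
    and fG: "finite G" and on: "orthonormal_on G (\<lambda>g. g)"
  shows "of_nat (card G) \<le> trace_pos (orth_proj M)"
proof -
  define E where "E = (SOME E :: 'h set. orthonormal_basis E)"
  have onE: "orthonormal_on E (\<lambda>e. e)" and tE: "total_family E (\<lambda>e. e)"
    unfolding E_def by (rule some_orthonormal_basis[OF ex])+
  define f where "f e = (\<Sum>g\<in>G. (cmod (cinner e g))\<^sup>2)" for e
  have ge: "f e \<le> Re (cinner e (orth_proj M e))" for e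
  proof -
    obtain y where y: "y \<in> M" "\<forall>z\<in>M. cinner z (e - y) = 0" using projection_exists[OF M] by blast
    have P: "orth_proj M e = y" by (rule orth_proj_eqI[OF M(1)]) (use y in auto)
    have "cinner g e = cinner g y" if "g \<in> G" for g
      using y(2) GM that by (auto simp: cinner_diff_right)
    then have "f e = (\<Sum>g\<in>G. (cmod (cinner g y))\<^sup>2)" by (simp add: f_def cmod_cinner_commute[of e])
    also have "\<dots> \<le> (norm y)\<^sup>2" by (rule Bessel_inequality[OF on fG]) simp
    also have "\<dots> = Re (cinner e y)"
    proof -
      have "cinner y e = cinner y y" using y by (simp add: cinner_diff_right)
      then have "cinner e y = cinner y y" by (metis cinner_commute)
      then show ?thesis by simp
    qed
    finally show ?thesis by (simp add: P)
  qed
  have f0: "0 \<le> f e" for e by (simp add: f_def sum_nonneg)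
  have "(f has_sum (\<Sum>g\<in>G. (norm g)\<^sup>2)) E"
    unfolding f_def using fG
    by (induction G rule: finite_induct) (auto intro: has_sum_add Parseval[OF onE tE])
  moreover have "(\<Sum>g\<in>G. (norm g)\<^sup>2) = real (card G)"
    using orthonormal_on_norm[OF on] by simp
  ultimately have hs: "(f has_sum real (card G)) E" by simp
  have "of_nat (card G) = ennreal (infsum f E)"
    using infsumI[OF hs] by (simp add: ennreal_of_nat_eq_real_of_nat)
  also have "\<dots> = (SUP F\<in>{F. finite F \<and> F \<subseteq> E}. ennreal (sum f F))"
    by (rule infsum_nonneg_is_SUPREMUM_ennreal) (use hs f0 in \<open>auto simp: summable_on_def\<close>)
  also have "\<dots> \<le> (SUP F\<in>{F. finite F \<and> F \<subseteq> E}. (\<Sum>e\<in>F. ennreal (Re (cinner e (orth_proj M e)))))"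
  proof (rule SUP_mono')
    fix F
    have "ennreal (sum f F) = (\<Sum>e\<in>F. ennreal (f e))" by (rule sum_ennreal[symmetric]) (rule f0)
    also have "\<dots> \<le> (\<Sum>e\<in>F. ennreal (Re (cinner e (orth_proj M e))))"
      by (intro sum_mono ennreal_leI ge)
    finally show "ennreal (sum f F) \<le> (\<Sum>e\<in>F. ennreal (Re (cinner e (orth_proj M e))))" .
  qed
  also have "\<dots> = infsum (\<lambda>e. ennreal (Re (cinner e (orth_proj M e)))) E"
    by (rule nonneg_infsum_complete[symmetric]) simp
  finally show ?thesis by (simp add: trace_pos_def E_def)
qed

section \<open>Min-max bounds for the singular value function\<close>

context compact_positive
begin

lemma trace_spectral_proj_le:
  assumes "\<exists>E :: 'h set. orthonormal_basis E"
    and le: "\<And>G. eigen_family T s G \<Longrightarrow> card G \<le> m"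
  shows "trace_pos (spectral_proj T {s<..}) \<le> of_nat m"
proof -
  obtain G where G: "eigen_family T s G"
    and max: "\<And>w r. norm w = 1 \<Longrightarrow> T w = r *\<^sub>R w \<Longrightarrow> s < r \<Longrightarrow> \<exists>g\<in>G. cinner g w \<noteq> 0"
    using maximal_eigen_family[OF le] by blast
  have "trace_pos (spectral_proj T {s<..}) \<le> of_nat (card G)"
    by (rule trace_pos_finite_rank_le[OF assms(1)])
       (use G in \<open>auto simp: eigen_family_def intro: spectral_proj_eigen_family[OF G max]\<close>)
  also have "\<dots> \<le> of_nat m" using le[OF G] by simp
  finally show ?thesis .
qed

lemma trace_spectral_proj_ge:
  assumes "\<exists>E :: 'h set. orthonormal_basis E" and G: "eigen_family T s G"
  shows "of_nat (card G) \<le> trace_pos (spectral_proj T {s<..})"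
  unfolding spectral_proj_eq
proof (rule trace_pos_orth_proj_ge[OF assms(1) csubspace_spectral_space[OF clinear]])
  show "G \<subseteq> spectral_space T {s<..}"
    using G by (auto simp: eigen_family_def intro: eigenvector_in_spectral_space)
qed (use G in \<open>auto simp: eigen_family_def spectral_space_def\<close>)

text \<open>At most \<open>t\<close> constraints bring the form below \<open>s\<close>, so at most
  \<open>t\<close> eigenvalues exceed \<open>s\<close>, and \<open>s\<close> belongs to the set
  whose infimum is taken.\<close>

lemma singular_value_fn_le:
  assumes ex: "\<exists>E :: 'h set. orthonormal_basis E"
    and s: "0 \<le> s" and K: "finite K" "real (card K) \<le> t"
    and form: "\<And>v. (\<And>k. k \<in> K \<Longrightarrow> cinner (y k) v = 0) \<Longrightarrow> Re (cinner v (T v)) \<le> s * (norm v)\<^sup>2"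
  shows "singular_value_fn t T \<le> s"
  unfolding singular_value_fn_def abs_op_self
proof (rule cInf_lower)
  have "trace_pos (spectral_proj T {s<..}) \<le> of_nat (card K)"
    by (rule trace_spectral_proj_le[OF ex]) (rule eigen_family_small[OF K(1) form])
  also have "\<dots> \<le> ennreal t" using K(2) by (simp add: ennreal_of_nat_eq_real_of_nat ennreal_leI)
  finally show "s \<in> {s. 0 \<le> s \<and> trace_pos (spectral_proj T {s<..}) \<le> ennreal t}" using s by simp
qed (auto intro: bdd_belowI[of _ 0])

text \<open>No eigenvalue exceeds an operator bound for \<open>T\<close>, so this bound belongs to
  the set. It ensures that the infimum in \<open>singular_value_fn\<close> is not one of the empty
  set.\<close>

lemma singular_value_fn_set_nonempty:
  assumes "\<exists>E :: 'h set. orthonormal_basis E"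
  shows "{s. 0 \<le> s \<and> trace_pos (spectral_proj T {s<..}) \<le> ennreal t} \<noteq> {}"
proof -
  obtain K where K: "\<And>x. norm (T x) \<le> norm x * K" "0 \<le> K"
    using bounded_linear.nonneg_bounded[OF bounded_clinear_imp_bounded_linear[OF clinear]] by blast
  have "G = {}" if G: "eigen_family T K G" for G
  proof (rule ccontr)
    assume "G \<noteq> {}"
    then obtain g r where g: "g \<in> G" "K < r" "T g = r *\<^sub>R g" using G unfolding eigen_family_def by blast
    have "norm g = 1" using G g(1) orthonormal_on_norm[of G "\<lambda>g. g" g] by (auto simp: eigen_family_def)
    then show False using K(1)[of g] K(2) g by simp
  qed
  then have "trace_pos (spectral_proj T {K<..}) \<le> of_nat 0"
    by (intro trace_spectral_proj_le[OF assms]) (metis card.empty order_refl)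
  then show ?thesis using K(2) by auto
qed

lemma singular_value_fn_nonneg:
  assumes "\<exists>E :: 'h set. orthonormal_basis E"
  shows "0 \<le> singular_value_fn t T"
  unfolding singular_value_fn_def abs_op_self
  by (rule cInf_greatest[OF singular_value_fn_set_nonempty[OF assms]]) simp

text \<open>An admissible \<open>p < s\<close> would have an eigenfamily of size at least
  \<open>card I\<close> above it, which the bound \<open>t\<close> on the trace excludes.\<close>

lemma singular_value_fn_ge:
  assumes ex: "\<exists>E :: 'h set. orthonormal_basis E"
    and s: "0 \<le> s" and t: "0 \<le> t" and I: "finite I" "t < real (card I)"
    and form: "\<And>c v. v = (\<Sum>i\<in>I. c i *\<^sub>C x i) \<Longrightarrow> \<exists>i\<in>I. c i \<noteq> 0 \<Longrightarrow>
       s * (norm v)\<^sup>2 < Re (cinner v (T v))"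
  shows "s \<le> singular_value_fn t T"
  unfolding singular_value_fn_def abs_op_self
proof (rule cInf_greatest[OF singular_value_fn_set_nonempty[OF ex]])
  fix p assume p: "p \<in> {s. 0 \<le> s \<and> trace_pos (spectral_proj T {s<..}) \<le> ennreal t}"
  obtain G where G: "eigen_family T s G" "card I \<le> card G"
  proof -
    have "\<exists>G. eigen_family T s G \<and> card I \<le> card G"
      by (rule eigen_family_large[where x = x, OF s I(1)]) (rule form)
    then show ?thesis using that by blast
  qed
  show "s \<le> p"
  proof (rule ccontr)
    assume "\<not> s \<le> p"
    then have "eigen_family T p G" using eigen_family_mono[OF G(1)] by simp
    then have "of_nat (card G) \<le> trace_pos (spectral_proj T {p<..})"
      by (rule trace_spectral_proj_ge[OF ex])
    also have "\<dots> \<le> ennreal t" using p by simp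
    finally have "of_nat (card G) \<le> ennreal t" .
    then have "real (card G) \<le> t" using t by (simp add: ennreal_of_nat_eq_real_of_nat)
    then show False using G(2) I(2) by simp
  qed
qed

end

section \<open>Lattice points in balls\<close>

definition lattice_vec :: "int^'d \<Rightarrow> real^'d::finite" where
  "lattice_vec q = (\<chi> j. real_of_int (q $ j))"

lemma lattice_vec_nth [simp]: "lattice_vec q $ j = real_of_int (q $ j)"
  by (simp add: lattice_vec_def)

lemma norm_lattice_vec_square: "(norm (lattice_vec q))\<^sup>2 = (\<Sum>j\<in>UNIV. (real_of_int (q $ j))\<^sup>2)"
  unfolding power2_norm_eq_inner inner_vec_def by (simp add: power2_eq_square)

lemma finite_int_box: "finite {q :: int^'d::finite. \<forall>j. a \<le> q $ j \<and> q $ j \<le> b}"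
proof -
  have "{q :: int^'d. \<forall>j. a \<le> q $ j \<and> q $ j \<le> b} \<subseteq> vec_lambda ` (UNIV \<rightarrow>\<^sub>E {a..b})"
  proof
    fix q :: "int^'d" assume "q \<in> {q. \<forall>j. a \<le> q $ j \<and> q $ j \<le> b}"
    then have "vec_nth q \<in> UNIV \<rightarrow>\<^sub>E {a..b}" by auto
    then show "q \<in> vec_lambda ` (UNIV \<rightarrow>\<^sub>E {a..b})" by (metis image_eqI vec_nth_inverse)
  qed
  then show ?thesis by (rule finite_subset) (intro finite_imageI finite_PiE; simp)
qed

lemma finite_lattice_ball: "finite {q :: int^'d::finite. norm (lattice_vec q) \<le> \<rho>}"
proof (rule finite_subset[OF _ finite_int_box[of "- \<lceil>\<rho>\<rceil>" "\<lceil>\<rho>\<rceil>"]])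
  show "{q :: int^'d. norm (lattice_vec q) \<le> \<rho>} \<subseteq> {q. \<forall>j. - \<lceil>\<rho>\<rceil> \<le> q $ j \<and> q $ j \<le> \<lceil>\<rho>\<rceil>}"
  proof (intro subsetI CollectI allI)
    fix q :: "int^'d" and j assume "q \<in> {q. norm (lattice_vec q) \<le> \<rho>}"
    then have "\<bar>real_of_int (q $ j)\<bar> \<le> \<rho>"
      using component_le_norm_cart[of "lattice_vec q" j] by simp
    then show "- \<lceil>\<rho>\<rceil> \<le> q $ j \<and> q $ j \<le> \<lceil>\<rho>\<rceil>" by linarith
  qed
qed

definition lattice_count :: "'d::finite itself \<Rightarrow> real \<Rightarrow> nat" where
  "lattice_count _ \<rho> = card {q :: int^'d. norm (lattice_vec q) \<le> \<rho>}"

definition lattice_cube :: "int^'d \<Rightarrow> (real^'d::finite) set" where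
  "lattice_cube q = cbox (lattice_vec q) (lattice_vec q + 1)"

lemma in_lattice_cube: "x \<in> lattice_cube q \<longleftrightarrow> (\<forall>j. real_of_int (q $ j) \<le> x $ j \<and> x $ j \<le> real_of_int (q $ j) + 1)"
  by (simp add: lattice_cube_def mem_box_cart)

lemma norm_diff_lattice_cube:
  assumes "x \<in> lattice_cube q"
  shows "norm (x - lattice_vec q :: real^'d::finite) \<le> real CARD('d)"
proof -
  have "norm (x - lattice_vec q) \<le> (\<Sum>j\<in>UNIV. \<bar>(x - lattice_vec q) $ j\<bar>)" by (rule norm_le_l1_cart)
  also have "\<dots> \<le> (\<Sum>j\<in>(UNIV :: 'd set). 1)"
    by (rule sum_mono) (use assms in \<open>auto simp: in_lattice_cube abs_le_iff algebra_simps intro: add_increasing\<close>)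
  finally show ?thesis by simp
qed

text \<open>Distinct closed unit cubes overlap at most in a coordinate hyperplane, so the measure of
  the union counts them.\<close>

lemma measure_lattice_cubes:
  assumes "finite S"
  shows "measure lebesgue (\<Union>q\<in>S. lattice_cube (q :: int^'d::finite)) = real (card S)"
proof -
  have "measure lebesgue (\<Union>q\<in>S. lattice_cube q) = (\<Sum>q\<in>S. measure lebesgue (lattice_cube q))"
  proof (rule measure_negligible_finite_Union_image[OF assms])
    show "pairwise (\<lambda>p q. negligible (lattice_cube p \<inter> lattice_cube q)) S"
    proof (rule pairwiseI)
      fix p q :: "int^'d" assume "p \<noteq> q"
      then obtain j where j: "p $ j \<noteq> q $ j" by (auto simp: vec_eq_iff)
      define c where "c = real_of_int (max (p $ j) (q $ j))"
      have "lattice_cube p \<inter> lattice_cube q \<subseteq> {x. x $ j = c}"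
      proof (intro subsetI CollectI)
        fix x assume "x \<in> lattice_cube p \<inter> lattice_cube q"
        then have "real_of_int (p $ j) \<le> x $ j \<and> x $ j \<le> real_of_int (p $ j) + 1"
          "real_of_int (q $ j) \<le> x $ j \<and> x $ j \<le> real_of_int (q $ j) + 1"
          by (auto simp: in_lattice_cube)
        with j show "x $ j = c" unfolding c_def by linarith
      qed
      then show "negligible (lattice_cube p \<inter> lattice_cube q)"
        by (rule negligible_subset[rotated])
          (simp add: cart_eq_inner_axis negligible_standard_hyperplane)
    qed
  qed (simp add: lattice_cube_def)
  moreover have "measure lebesgue (lattice_cube q) = 1" for q :: "int^'d"
  proof -
    have "lattice_vec q \<in> lattice_cube q" by (simp add: in_lattice_cube)
    then have "lattice_cube q \<noteq> {}" by blast
    then show ?thesis unfolding lattice_cube_def by (simp add: content_cbox_cart)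
  qed
  ultimately show ?thesis by simp
qed

text \<open>The unit cubes at the counted points lie in the ball enlarged by
  \<open>CARD('d)\<close>, a crude bound for the diameter of a cube.\<close>

lemma lattice_count_le:
  assumes "0 \<le> \<rho> + real CARD('d::finite)"
  shows "real (lattice_count TYPE('d) \<rho>) \<le> unit_ball_vol (real CARD('d)) * (\<rho> + real CARD('d)) ^ CARD('d)"
proof -
  let ?S = "{q :: int^'d. norm (lattice_vec q) \<le> \<rho>}"
  have "real (lattice_count TYPE('d) \<rho>) = measure lebesgue (\<Union>q\<in>?S. lattice_cube q)"
    by (simp add: lattice_count_def measure_lattice_cubes finite_lattice_ball)
  also have "\<dots> \<le> measure lebesgue (cball (0 :: real^'d) (\<rho> + real CARD('d)))"
  proof (rule measure_mono_fmeasurable)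
    show "(\<Union>q\<in>?S. lattice_cube q) \<subseteq> cball 0 (\<rho> + real CARD('d))"
    proof
      fix x assume "x \<in> (\<Union>q\<in>?S. lattice_cube q)"
      then obtain q where q: "norm (lattice_vec q) \<le> \<rho>" "x \<in> lattice_cube q" by blast
      have "norm x \<le> norm (lattice_vec q) + norm (x - lattice_vec q)" by (rule norm_triangle_sub)
      then show "x \<in> cball 0 (\<rho> + real CARD('d))" using norm_diff_lattice_cube[OF q(2)] q(1) by simp
    qed
    show "(\<Union>q\<in>?S. lattice_cube q) \<in> sets lebesgue"
      by (intro sets.finite_UN finite_lattice_ball) (simp add: lattice_cube_def)
  qed simp
  finally show ?thesis using assms by (simp add: content_cball)
qed

text \<open>Rounding down the coordinates puts every point of the shrunken ball into the cube of a
  counted point.\<close>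

lemma lattice_count_ge:
  assumes "real CARD('d::finite) \<le> \<rho>"
  shows "unit_ball_vol (real CARD('d)) * (\<rho> - real CARD('d)) ^ CARD('d) \<le> real (lattice_count TYPE('d) \<rho>)"
proof -
  let ?S = "{q :: int^'d. norm (lattice_vec q) \<le> \<rho>}"
  have "unit_ball_vol (real CARD('d)) * (\<rho> - real CARD('d)) ^ CARD('d)
      = measure lebesgue (cball (0 :: real^'d) (\<rho> - real CARD('d)))"
    using assms by (simp add: content_cball)
  also have "\<dots> \<le> measure lebesgue (\<Union>q\<in>?S. lattice_cube q)"
  proof (rule measure_mono_fmeasurable)
    show "cball 0 (\<rho> - real CARD('d)) \<subseteq> (\<Union>q\<in>?S. lattice_cube q)"
    proof
      fix x :: "real^'d" assume x: "x \<in> cball 0 (\<rho> - real CARD('d))"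
      define q :: "int^'d" where "q = (\<chi> j. \<lfloor>x $ j\<rfloor>)"
      have q: "x \<in> lattice_cube q" by (simp add: in_lattice_cube q_def)
      have "norm (lattice_vec q) \<le> norm x + norm (lattice_vec q - x)" by (rule norm_triangle_sub)
      then have "norm (lattice_vec q) \<le> \<rho>"
        using norm_diff_lattice_cube[OF q] x by (simp add: norm_minus_commute)
      then show "x \<in> (\<Union>q\<in>?S. lattice_cube q)" using q by blast
    qed
    show "(\<Union>q\<in>?S. lattice_cube q) \<in> lmeasurable"
      by (intro fmeasurable.finite_UN finite_lattice_ball) (simp add: lattice_cube_def)
  qed simp
  also have "\<dots> = real (lattice_count TYPE('d) \<rho>)"
    by (simp add: lattice_count_def measure_lattice_cubes finite_lattice_ball)
  finally show ?thesis .
qed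

text \<open>Moving the factor \<open>s\<close> into the power as \<open>s powr (1 / real n)\<close>
  turns the shift \<open>c\<close> into a vanishing term.\<close>

lemma scaled_power_tendsto:
  fixes a L c :: real
  assumes "0 < a" "0 < L" "0 < n"
  shows "((\<lambda>s. s * ((a / s) powr (1 / real n) / L + c) ^ n) \<longlongrightarrow> a / L ^ n) (at_right 0)"
proof -
  have root: "(x powr (1 / real n)) ^ n = x" if "0 < x" for x :: real
    using assms(3) that by (simp add: powr_realpow[symmetric] powr_powr)
  have "((\<lambda>s::real. s powr (1 / real n)) \<longlongrightarrow> 0 powr (1 / real n)) (at_right 0)"
    by (intro tendsto_powr' tendsto_intros)
       (use assms(3) in \<open>auto simp: eventually_at_right_field intro: exI[of _ 1]\<close>)
  then have "((\<lambda>s. (a powr (1 / real n) / L + s powr (1 / real n) * c) ^ n) \<longlongrightarrow>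
      (a powr (1 / real n) / L + 0 * c) ^ n) (at_right 0)"
    by (intro tendsto_intros) simp_all
  moreover have "(a powr (1 / real n) / L + 0 * c) ^ n = a / L ^ n"
    using assms by (simp add: power_divide root)
  moreover have "\<forall>\<^sub>F s in at_right 0. (a powr (1 / real n) / L + s powr (1 / real n) * c) ^ n
      = s * ((a / s) powr (1 / real n) / L + c) ^ n"
  proof (rule eventually_at_rightI[of 0 1])
    fix s :: real assume "s \<in> {0<..<1}"
    then have s: "0 < s" by simp
    then have "s powr (1 / real n) \<noteq> 0" by simp
    then have "a powr (1 / real n) / L + s powr (1 / real n) * c
        = s powr (1 / real n) * ((a / s) powr (1 / real n) / L + c)"
      using s assms by (simp add: powr_divide field_simps)
    then show "(a powr (1 / real n) / L + s powr (1 / real n) * c) ^ n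
        = s * ((a / s) powr (1 / real n) / L + c) ^ n"
      using root[OF s] by (simp add: power_mult_distrib)
  qed simp
  ultimately show ?thesis by (simp only: Lim_transform_eventually)
qed

lemma real_powr_at_top:
  assumes "0 < p"
  shows "filterlim (\<lambda>x::real. x powr p) at_top at_top"
proof -
  have "filterlim (\<lambda>x::real. exp (p * ln x)) at_top at_top"
    by (intro filterlim_compose[OF exp_at_top] filterlim_tendsto_pos_mult_at_top[OF tendsto_const]
        assms ln_at_top)
  then show ?thesis
    by (rule filterlim_mono_eventually[OF _ order_refl order_refl])
       (auto simp: powr_def intro: eventually_mono[OF eventually_gt_at_top[of 0]])
qed

text \<open>The radius, in units of cells of side \<open>L\<close>, is where the
  \<open>CARD('d)\<close>-th power of the actual length reaches \<open>a / s\<close>. Any bounded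
  correction \<open>c\<close> of the radius disappears in the limit.\<close>

lemma lattice_count_tendsto:
  fixes a L c :: real
  assumes "0 < a" "0 < L"
  shows "((\<lambda>s. s * real (lattice_count TYPE('d::finite) ((a / s) powr (1 / real CARD('d)) / L + c)))
    \<longlongrightarrow> unit_ball_vol (real CARD('d)) * a / L ^ CARD('d)) (at_right 0)"
proof -
  let ?n = "CARD('d)" and ?\<omega> = "unit_ball_vol (real CARD('d))"
  define y where "y s = (a / s) powr (1 / real ?n) / L + c" for s
  have n: "0 < ?n" by simp
  have top: "filterlim y at_top (at_right 0)"
  proof -
    have "filterlim (\<lambda>s. a / s) at_top (at_right 0)"
      using filterlim_tendsto_pos_mult_at_top[OF tendsto_const assms(1) filterlim_inverse_at_top_right]
      by (simp add: divide_inverse)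
    then have "filterlim (\<lambda>s. (a / s) powr (1 / real ?n)) at_top (at_right 0)"
      by (rule filterlim_compose[OF real_powr_at_top, rotated]) simp
    then have "filterlim (\<lambda>s. (1 / L) * (a / s) powr (1 / real ?n)) at_top (at_right 0)"
      using assms(2) by (intro filterlim_tendsto_pos_mult_at_top[OF tendsto_const]) auto
    then have "filterlim (\<lambda>s. c + (1 / L) * (a / s) powr (1 / real ?n)) at_top (at_right 0)"
      by (rule filterlim_tendsto_add_at_top[OF tendsto_const])
    then show ?thesis unfolding y_def by (simp add: add.commute[of c])
  qed
  have sq: "((\<lambda>s. ?\<omega> * (s * (y s + e) ^ ?n)) \<longlongrightarrow> ?\<omega> * (a / L ^ ?n)) (at_right 0)" for e
    using scaled_power_tendsto[OF assms n, of "c + e"]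
    by (intro tendsto_mult tendsto_const) (simp add: y_def add.assoc)
  have big: "\<forall>\<^sub>F s in at_right 0. real ?n \<le> y s \<and> 0 < s"
    using top eventually_at_right_less[of "0::real"]
    by (auto simp: filterlim_at_top elim: eventually_elim2)
  have "((\<lambda>s. s * real (lattice_count TYPE('d) (y s))) \<longlongrightarrow> ?\<omega> * (a / L ^ ?n)) (at_right 0)"
  proof (rule tendsto_sandwich[OF _ _ sq[of "- real ?n"] sq[of "real ?n"]])
    show "\<forall>\<^sub>F s in at_right 0. ?\<omega> * (s * (y s + - real ?n) ^ ?n) \<le> s * real (lattice_count TYPE('d) (y s))"
      using big
    proof eventually_elim
      case (elim s)
      then have "s * (?\<omega> * (y s - real ?n) ^ ?n) \<le> s * real (lattice_count TYPE('d) (y s))"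
        by (intro mult_left_mono lattice_count_ge) auto
      then show ?case by (simp add: mult_ac)
    qed
    show "\<forall>\<^sub>F s in at_right 0. s * real (lattice_count TYPE('d) (y s)) \<le> ?\<omega> * (s * (y s + real ?n) ^ ?n)"
      using big
    proof eventually_elim
      case (elim s)
      then have "s * real (lattice_count TYPE('d) (y s)) \<le> s * (?\<omega> * (y s + real ?n) ^ ?n)"
        by (intro mult_left_mono lattice_count_le) auto
      then show ?case by (simp add: mult_ac)
    qed
  qed
  then show ?thesis by (simp add: y_def)
qed

section \<open>Surface area of the unit sphere\<close>

lemma sphere_neighbourhood:
  assumes "0 < \<epsilon>" "\<epsilon> < 1"
  shows "(\<Union>x\<in>sphere (0 :: real^'d::finite) 1. cball x \<epsilon>) = cball 0 (1 + \<epsilon>) - ball 0 (1 - \<epsilon>)"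
proof (intro equalityI subsetI)
  fix y :: "real^'d" assume "y \<in> (\<Union>x\<in>sphere 0 1. cball x \<epsilon>)"
  then obtain x where x: "norm x = 1" "norm (x - y) \<le> \<epsilon>" by (auto simp: dist_norm)
  have "norm y \<le> norm x + norm (y - x)" "norm x \<le> norm y + norm (x - y)" by (rule norm_triangle_sub)+
  then show "y \<in> cball 0 (1 + \<epsilon>) - ball 0 (1 - \<epsilon>)" using x by (simp add: norm_minus_commute)
next
  fix y :: "real^'d" assume "y \<in> cball 0 (1 + \<epsilon>) - ball 0 (1 - \<epsilon>)"
  then have y: "norm y \<le> 1 + \<epsilon>" "1 - \<epsilon> \<le> norm y" by auto
  \<comment> \<open>The radial projection is the point of the sphere nearest to \<open>y\<close>;
    \<open>\<epsilon> < 1\<close> keeps \<open>y\<close> away from the origin.\<close>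
  define x where "x = (1 / norm y) *\<^sub>R y"
  have y0: "0 < norm y" using y assms by linarith
  then have "x \<in> sphere 0 1" by (simp add: x_def)
  moreover have "norm (x - y) \<le> \<epsilon>"
  proof -
    have "x - y = (1 / norm y - 1) *\<^sub>R y" by (simp add: x_def algebra_simps)
    then have "norm (x - y) = \<bar>1 / norm y - 1\<bar> * \<bar>norm y\<bar>" by simp
    also have "\<dots> = \<bar>(1 / norm y - 1) * norm y\<bar>" by (rule abs_mult[symmetric])
    also have "(1 / norm y - 1) * norm y = 1 - norm y" using y0 by (simp add: left_diff_distrib)
    finally show ?thesis using y by simp
  qed
  ultimately show "y \<in> (\<Union>x\<in>sphere 0 1. cball x \<epsilon>)" by (auto simp: dist_norm)
qed

text \<open>The neighbourhood is a shell. Its volume divided by \<open>2 * \<epsilon>\<close> is the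
  volume of the unit ball times a symmetric difference quotient at 1 of the power with exponent
  \<open>CARD('d)\<close>.\<close>

lemma surface_area_unit_sphere:
  "surface_area (sphere (0 :: real^'d::finite) 1) = real CARD('d) * unit_ball_vol (real CARD('d))"
proof -
  let ?n = "CARD('d)" and ?\<omega> = "unit_ball_vol (real CARD('d))"
  define f where "f \<epsilon> = (1 + \<epsilon>) ^ ?n - (1 - \<epsilon>) ^ ?n" for \<epsilon> :: real
  have "(f has_real_derivative 2 * real ?n) (at 0)"
    unfolding f_def by (auto intro!: derivative_eq_intros)
  then have "((\<lambda>\<epsilon>. f \<epsilon> / \<epsilon>) \<longlongrightarrow> 2 * real ?n) (at 0)"
    by (simp add: has_field_derivative_iff f_def)
  then have "((\<lambda>\<epsilon>. ?\<omega> / 2 * (f \<epsilon> / \<epsilon>)) \<longlongrightarrow> ?\<omega> / 2 * (2 * real ?n)) (at_right 0)"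
    by (intro tendsto_mult tendsto_const) (rule filterlim_mono[OF _ order_refl at_le], auto)
  moreover have "\<forall>\<^sub>F \<epsilon> in at_right 0. ?\<omega> / 2 * (f \<epsilon> / \<epsilon>)
      = measure lebesgue (\<Union>x\<in>sphere (0 :: real^'d) 1. cball x \<epsilon>) / (2 * \<epsilon>)"
  proof (rule eventually_at_rightI[of 0 1])
    fix \<epsilon> :: real assume "\<epsilon> \<in> {0<..<1}"
    then have e: "0 < \<epsilon>" "\<epsilon> < 1" by auto
    have "measure lebesgue (cball 0 (1 + \<epsilon>) - ball 0 (1 - \<epsilon>) :: (real^'d) set)
        = measure lebesgue (cball 0 (1 + \<epsilon>) :: (real^'d) set) - measure lebesgue (ball 0 (1 - \<epsilon>) :: (real^'d) set)"
      by (rule measurable_measure_Diff) (use e in \<open>auto simp: subset_eq\<close>)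
    also have "\<dots> = ?\<omega> * f \<epsilon>"
      using e by (simp add: content_cball content_ball f_def algebra_simps)
    finally show "?\<omega> / 2 * (f \<epsilon> / \<epsilon>)
      = measure lebesgue (\<Union>x\<in>sphere (0 :: real^'d) 1. cball x \<epsilon>) / (2 * \<epsilon>)"
      by (simp add: sphere_neighbourhood[OF e])
  qed simp
  ultimately have "((\<lambda>\<epsilon>. measure lebesgue (\<Union>x\<in>sphere (0 :: real^'d) 1. cball x \<epsilon>) / (2 * \<epsilon>))
      \<longlongrightarrow> ?\<omega> / 2 * (2 * real ?n)) (at_right 0)"
    by (rule Lim_transform_eventually)
  then show ?thesis
    unfolding surface_area_def by (simp add: tendsto_Lim mult.commute)
qed

section \<open>Monomials in the generators\<close>

context cstar_algebra
begin

lemma ring_A: "ring A"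
  by unfold_locales

text \<open>The names of the ring laws denote, in this locale, the laws of the scalar ring.\<close>

lemmas A_m_assoc = monoid.m_assoc[OF ring.is_monoid[OF ring_A]]
  and A_m_closed [intro, simp] = monoid.m_closed[OF ring.is_monoid[OF ring_A]]
  and A_units_group = monoid.units_group[OF ring.is_monoid[OF ring_A]]
  and A_Units_pow_closed = monoid.Units_pow_closed[OF ring.is_monoid[OF ring_A]]
  and A_inv_unique = monoid.inv_unique'[OF ring.is_monoid[OF ring_A]]
  and A_a_assoc = ring.ring_simprules(7)[OF ring_A]
  and A_l_distr = ring.ring_simprules(13)[OF ring_A]
  and A_r_distr = ring.ring_simprules(23)[OF ring_A]
  and A_minus_equality = abelian_group.minus_equality[OF ring.is_abelian_group[OF ring_A]]
  and A_minus_add = ring.ring_simprules(19)[OF ring_A]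
  and A_r_neg = ring.ring_simprules(16)[OF ring_A]
  and A_subringI = ring.subringI[OF ring_A]

lemma complex_ring_simps [simp]:
  "c \<in> carrier complex_ring" "mult complex_ring = (*)" "one complex_ring = 1"
  "zero complex_ring = 0" "add complex_ring = (+)"
  by (simp_all add: complex_ring_def)

lemma smul_add_left: "x \<in> carrier A \<Longrightarrow> (a + b) \<odot> x = a \<odot> x \<oplus> b \<odot> x"
  using smult_l_distr[of a b x] by simp

lemma smul_add_right: "x \<in> carrier A \<Longrightarrow> y \<in> carrier A \<Longrightarrow> c \<odot> (x \<oplus> y) = c \<odot> x \<oplus> c \<odot> y"
  using smult_r_distr[of c x y] by simp

lemma smul_smul: "x \<in> carrier A \<Longrightarrow> a \<odot> (b \<odot> x) = (a * b) \<odot> x"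
  using smult_assoc1[of a b x] by simp

lemma smul_one: "x \<in> carrier A \<Longrightarrow> 1 \<odot> x = x"
  using smult_one[of x] by simp

lemma smul_zero_left: "x \<in> carrier A \<Longrightarrow> 0 \<odot> x = \<zero>"
  using smult_l_null[of x] by simp

lemma smul_zero_right: "c \<odot> \<zero> = \<zero>"
  using smult_r_null[of c] by simp

lemma smul_minus_one: "x \<in> carrier A \<Longrightarrow> (-1) \<odot> x = \<ominus> x"
  using smul_add_left[of x "-1" 1] smul_zero_left[of x] smul_one[of x]
  by (intro A_minus_equality[symmetric]) simp_all

lemma star_one: "star A \<one> = \<one>"
proof -
  have "star A (star A \<one> \<otimes> \<one>) = star A \<one> \<otimes> star A (star A \<one>)"
    by (rule star_mult) (simp_all add: star_closed)
  then show ?thesis by (simp add: star_closed star_star)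
qed

lemma anorm_zero: "anorm A \<zero> = 0"
  by (simp add: anorm_eq_0_iff)

lemma anorm_minus: "x \<in> carrier A \<Longrightarrow> anorm A (\<ominus> x) = anorm A x"
  by (simp add: anorm_smult flip: smul_minus_one)

lemma anorm_diff: "x \<in> carrier A \<Longrightarrow> y \<in> carrier A \<Longrightarrow> anorm A (x \<ominus> y) \<le> anorm A x + anorm A y"
  using anorm_triangle[of x "\<ominus> y"] by (simp add: anorm_minus a_minus_def)

text \<open>Cancelling one factor in the C*-identity gives one inequality; applied to the adjoint it
  gives the other.\<close>

lemma anorm_star: assumes "x \<in> carrier A" shows "anorm A (star A x) = anorm A x"
proof -
  have le: "anorm A y \<le> anorm A (star A y)" if y: "y \<in> carrier A" for y
  proof (cases "anorm A y = 0")
    case False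
    have "anorm A y * anorm A y \<le> anorm A (star A y) * anorm A y"
      using anorm_mult[of "star A y" y] anorm_star_mult[OF y] y
      by (simp add: star_closed power2_eq_square)
    then show ?thesis using False anorm_nonneg[OF y] by (simp add: mult_le_cancel_right)
  qed (simp add: anorm_nonneg star_closed y)
  show ?thesis using le[OF assms] le[of "star A x"] assms by (simp add: star_closed star_star)
qed

text \<open>Reordering the generators produces scalars of modulus 1 that depend on \<theta>. The
  arguments below need only their modulus, so the values are never tracked.\<close>

definition phase_eq :: "'a \<Rightarrow> 'a \<Rightarrow> bool" (infix \<open>\<asymp>\<close> 50) where
  "x \<asymp> y \<longleftrightarrow> (\<exists>c. cmod c = 1 \<and> x = c \<odot> y)"

lemma phase_eq_refl: "x \<in> carrier A \<Longrightarrow> x \<asymp> x"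
  unfolding phase_eq_def by (rule exI[of _ 1]) (simp add: smul_one)

lemma phase_eq_trans: "x \<asymp> y \<Longrightarrow> y \<asymp> z \<Longrightarrow> z \<in> carrier A \<Longrightarrow> x \<asymp> z"
  unfolding phase_eq_def by (metis smul_smul norm_mult mult_1)

lemma phase_eq_sym:
  assumes "x \<asymp> y" "y \<in> carrier A" shows "y \<asymp> x"
proof -
  obtain c where c: "cmod c = 1" "x = c \<odot> y" using assms by (auto simp: phase_eq_def)
  have "cnj c * c = 1" using c(1) by (metis complex_norm_square mult.commute of_real_1 power_one)
  then have "y = cnj c \<odot> x" using assms(2) by (simp add: c smul_smul smul_one)
  then show ?thesis using c(1) unfolding phase_eq_def by (intro exI[of _ "cnj c"]) simp
qed

lemma phase_eq_mult_left:
  "x \<asymp> y \<Longrightarrow> y \<in> carrier A \<Longrightarrow> z \<in> carrier A \<Longrightarrow> z \<otimes> x \<asymp> z \<otimes> y"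
  unfolding phase_eq_def by (auto simp: smult_mult_right)

lemma phase_eq_mult_right:
  "x \<asymp> y \<Longrightarrow> y \<in> carrier A \<Longrightarrow> z \<in> carrier A \<Longrightarrow> x \<otimes> z \<asymp> y \<otimes> z"
  unfolding phase_eq_def by (auto simp: smult_mult_left)

section \<open>Unitaries and their integer powers\<close>

definition unitaries :: "'a set" where
  "unitaries = {u. unitary_in A u}"

lemma unitaries_closed: "u \<in> unitaries \<Longrightarrow> u \<in> carrier A"
  by (simp add: unitaries_def unitary_in_def)

lemma unitaries_star: "u \<in> unitaries \<Longrightarrow> star A u \<otimes> u = \<one>" "u \<in> unitaries \<Longrightarrow> u \<otimes> star A u = \<one>"
  by (simp_all add: unitaries_def unitary_in_def)

lemma one_in_unitaries: "\<one> \<in> unitaries"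
  by (simp add: unitaries_def unitary_in_def star_one)

lemma star_in_unitaries: "u \<in> unitaries \<Longrightarrow> star A u \<in> unitaries"
  by (simp add: unitaries_def unitary_in_def star_closed star_star)

lemma cancel_middle:
  assumes "a \<in> carrier A" "b \<in> carrier A" "c \<in> carrier A" "d \<in> carrier A" "b \<otimes> c = \<one>"
  shows "(a \<otimes> b) \<otimes> (c \<otimes> d) = a \<otimes> d"
proof -
  have "(a \<otimes> b) \<otimes> (c \<otimes> d) = a \<otimes> ((b \<otimes> c) \<otimes> d)" using assms(1-4) by (simp add: A_m_assoc)
  then show ?thesis using assms by simp
qed

lemma mult_in_unitaries:
  assumes "u \<in> unitaries" "v \<in> unitaries" shows "u \<otimes> v \<in> unitaries"
proof -
  note c = unitaries_closed[OF assms(1)] unitaries_closed[OF assms(2)]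
  note s = star_closed[OF c(1)] star_closed[OF c(2)]
  show ?thesis unfolding unitaries_def unitary_in_def
    using assms c s by (auto simp: star_mult cancel_middle unitaries_star)
qed

lemma unitaries_Units: "u \<in> unitaries \<Longrightarrow> u \<in> Units A"
  unfolding Units_def by (auto intro: star_closed unitaries_closed unitaries_star)

lemma inv_unitary: "u \<in> unitaries \<Longrightarrow> inv u = star A u"
  by (intro A_inv_unique[symmetric]) (auto intro: star_closed unitaries_closed unitaries_star)

lemma nat_pow_in_unitaries: "u \<in> unitaries \<Longrightarrow> u [^] (n::nat) \<in> unitaries"
  by (induction n) (auto intro: one_in_unitaries mult_in_unitaries)

lemma int_pow_in_unitaries: "u \<in> unitaries \<Longrightarrow> u [^] (z::int) \<in> unitaries"
  unfolding int_pow_def2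
  by (auto simp only: inv_unitary nat_pow_in_unitaries star_in_unitaries split: if_split)

text \<open>Integer powers obey the addition law in a group, so they are identified with powers in
  the group of units.\<close>

lemma int_pow_units_of:
  assumes "u \<in> Units A" shows "u [^]\<^bsub>units_of A\<^esub> (z::int) = u [^] z"
proof -
  have nat: "u [^]\<^bsub>units_of A\<^esub> (n::nat) = u [^] n" for n
    by (simp add: nat_pow_def units_of_mult units_of_one)
  have "u [^] (n::nat) \<in> Units A" for n
    using A_Units_pow_closed[OF assms] by simp
  then show ?thesis unfolding int_pow_def2 nat
    by (simp only: monoid.units_of_inv[OF ring.is_monoid[OF ring_A]])
qed

lemma int_pow_add_unitary:
  assumes "u \<in> unitaries" shows "u [^] (a + b :: int) = u [^] a \<otimes> u [^] b"
proof -
  have u: "u \<in> Units A" by (rule unitaries_Units[OF assms])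
  interpret G: group "units_of A" by (rule A_units_group)
  have "u [^]\<^bsub>units_of A\<^esub> (a + b) = u [^]\<^bsub>units_of A\<^esub> a \<otimes>\<^bsub>units_of A\<^esub> u [^]\<^bsub>units_of A\<^esub> b"
    by (rule G.int_pow_mult) (simp add: units_of_carrier u)
  then show ?thesis by (simp add: int_pow_units_of[OF u] units_of_mult)
qed

lemma int_pow_one_unitary: "u \<in> unitaries \<Longrightarrow> u [^] (1 :: int) = u"
  by (simp add: int_pow_def2 unitaries_closed)

text \<open>Multiplying the relation by \<open>star A u\<close> from both sides turns it into the
  reversed relation for the inverse.\<close>

lemma phase_commute_unitary_inverse:
  assumes u: "u \<in> unitaries" and x: "x \<in> carrier A" and "u \<otimes> x \<asymp> x \<otimes> u"
  shows "star A u \<otimes> x \<asymp> x \<otimes> star A u"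
proof -
  note uc = unitaries_closed[OF u] and sc = star_closed[OF unitaries_closed[OF u]]
  have "star A u \<otimes> (u \<otimes> x) \<otimes> star A u \<asymp> star A u \<otimes> (x \<otimes> u) \<otimes> star A u"
    by (intro phase_eq_mult_left phase_eq_mult_right assms A_m_closed uc sc)
  moreover have "star A u \<otimes> (u \<otimes> x) \<otimes> star A u = x \<otimes> star A u"
    using uc sc x by (simp add: unitaries_star[OF u] flip: A_m_assoc)
  moreover have "star A u \<otimes> (x \<otimes> u) \<otimes> star A u = star A u \<otimes> x"
    using uc sc x by (simp add: unitaries_star[OF u] A_m_assoc)
  ultimately show ?thesis using uc sc x by (auto intro: phase_eq_sym)
qed

lemma phase_commute_int_pow:
  assumes u: "u \<in> unitaries" and x: "x \<in> carrier A" and comm: "u \<otimes> x \<asymp> x \<otimes> u"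
  shows "u [^] (z::int) \<otimes> x \<asymp> x \<otimes> u [^] z"
proof -
  have step: "(p \<otimes> w) \<otimes> x \<asymp> x \<otimes> (p \<otimes> w)"
    if p: "p \<in> carrier A" "p \<otimes> x \<asymp> x \<otimes> p" and w: "w \<in> carrier A" "w \<otimes> x \<asymp> x \<otimes> w" for p w
  proof -
    have "p \<otimes> (w \<otimes> x) \<asymp> p \<otimes> (x \<otimes> w)" by (intro phase_eq_mult_left w A_m_closed p x)
    moreover have "(p \<otimes> x) \<otimes> w \<asymp> (x \<otimes> p) \<otimes> w" by (intro phase_eq_mult_right w A_m_closed p x)
    ultimately show ?thesis using p w x by (auto simp: A_m_assoc intro: phase_eq_trans)
  qed
  note uc = unitaries_closed[OF u]
  have minus: "u [^] (-1::int) = star A u"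
    using uc by (simp add: int_pow_def2 inv_unitary[OF u])
  show ?thesis
  proof (induction z rule: int_induct[where k = 0])
    case base
    show ?case using x by (simp add: phase_eq_refl)
  next
    case (step1 z)
    then show ?case unfolding int_pow_add_unitary[OF u]
      by (intro step) (simp_all add: comm uc int_pow_one_unitary[OF u] int_pow_in_unitaries[OF u] unitaries_closed)
  next
    case (step2 z)
    then show ?case unfolding diff_conv_add_uminus int_pow_add_unitary[OF u] minus
      by (intro step) (simp_all add: phase_commute_unitary_inverse[OF u x comm] uc star_closed
          int_pow_in_unitaries[OF u] unitaries_closed)
  qed
qed

end

section \<open>Monomials and trigonometric polynomials\<close>

locale phase_commuting_unitaries = cstar_algebra A for A :: "'a cstar" (structure) +
  fixes U :: "'d::{finite,linorder} \<Rightarrow> 'a"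
  assumes U_unitary: "U j \<in> unitaries"
    and U_commute: "U j \<otimes> U k \<asymp> U k \<otimes> U j"
begin

text \<open>Inductions run over the tails of the sorted list in \<open>torus_monomial\<close>, so
  the product is needed for arbitrary lists.\<close>

definition list_monomial :: "'d list \<Rightarrow> int^('d::{finite,linorder}) \<Rightarrow> 'a" where
  "list_monomial js n = foldr (\<lambda>j x. U j [^] (n $ j) \<otimes> x) js \<one>"

lemma list_monomial_simps [simp]:
  "list_monomial [] n = \<one>"
  "list_monomial (j # js) n = U j [^] (n $ j) \<otimes> list_monomial js n"
  by (simp_all add: list_monomial_def)

abbreviation mono :: "int^('d::{finite,linorder}) \<Rightarrow> 'a" where
  "mono n \<equiv> torus_monomial A U n"

lemma mono_eq: "mono n = list_monomial (sorted_list_of_set UNIV) n"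
  by (simp add: torus_monomial_def list_monomial_def)

lemma list_monomial_unitary: "list_monomial js n \<in> unitaries"
  by (induction js) (auto intro: one_in_unitaries mult_in_unitaries int_pow_in_unitaries U_unitary)

lemma mono_unitary: "mono n \<in> unitaries"
  by (simp add: mono_eq list_monomial_unitary)

lemma mono_closed [simp, intro]: "mono n \<in> carrier A"
  by (rule unitaries_closed[OF mono_unitary])

lemma U_closed [simp, intro]: "U j \<in> carrier A" "U j [^] (z::int) \<in> carrier A"
  by (rule unitaries_closed, intro U_unitary int_pow_in_unitaries)+

lemma list_monomial_closed [simp, intro]: "list_monomial js n \<in> carrier A"
  by (rule unitaries_closed[OF list_monomial_unitary])

lemma mono_zero: "mono 0 = \<one>"
proof -
  have "list_monomial js 0 = \<one>" for js by (induction js) auto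
  then show ?thesis by (simp add: mono_eq)
qed

lemma list_monomial_cong: "(\<And>j. j \<in> set js \<Longrightarrow> n $ j = m $ j) \<Longrightarrow> list_monomial js n = list_monomial js m"
  by (induction js) auto

text \<open>\<open>U k\<close> moves to the right past the powers of other generators, at the cost
  of a phase each, until it meets its own power. Distinctness ensures that no later factor contains
  \<open>U k\<close>.\<close>

lemma U_mult_list_monomial:
  assumes "distinct js" "k \<in> set js"
  shows "U k \<otimes> list_monomial js n \<asymp> list_monomial js (n + axis k 1)"
  using assms
proof (induction js)
  case (Cons a js)
  show ?case
  proof (cases "a = k")
    case True
    have "list_monomial js (n + axis k 1) = list_monomial js n"
      by (rule list_monomial_cong) (use Cons.prems True in \<open>auto simp: axis_def\<close>)
    moreover have "U k [^] (n $ k + 1) = U k \<otimes> U k [^] (n $ k)"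
      using int_pow_add_unitary[OF U_unitary, of k 1 "n $ k"]
      by (simp add: int_pow_one_unitary[OF U_unitary] add.commute)
    ultimately show ?thesis
      using True by (simp add: axis_def A_m_assoc phase_eq_refl)
  next
    case False
    then have k: "k \<in> set js" using Cons.prems by simp
    have "U a \<otimes> U k \<asymp> U k \<otimes> U a" by (rule U_commute)
    then have "U a [^] (n $ a) \<otimes> U k \<asymp> U k \<otimes> U a [^] (n $ a)"
      by (rule phase_commute_int_pow[OF U_unitary U_closed(1)])
    then have "U k \<otimes> U a [^] (n $ a) \<asymp> U a [^] (n $ a) \<otimes> U k"
      by (rule phase_eq_sym) simp
    then have "(U k \<otimes> U a [^] (n $ a)) \<otimes> list_monomial js n \<asymp> (U a [^] (n $ a) \<otimes> U k) \<otimes> list_monomial js n"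
      by (rule phase_eq_mult_right) simp_all
    moreover have "U a [^] (n $ a) \<otimes> (U k \<otimes> list_monomial js n) \<asymp>
        U a [^] (n $ a) \<otimes> list_monomial js (n + axis k 1)"
      by (rule phase_eq_mult_left[OF Cons.IH]) (use Cons.prems k in auto)
    ultimately have "U k \<otimes> (U a [^] (n $ a) \<otimes> list_monomial js n) \<asymp>
        U a [^] (n $ a) \<otimes> list_monomial js (n + axis k 1)"
      by (auto simp: A_m_assoc intro: phase_eq_trans)
    then show ?thesis using False by (simp add: axis_def)
  qed
qed simp

lemma U_mult_mono: "U k \<otimes> mono n \<asymp> mono (n + axis k 1)"
  by (simp add: mono_eq U_mult_list_monomial)

lemma axis_add: "axis k (a + b) = axis k a + axis k (b :: int)"
  by (simp add: vec_eq_iff axis_def)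

lemma axis_zero: "axis k (0 :: int) = 0"
  by (simp add: vec_eq_iff axis_def)

lemma axis_minus: "axis k (- a) = - axis k (a :: int)"
  by (simp add: vec_eq_iff axis_def)

lemma star_U_mult_mono: "star A (U k) \<otimes> mono n \<asymp> mono (n + axis k (-1))"
proof -
  have sc: "star A (U k) \<in> carrier A" by (simp add: star_closed)
  have "U k \<otimes> mono (n + axis k (-1)) \<asymp> mono n"
    using U_mult_mono[of k "n + axis k (-1)"] by (simp add: axis_minus)
  then have "star A (U k) \<otimes> (U k \<otimes> mono (n + axis k (-1))) \<asymp> star A (U k) \<otimes> mono n"
    by (rule phase_eq_mult_left) (simp_all add: sc)
  then have "mono (n + axis k (-1)) \<asymp> star A (U k) \<otimes> mono n"
    using sc by (simp add: unitaries_star[OF U_unitary] flip: A_m_assoc)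
  then show ?thesis by (rule phase_eq_sym) (simp add: sc)
qed

lemma U_pow_mult_mono: "U k [^] (z::int) \<otimes> mono n \<asymp> mono (n + axis k z)"
proof (induction z arbitrary: n rule: int_induct[where k = 0])
  case base
  show ?case by (simp add: axis_zero phase_eq_refl)
next
  case (step1 z)
  have "U k [^] z \<otimes> (U k \<otimes> mono n) \<asymp> U k [^] z \<otimes> mono (n + axis k 1)"
    by (rule phase_eq_mult_left[OF U_mult_mono]) simp_all
  from phase_eq_trans[OF this step1.IH] show ?case
    unfolding int_pow_add_unitary[OF U_unitary] axis_add
    by (simp add: int_pow_one_unitary[OF U_unitary] A_m_assoc add_ac)
next
  case (step2 z)
  have minus: "U k [^] (-1::int) = star A (U k)"
    by (simp add: int_pow_def2 inv_unitary[OF U_unitary])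
  have "U k [^] z \<otimes> (star A (U k) \<otimes> mono n) \<asymp> U k [^] z \<otimes> mono (n + axis k (-1))"
    by (rule phase_eq_mult_left[OF star_U_mult_mono]) simp_all
  from phase_eq_trans[OF this step2.IH] show ?case
    unfolding diff_conv_add_uminus int_pow_add_unitary[OF U_unitary] minus axis_add
    by (simp add: A_m_assoc star_closed add_ac)
qed

lemma list_monomial_mult_mono:
  assumes "distinct js"
  shows "list_monomial js m \<otimes> mono n \<asymp> mono (n + (\<Sum>j\<in>set js. axis j (m $ j)))"
  using assms
proof (induction js)
  case (Cons a js)
  have "U a [^] (m $ a) \<otimes> (list_monomial js m \<otimes> mono n) \<asymp>
      U a [^] (m $ a) \<otimes> mono (n + (\<Sum>j\<in>set js. axis j (m $ j)))"
    by (rule phase_eq_mult_left[OF Cons.IH]) (use Cons.prems in auto)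
  from phase_eq_trans[OF this U_pow_mult_mono] show ?case
    using Cons.prems by (simp add: A_m_assoc add_ac)
qed (simp add: phase_eq_refl)

text \<open>The factors of \<open>mono m\<close> are applied one at a time; each shifts the exponent
  along its own axis, and the shifts add up to \<open>m\<close>.\<close>

lemma mono_mult: "mono m \<otimes> mono n \<asymp> mono (m + n)"
proof -
  have "(\<Sum>j\<in>UNIV. axis j (m $ j)) = m"
    by (simp add: vec_eq_iff axis_def sum.delta)
  then show ?thesis
    using list_monomial_mult_mono[of "sorted_list_of_set UNIV" m n] by (simp add: mono_eq add.commute)
qed

lemma star_mono_closed [simp, intro]: "star A (mono n) \<in> carrier A"
  by (simp add: star_closed)

lemma star_mono: "star A (mono n) \<asymp> mono (- n)"
proof -
  have "mono (- n) \<otimes> mono n \<asymp> \<one>" using mono_mult[of "- n" n] by (simp add: mono_zero)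
  then have "(mono (- n) \<otimes> mono n) \<otimes> star A (mono n) \<asymp> \<one> \<otimes> star A (mono n)"
    by (rule phase_eq_mult_right) simp_all
  then have "mono (- n) \<asymp> star A (mono n)"
    by (simp add: A_m_assoc unitaries_star[OF mono_unitary])
  then show ?thesis by (rule phase_eq_sym) simp
qed

text \<open>The span of the monomials, built up term by term so that closure under the operations,
  and later bandedness, follow by induction.\<close>

inductive_set trig_polys :: "'a set" where
  zero: "\<zero> \<in> trig_polys"
| step: "p \<in> trig_polys \<Longrightarrow> c \<odot> mono n \<oplus> p \<in> trig_polys"

lemma trig_polys_closed: "p \<in> trig_polys \<Longrightarrow> p \<in> carrier A"
  by (induction rule: trig_polys.induct) auto

lemma trig_polys_smul_mono: "c \<odot> mono n \<in> trig_polys"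
  using trig_polys.step[OF trig_polys.zero, of c n] by simp

lemma trig_polys_phase: "x \<asymp> mono n \<Longrightarrow> c \<odot> x \<in> trig_polys"
  by (auto simp: phase_eq_def smul_smul trig_polys_smul_mono)

lemma trig_polys_phase1: "x \<asymp> mono n \<Longrightarrow> x \<in> trig_polys"
  by (auto simp: phase_eq_def trig_polys_smul_mono)

lemma trig_polys_add: "p \<in> trig_polys \<Longrightarrow> q \<in> trig_polys \<Longrightarrow> p \<oplus> q \<in> trig_polys"
  by (induction rule: trig_polys.induct) (auto simp: trig_polys_closed A_a_assoc intro: trig_polys.step)

lemma trig_polys_smul: "p \<in> trig_polys \<Longrightarrow> c \<odot> p \<in> trig_polys"
  by (induction rule: trig_polys.induct)
     (auto simp: trig_polys_closed smul_add_right smul_zero_right smul_smul intro: trig_polys.intros)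

lemma trig_polys_star: "p \<in> trig_polys \<Longrightarrow> star A p \<in> trig_polys"
proof (induction rule: trig_polys.induct)
  case zero
  have "star A \<zero> = \<zero>" using star_smult[of "\<zero>" 0] by (simp add: smul_zero_left star_closed)
  then show ?case by (simp add: trig_polys.zero)
next
  case (step p c n)
  then show ?case
    by (simp add: star_add star_smult trig_polys_closed)
       (intro trig_polys_add trig_polys_phase[OF star_mono])
qed

lemma trig_polys_mult:
  assumes "p \<in> trig_polys" "q \<in> trig_polys" shows "p \<otimes> q \<in> trig_polys"
  using assms(1)
proof (induction rule: trig_polys.induct)
  case zero
  show ?case using trig_polys_closed[OF assms(2)] by (simp add: trig_polys.zero)
next
  case (step p c n)
  have "mono n \<otimes> q \<in> trig_polys" using assms(2)
  proof (induction rule: trig_polys.induct)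
    case (step q d m)
    then show ?case
      by (simp add: A_r_distr trig_polys_closed smult_mult_right)
         (intro trig_polys_add trig_polys_phase[OF mono_mult])
  qed (simp add: trig_polys.zero)
  then show ?case
    using step trig_polys_closed[OF assms(2)]
    by (simp add: A_l_distr trig_polys_closed smult_mult_left trig_polys_add trig_polys_smul)
qed

lemma U_in_trig_polys: "U k \<in> trig_polys"
  using trig_polys_phase1[OF U_mult_mono[of k 0]] by (simp add: mono_zero)

lemma one_in_trig_polys: "\<one> \<in> trig_polys"
  using trig_polys_phase1[OF phase_eq_refl[OF mono_closed[of 0]]] by (simp add: mono_zero)

lemma trig_polys_minus: "p \<in> trig_polys \<Longrightarrow> \<ominus> p \<in> trig_polys"
  using trig_polys_smul[of p "-1"] by (simp add: smul_minus_one trig_polys_closed)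

text \<open>The set is the norm closure of the trigonometric polynomials, written out with
  \<epsilon> because the carrier comes with a norm but not with a topology.\<close>

lemma cstar_subalgebra_closure_trig_polys:
  "cstar_subalgebra {x \<in> carrier A. \<forall>\<epsilon>>0. \<exists>p\<in>trig_polys. anorm A (x \<ominus> p) < \<epsilon>} A" (is "cstar_subalgebra ?S A")
  unfolding cstar_subalgebra_def
proof (intro conjI allI ballI impI)
  note pc = trig_polys_closed
  show "subring ?S A"
  proof (rule A_subringI)
    show "?S \<subseteq> carrier A" by auto
    show "\<one> \<in> ?S"
      using one_in_trig_polys by (auto intro!: bexI[of _ \<one>] simp: a_minus_def A_r_neg anorm_zero)
  next
    fix h assume h: "h \<in> ?S"
    have "\<exists>p\<in>trig_polys. anorm A (\<ominus> h \<ominus> p) < \<epsilon>" if e: "0 < \<epsilon>" for \<epsilon>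
    proof -
      obtain p where p: "p \<in> trig_polys" "anorm A (h \<ominus> p) < \<epsilon>" using h e by blast
      have "\<ominus> h \<ominus> (\<ominus> p) = \<ominus> (h \<ominus> p)" using h pc[OF p(1)] by (simp add: a_minus_def A_minus_add)
      then show ?thesis using p h pc[OF p(1)]
        by (intro bexI[of _ "\<ominus> p"] trig_polys_minus) (simp_all add: anorm_minus)
    qed
    then show "\<ominus> h \<in> ?S" using h by auto
  next
    fix x y assume x: "x \<in> ?S" and y: "y \<in> ?S"
    then have xc: "x \<in> carrier A" and yc: "y \<in> carrier A" by auto
    have "\<exists>p\<in>trig_polys. anorm A ((x \<otimes> y) \<ominus> p) < \<epsilon>" if e: "0 < \<epsilon>" for \<epsilon>
    proof -
      define D where "D = anorm A x + anorm A y + 1"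
      have D: "0 < D" using anorm_nonneg[OF xc] anorm_nonneg[OF yc] by (simp add: D_def)
      \<comment> \<open>The bound 1 gives \<open>anorm A p \<le> anorm A x + 1\<close>; the bound
        \<open>\<epsilon> / D\<close> absorbs both error terms of the product.\<close>
      define \<delta> where "\<delta> = min 1 (\<epsilon> / D)"
      have d: "0 < \<delta>" "\<delta> \<le> 1" "\<delta> * D \<le> \<epsilon>"
        using e D by (auto simp: \<delta>_def min_def field_simps)
      obtain p where p: "p \<in> trig_polys" "anorm A (x \<ominus> p) < \<delta>" using x d(1) by blast
      obtain q where q: "q \<in> trig_polys" "anorm A (y \<ominus> q) < \<delta>" using y d(1) by blast
      note c = xc yc pc[OF p(1)] pc[OF q(1)]
      have p_bd: "anorm A p \<le> anorm A x + 1"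
      proof -
        have "p = x \<ominus> (x \<ominus> p)" using c by algebra
        then have "anorm A p \<le> anorm A x + anorm A (x \<ominus> p)" using anorm_diff[of x "x \<ominus> p"] c by simp
        then show ?thesis using p(2) d(2) by simp
      qed
      have "(x \<otimes> y) \<ominus> (p \<otimes> q) = (x \<ominus> p) \<otimes> y \<oplus> p \<otimes> (y \<ominus> q)"
        using c by algebra
      then have "anorm A ((x \<otimes> y) \<ominus> (p \<otimes> q)) \<le> anorm A ((x \<ominus> p) \<otimes> y) + anorm A (p \<otimes> (y \<ominus> q))"
        using c by (simp add: anorm_triangle)
      also have "\<dots> \<le> anorm A (x \<ominus> p) * anorm A y + anorm A p * anorm A (y \<ominus> q)"
        using c by (intro add_mono anorm_mult) auto
      also have "\<dots> \<le> \<delta> * anorm A y + (anorm A x + 1) * anorm A (y \<ominus> q)"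
        using c p(2) p_bd by (intro add_mono mult_right_mono) (auto simp: anorm_nonneg)
      also have "\<dots> < \<delta> * anorm A y + (anorm A x + 1) * \<delta>"
        using q(2) anorm_nonneg[OF xc] by simp
      also have "\<dots> = \<delta> * D" by (simp add: D_def algebra_simps)
      finally show ?thesis using d(3) trig_polys_mult[OF p(1) q(1)] by (auto intro!: bexI[of _ "p \<otimes> q"])
    qed
    then show "x \<otimes> y \<in> ?S" using xc yc by auto
    have "\<exists>p\<in>trig_polys. anorm A ((x \<oplus> y) \<ominus> p) < \<epsilon>" if e: "0 < \<epsilon>" for \<epsilon>
    proof -
      obtain p where p: "p \<in> trig_polys" "anorm A (x \<ominus> p) < \<epsilon> / 2" using x half_gt_zero[OF e] by blast
      obtain q where q: "q \<in> trig_polys" "anorm A (y \<ominus> q) < \<epsilon> / 2" using y half_gt_zero[OF e] by blast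
      note c = xc yc pc[OF p(1)] pc[OF q(1)]
      have "(x \<oplus> y) \<ominus> (p \<oplus> q) = (x \<ominus> p) \<oplus> (y \<ominus> q)" using c by algebra
      then have "anorm A ((x \<oplus> y) \<ominus> (p \<oplus> q)) \<le> anorm A (x \<ominus> p) + anorm A (y \<ominus> q)"
        using c by (simp add: anorm_triangle)
      then show ?thesis using p q trig_polys_add[OF p(1) q(1)] by (auto intro!: bexI[of _ "p \<oplus> q"])
    qed
    then show "x \<oplus> y \<in> ?S" using xc yc by auto
  qed
next
  fix c x assume x: "x \<in> ?S"
  have "\<exists>p\<in>trig_polys. anorm A (c \<odot> x \<ominus> p) < \<epsilon>" if e: "0 < \<epsilon>" for \<epsilon>
  proof -
    \<comment> \<open>The summand 1 covers \<open>c = 0\<close>.\<close>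
    have "0 < \<epsilon> / (cmod c + 1)" using e by (simp add: add_nonneg_pos)
    then obtain p where p: "p \<in> trig_polys" "anorm A (x \<ominus> p) < \<epsilon> / (cmod c + 1)" using x by blast
    note pcl = trig_polys_closed[OF p(1)]
    have "c \<odot> x \<ominus> c \<odot> p = c \<odot> (x \<ominus> p)"
      using x pcl by (simp add: a_minus_def smul_add_right smul_smul flip: smul_minus_one)
    then have "anorm A (c \<odot> x \<ominus> c \<odot> p) = cmod c * anorm A (x \<ominus> p)" using x pcl by (simp add: anorm_smult)
    also have "\<dots> \<le> (cmod c + 1) * anorm A (x \<ominus> p)"
      using x pcl by (intro mult_right_mono) (auto simp: anorm_nonneg)
    also have "\<dots> < (cmod c + 1) * (\<epsilon> / (cmod c + 1))"
      using p(2) by (intro mult_strict_left_mono) (auto simp: add_nonneg_pos)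
    also have "\<dots> = \<epsilon>" by (simp add: add_nonneg_eq_0_iff)
    finally show ?thesis using trig_polys_smul[OF p(1)] by blast
  qed
  then show "c \<odot> x \<in> ?S" using x by auto
next
  fix x assume x: "x \<in> ?S"
  have "\<exists>p\<in>trig_polys. anorm A (star A x \<ominus> p) < \<epsilon>" if e: "0 < \<epsilon>" for \<epsilon>
  proof -
    obtain p where p: "p \<in> trig_polys" "anorm A (x \<ominus> p) < \<epsilon>" using x e by blast
    note pcl = trig_polys_closed[OF p(1)]
    have "star A x \<ominus> star A p = star A (x \<ominus> p)"
      using x pcl by (simp add: a_minus_def star_add star_smult star_closed flip: smul_minus_one)
    then have "anorm A (star A x \<ominus> star A p) < \<epsilon>" using p(2) x pcl by (simp add: anorm_star)
    then show ?thesis using trig_polys_star[OF p(1)] by blast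
  qed
  then show "star A x \<in> ?S" using x by (auto simp: star_closed)
next
  fix X l assume l: "l \<in> carrier A" and X: "range X \<subseteq> ?S \<and> norm_limit A X l"
  have "\<exists>p\<in>trig_polys. anorm A (l \<ominus> p) < \<epsilon>" if e: "0 < \<epsilon>" for \<epsilon>
  proof -
    have "\<forall>\<^sub>F n in sequentially. anorm A (X n \<ominus> l) < \<epsilon> / 2"
      by (rule order_tendstoD(2)[OF _ half_gt_zero[OF e]]) (use X in \<open>simp add: norm_limit_def\<close>)
    then obtain n where n: "anorm A (X n \<ominus> l) < \<epsilon> / 2" by (auto simp: eventually_sequentially)
    have "X n \<in> ?S" using X by blast
    then obtain p where p: "p \<in> trig_polys" "anorm A (X n \<ominus> p) < \<epsilon> / 2" "X n \<in> carrier A"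
      using half_gt_zero[OF e] by blast
    note pcl = trig_polys_closed[OF p(1)]
    have "l \<ominus> p = (X n \<ominus> p) \<ominus> (X n \<ominus> l)" using l pcl p(3) by algebra
    then have "anorm A (l \<ominus> p) \<le> anorm A (X n \<ominus> p) + anorm A (X n \<ominus> l)"
      using anorm_diff[of "X n \<ominus> p" "X n \<ominus> l"] l pcl p(3) by simp
    then show ?thesis using n p by (intro bexI[of _ p]) auto
  qed
  then show "l \<in> ?S" using l by auto
qed

text \<open>The norm closure is a C*-subalgebra containing the generators, and by hypothesis only
  the whole algebra is one.\<close>

lemma trig_polys_dense:
  assumes "cstar_generated_by A (range U)" "x \<in> carrier A" "0 < \<epsilon>"
  shows "\<exists>p\<in>trig_polys. anorm A (x \<ominus> p) < \<epsilon>"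
proof -
  let ?S = "{x \<in> carrier A. \<forall>\<epsilon>>0. \<exists>p\<in>trig_polys. anorm A (x \<ominus> p) < \<epsilon>}"
  have "\<exists>p\<in>trig_polys. anorm A (U k \<ominus> p) < \<epsilon>" if "0 < \<epsilon>" for k \<epsilon>
    using that by (intro bexI[OF _ U_in_trig_polys[of k]]) (simp add: a_minus_def A_r_neg anorm_zero)
  then have "range U \<subseteq> ?S" by auto
  then have "?S = carrier A"
    using assms(1) cstar_subalgebra_closure_trig_polys unfolding cstar_generated_by_def by blast
  then show ?thesis using assms(2,3) by blast
qed

end

section \<open>The GNS representation\<close>

lemmas continuous_on_cinner [continuous_intros] = bounded_bilinear.continuous_on[OF bounded_bilinear_cinner]
  and continuous_on_scaleC [continuous_intros] = bounded_bilinear.continuous_on[OF bounded_bilinear_scaleC]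

locale torus_gns = phase_commuting_unitaries A U
  for A :: "'a cstar" (structure) and U :: "'d::{finite,linorder} \<Rightarrow> 'a" +
  fixes \<tau> :: "'a \<Rightarrow> complex" and \<Lambda> :: "'a \<Rightarrow> 'h::chilbert_space"
  assumes generated: "cstar_generated_by A (range U)"
    and trace: "tracial_state A \<tau>"
    and trace_mono: "n \<noteq> 0 \<Longrightarrow> \<tau> (mono n) = 0"
    and gns: "gns_space A \<tau> \<Lambda>"
begin

lemma trace_smul: "x \<in> carrier A \<Longrightarrow> \<tau> (c \<odot> x) = c * \<tau> x"
  and trace_add: "x \<in> carrier A \<Longrightarrow> y \<in> carrier A \<Longrightarrow> \<tau> (x \<oplus> y) = \<tau> x + \<tau> y"
  and trace_one: "\<tau> \<one> = 1"
  and trace_bound: "x \<in> carrier A \<Longrightarrow> cmod (\<tau> x) \<le> anorm A x"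
  and trace_commute: "x \<in> carrier A \<Longrightarrow> y \<in> carrier A \<Longrightarrow> \<tau> (x \<otimes> y) = \<tau> (y \<otimes> x)"
  using trace by (simp_all add: tracial_state_def)

lemma trace_positive: "x \<in> positive_elements A \<Longrightarrow> \<tau> x \<in> \<real>\<^sub>\<ge>\<^sub>0"
  using trace by (simp add: tracial_state_def)

lemma gns_add: "x \<in> carrier A \<Longrightarrow> y \<in> carrier A \<Longrightarrow> \<Lambda> (x \<oplus> y) = \<Lambda> x + \<Lambda> y"
  and gns_smul: "x \<in> carrier A \<Longrightarrow> \<Lambda> (c \<odot> x) = c *\<^sub>C \<Lambda> x"
  and gns_cinner: "x \<in> carrier A \<Longrightarrow> y \<in> carrier A \<Longrightarrow> cinner (\<Lambda> x) (\<Lambda> y) = \<tau> (star A x \<otimes> y)"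
  and gns_dense: "closure (\<Lambda> ` carrier A) = UNIV"
  using gns by (simp_all add: gns_space_def)

lemma gns_diff: "x \<in> carrier A \<Longrightarrow> y \<in> carrier A \<Longrightarrow> \<Lambda> (x \<ominus> y) = \<Lambda> x - \<Lambda> y"
  by (simp add: a_minus_def gns_add gns_smul scaleC_minus_left flip: smul_minus_one)

text \<open>The image of \<Lambda> is dense, so a closed condition has to be checked there
  only.\<close>

lemma gns_induct:
  assumes "closed {v. P v}" "\<And>y. y \<in> carrier A \<Longrightarrow> P (\<Lambda> y)"
  shows "P v"
proof -
  have "closure (\<Lambda> ` carrier A) \<subseteq> {v. P v}" by (rule closure_minimal) (use assms in auto)
  then show ?thesis using gns_dense by auto
qed

section \<open>Boundedness of left multiplication\<close>

lemma norm_gns_le: assumes "x \<in> carrier A" shows "norm (\<Lambda> x) \<le> anorm A x"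
proof -
  have "(norm (\<Lambda> x))\<^sup>2 = Re (\<tau> (star A x \<otimes> x))"
    using assms by (simp flip: gns_cinner)
  also have "\<dots> \<le> cmod (\<tau> (star A x \<otimes> x))" by (rule complex_Re_le_cmod)
  also have "\<dots> \<le> (anorm A x)\<^sup>2"
    using trace_bound[of "star A x \<otimes> x"] assms by (simp add: anorm_star_mult star_closed)
  finally show ?thesis by (rule power2_le_imp_le) (rule anorm_nonneg[OF assms])
qed

lemma cinner_gns_mult:
  assumes "x \<in> carrier A" "y \<in> carrier A" "z \<in> carrier A"
  shows "cinner (\<Lambda> y) (\<Lambda> (x \<otimes> z)) = cinner (\<Lambda> (star A x \<otimes> y)) (\<Lambda> z)"
  using assms by (simp add: gns_cinner star_mult star_star star_closed A_m_assoc)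

text \<open>Iterating \<open>\<parallel>\<Lambda> (c y)\<parallel>\<^sup>2 \<le> \<parallel>\<Lambda> y\<parallel> \<parallel>\<Lambda> (c\<^sup>2 y)\<parallel>\<close> bounds left multiplication by the
  norm of the algebra without any functional calculus.\<close>

lemma gns_mult_power_bound:
  assumes "c \<in> carrier A" "star A c = c" and y: "y \<in> carrier A"
  shows "norm (\<Lambda> y) * norm (\<Lambda> (c \<otimes> y)) ^ 2 ^ k \<le> norm (\<Lambda> y) ^ 2 ^ k * (anorm A c ^ 2 ^ k * anorm A y)"
  using assms(1,2)
proof (induction k arbitrary: c)
  case 0
  have "norm (\<Lambda> (c \<otimes> y)) \<le> anorm A c * anorm A y"
    using norm_gns_le[of "c \<otimes> y"] anorm_mult[of c y] 0 y by simp
  then show ?case by (simp add: mult_left_mono)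
next
  case (Suc k)
  let ?Y = "norm (\<Lambda> y)" and ?a = "norm (\<Lambda> (c \<otimes> y))" and ?b = "norm (\<Lambda> ((c \<otimes> c) \<otimes> y))"
  have c: "c \<in> carrier A" and sc: "star A c = c" by fact+
  have "?a\<^sup>2 = Re (cinner (\<Lambda> (c \<otimes> y)) (\<Lambda> (c \<otimes> y)))" by simp
  also have "cinner (\<Lambda> (c \<otimes> y)) (\<Lambda> (c \<otimes> y)) = cinner (\<Lambda> y) (\<Lambda> ((c \<otimes> c) \<otimes> y))"
    using c y cinner_gns_mult[of c "c \<otimes> y" y] cinner_gns_mult[of c y "c \<otimes> y"] sc
    by (simp add: A_m_assoc)
  also have "Re (cinner (\<Lambda> y) (\<Lambda> ((c \<otimes> c) \<otimes> y))) \<le> ?Y * ?b"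
    using cinner_Cauchy_Schwarz complex_Re_le_cmod order_trans by blast
  finally have ab: "?a\<^sup>2 \<le> ?Y * ?b" .
  have "?a ^ 2 ^ Suc k = (?a\<^sup>2) ^ 2 ^ k" by (simp add: power_mult)
  also have "\<dots> \<le> (?Y * ?b) ^ 2 ^ k" by (intro power_mono ab) simp
  finally have "?Y * ?a ^ 2 ^ Suc k \<le> ?Y * (?Y * ?b) ^ 2 ^ k" by (intro mult_left_mono) auto
  also have "\<dots> = ?Y ^ 2 ^ k * (?Y * ?b ^ 2 ^ k)" by (simp add: power_mult_distrib)
  \<comment> \<open>The induction hypothesis is used for \<open>c \<otimes> c\<close>, which is
    again selfadjoint and whose norm is at most the square of the norm of \<open>c\<close>.\<close>
  also have "\<dots> \<le> ?Y ^ 2 ^ k * (?Y ^ 2 ^ k * (anorm A (c \<otimes> c) ^ 2 ^ k * anorm A y))"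
    by (intro mult_left_mono Suc.IH) (use c sc in \<open>auto simp: star_mult\<close>)
  also have "\<dots> \<le> ?Y ^ 2 ^ k * (?Y ^ 2 ^ k * ((anorm A c)\<^sup>2 ^ 2 ^ k * anorm A y))"
    using anorm_mult[OF c c] c y
    by (intro mult_left_mono mult_right_mono power_mono) (auto simp: power2_eq_square anorm_nonneg)
  also have "\<dots> = ?Y ^ 2 ^ Suc k * (anorm A c ^ 2 ^ Suc k * anorm A y)"
    by (simp add: power_mult power2_eq_square power_mult_distrib)
  finally show ?case .
qed

text \<open>If the inequality failed, the quotient \<open>r > 1\<close> would, by
  \<open>gns_mult_power_bound\<close>, have all powers \<open>r ^ 2 ^ n\<close> bounded by the fixed
  number \<open>anorm A y / norm (\<Lambda> y)\<close>.\<close>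

lemma gns_mult_bound_selfadjoint:
  assumes c: "c \<in> carrier A" "star A c = c" and y: "y \<in> carrier A"
  shows "norm (\<Lambda> (c \<otimes> y)) \<le> anorm A c * norm (\<Lambda> y)"
proof (rule ccontr)
  let ?Y = "norm (\<Lambda> y)" and ?a = "norm (\<Lambda> (c \<otimes> y))" and ?C = "anorm A c"
  assume "\<not> ?a \<le> ?C * ?Y"
  then have gt: "?C * ?Y < ?a" by simp
  have C0: "0 \<le> ?C" by (rule anorm_nonneg[OF c(1)])
  have a0: "0 < ?a" using gt C0 by (meson less_le_trans mult_nonneg_nonneg norm_ge_zero not_less)
  have "?C \<noteq> 0"
  proof
    assume "?C = 0"
    then have "anorm A (c \<otimes> y) \<le> 0" using anorm_mult[OF c(1) y] by simp
    moreover have "?a \<le> anorm A (c \<otimes> y)" using c(1) y by (intro norm_gns_le) simp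
    ultimately show False using a0 by linarith
  qed
  then have C: "0 < ?C" using C0 by simp
  have Y: "0 < ?Y"
  proof (rule ccontr)
    assume "\<not> 0 < ?Y"
    then have "\<Lambda> y = 0" by simp
    then have "cinner (\<Lambda> (c \<otimes> y)) (\<Lambda> (c \<otimes> y)) = 0"
      using cinner_gns_mult[of c "c \<otimes> y" y] c y by simp
    then have "?a = 0" by (simp add: cinner_self)
    then show False using a0 by simp
  qed
  define r where "r = ?a / (?C * ?Y)"
  have r: "1 < r" using gt C Y by (simp add: r_def)
  obtain n where n: "anorm A y / ?Y < r ^ n" using real_arch_pow[OF r] by blast
  have "r ^ n \<le> r ^ 2 ^ n" using r by (intro power_increasing) (auto intro: less_imp_le)
  moreover have "r ^ 2 ^ n \<le> anorm A y / ?Y"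
    using gns_mult_power_bound[OF c y, of n] C Y
    by (simp add: r_def power_divide power_mult_distrib field_simps)
  ultimately show False using n by simp
qed

text \<open>The C*-identity reduces the general case to the selfadjoint element
  \<open>star A x \<otimes> x\<close>.\<close>

lemma gns_mult_bound:
  assumes x: "x \<in> carrier A" and y: "y \<in> carrier A"
  shows "norm (\<Lambda> (x \<otimes> y)) \<le> anorm A x * norm (\<Lambda> y)"
proof (rule power2_le_imp_le)
  let ?c = "star A x \<otimes> x"
  have c: "?c \<in> carrier A" "star A ?c = ?c" using x by (simp_all add: star_closed star_mult star_star)
  have "(norm (\<Lambda> (x \<otimes> y)))\<^sup>2 = Re (cinner (\<Lambda> (x \<otimes> y)) (\<Lambda> (x \<otimes> y)))" by simp
  also have "cinner (\<Lambda> (x \<otimes> y)) (\<Lambda> (x \<otimes> y)) = cinner (\<Lambda> (?c \<otimes> y)) (\<Lambda> y)"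
    using cinner_gns_mult[of x "x \<otimes> y" y] x y by (simp add: A_m_assoc star_closed)
  also have "Re \<dots> \<le> norm (\<Lambda> (?c \<otimes> y)) * norm (\<Lambda> y)"
    using cinner_Cauchy_Schwarz complex_Re_le_cmod order_trans by blast
  also have "\<dots> \<le> (anorm A ?c * norm (\<Lambda> y)) * norm (\<Lambda> y)"
    by (intro mult_right_mono gns_mult_bound_selfadjoint c y) simp
  also have "\<dots> = (anorm A x * norm (\<Lambda> y))\<^sup>2"
    using x by (simp add: anorm_star_mult power2_eq_square)
  finally show "(norm (\<Lambda> (x \<otimes> y)))\<^sup>2 \<le> (anorm A x * norm (\<Lambda> y))\<^sup>2" .
qed (simp add: anorm_nonneg x)

text \<open>Left multiplication is Lipschitz on the dense image of \<Lambda>, so it extends by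
  uniform continuity; the algebraic identities and the bound carry over by
  \<open>gns_induct\<close>.\<close>

lemma left_mult_exists:
  assumes x: "x \<in> carrier A"
  shows "\<exists>T. bounded_clinear T \<and> (\<forall>y\<in>carrier A. T (\<Lambda> y) = \<Lambda> (x \<otimes> y)) \<and> (\<forall>v. norm (T v) \<le> anorm A x * norm v)"
proof -
  \<comment> \<open>\<open>SOME\<close> picks a preimage under \<Lambda>. That the value does not
    depend on it is the case of distance 0 in \<open>lip\<close>.\<close>
  define f where "f v = \<Lambda> (x \<otimes> (SOME y. y \<in> carrier A \<and> \<Lambda> y = v))" for v
  have lip: "norm (\<Lambda> (x \<otimes> y) - \<Lambda> (x \<otimes> z)) \<le> anorm A x * norm (\<Lambda> y - \<Lambda> z)"
    if "y \<in> carrier A" "z \<in> carrier A" for y z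
  proof -
    have "x \<otimes> (y \<ominus> z) = x \<otimes> y \<ominus> x \<otimes> z"
      using x that by (simp add: a_minus_def A_r_distr smult_mult_right flip: smul_minus_one)
    then show ?thesis using gns_mult_bound[OF x, of "y \<ominus> z"] that x by (simp add: gns_diff)
  qed
  have f: "f (\<Lambda> y) = \<Lambda> (x \<otimes> y)" if y: "y \<in> carrier A" for y
  proof -
    let ?z = "SOME z. z \<in> carrier A \<and> \<Lambda> z = \<Lambda> y"
    have z: "?z \<in> carrier A \<and> \<Lambda> ?z = \<Lambda> y" by (rule someI[of _ y]) (use y in simp)
    then have "norm (\<Lambda> (x \<otimes> ?z) - \<Lambda> (x \<otimes> y)) \<le> 0" using lip[of ?z y] y by simp
    then show ?thesis by (simp add: f_def)
  qed
  have "uniformly_continuous_on (\<Lambda> ` carrier A) f"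
    unfolding uniformly_continuous_on_def
  proof (intro allI impI)
    fix e :: real assume e: "0 < e"
    have pos: "0 < anorm A x + 1" using anorm_nonneg[OF x] by simp
    have "dist (f (\<Lambda> z)) (f (\<Lambda> y)) < e"
      if yz: "y \<in> carrier A" "z \<in> carrier A" "dist (\<Lambda> z) (\<Lambda> y) < e / (anorm A x + 1)" for y z
    proof -
      have "dist (f (\<Lambda> z)) (f (\<Lambda> y)) \<le> anorm A x * dist (\<Lambda> z) (\<Lambda> y)"
        using lip yz f by (simp add: dist_norm)
      also have "\<dots> \<le> (anorm A x + 1) * dist (\<Lambda> z) (\<Lambda> y)" by (intro mult_right_mono) auto
      also have "\<dots> < e" using yz(3) pos by (simp add: field_simps)
      finally show ?thesis .
    qed
    then show "\<exists>d>0. \<forall>v\<in>\<Lambda> ` carrier A. \<forall>w\<in>\<Lambda> ` carrier A. dist w v < d \<longrightarrow> dist (f w) (f v) < e"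
      using e pos by (intro exI[of _ "e / (anorm A x + 1)"]) auto
  qed
  then obtain T where uc: "uniformly_continuous_on (closure (\<Lambda> ` carrier A)) T"
    and eq: "\<And>v. v \<in> \<Lambda> ` carrier A \<Longrightarrow> f v = T v"
    by (rule uniformly_continuous_on_extension_on_closure) blast
  have cont: "continuous_on UNIV T"
    using uniformly_continuous_imp_continuous[OF uc] gns_dense by simp
  have comp [continuous_intros]: "continuous_on UNIV (\<lambda>v. T (g v))" if "continuous_on UNIV g" for g :: "'h \<Rightarrow> 'h"
    by (rule continuous_on_compose2[OF cont that]) simp
  have T: "T (\<Lambda> y) = \<Lambda> (x \<otimes> y)" if "y \<in> carrier A" for y using eq[of "\<Lambda> y"] f that by simp
  have add: "T (u + v) = T u + T v" for u v
  proof (rule gns_induct[of "\<lambda>u. T (u + v) = T u + T v"])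
    show "closed {u. T (u + v) = T u + T v}" by (intro closed_Collect_eq continuous_intros)
    fix y assume y: "y \<in> carrier A"
    show "T (\<Lambda> y + v) = T (\<Lambda> y) + T v"
    proof (rule gns_induct[of "\<lambda>v. T (\<Lambda> y + v) = T (\<Lambda> y) + T v"])
      show "closed {v. T (\<Lambda> y + v) = T (\<Lambda> y) + T v}" by (intro closed_Collect_eq continuous_intros)
      fix z assume z: "z \<in> carrier A"
      then show "T (\<Lambda> y + \<Lambda> z) = T (\<Lambda> y) + T (\<Lambda> z)"
        using T[of "y \<oplus> z"] T[of y] T[of z] x y by (simp add: gns_add A_r_distr)
    qed
  qed
  have scale: "T (c *\<^sub>C v) = c *\<^sub>C T v" for c v
  proof (rule gns_induct[of "\<lambda>v. T (c *\<^sub>C v) = c *\<^sub>C T v"])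
    show "closed {v. T (c *\<^sub>C v) = c *\<^sub>C T v}" by (intro closed_Collect_eq continuous_intros)
    fix y assume "y \<in> carrier A"
    then show "T (c *\<^sub>C \<Lambda> y) = c *\<^sub>C T (\<Lambda> y)"
      using T[of "c \<odot> y"] T[of y] x by (simp add: gns_smul smult_mult_right)
  qed
  have bd: "norm (T v) \<le> anorm A x * norm v" for v
  proof (rule gns_induct[of "\<lambda>v. norm (T v) \<le> anorm A x * norm v"])
    show "closed {v. norm (T v) \<le> anorm A x * norm v}" by (intro closed_Collect_le continuous_intros)
    fix y assume "y \<in> carrier A"
    then show "norm (T (\<Lambda> y)) \<le> anorm A x * norm (\<Lambda> y)" using T gns_mult_bound[OF x] by simp
  qed
  have "bounded_clinear T"
    by (rule bounded_clinearI[OF add scale]) (subst mult.commute, rule bd)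
  then show ?thesis using T bd by blast
qed

section \<open>The operators of left multiplication\<close>

abbreviation lmul :: "'a \<Rightarrow> 'h \<Rightarrow> 'h" where
  "lmul \<equiv> left_mult A \<Lambda>"

lemma bounded_clinear_eq_on_gns:
  assumes "bounded_clinear S" "bounded_clinear T" "\<And>y. y \<in> carrier A \<Longrightarrow> S (\<Lambda> y) = T (\<Lambda> y)"
  shows "S = T"
proof
  fix v show "S v = T v"
    by (rule gns_induct[of "\<lambda>v. S v = T v"])
       (intro closed_Collect_eq linear_continuous_on bounded_clinear_imp_bounded_linear assms(1,2), rule assms(3))
qed

text \<open>Bounded operators that agree on the dense image of \<Lambda> are equal, so the
  description in \<open>left_mult\<close> singles out the operator of
  \<open>left_mult_exists\<close>.\<close>

lemma lmul_properties:
  assumes x: "x \<in> carrier A"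
  shows "bounded_clinear (lmul x)" "y \<in> carrier A \<Longrightarrow> lmul x (\<Lambda> y) = \<Lambda> (x \<otimes> y)"
    "norm (lmul x v) \<le> anorm A x * norm v"
proof -
  obtain T where T: "bounded_clinear T" "\<forall>y\<in>carrier A. T (\<Lambda> y) = \<Lambda> (x \<otimes> y)"
    "\<forall>v. norm (T v) \<le> anorm A x * norm v" using left_mult_exists[OF x] by blast
  have "lmul x = T"
    unfolding left_mult_def
  proof (rule the_equality)
    fix S assume "bounded_clinear S \<and> (\<forall>y\<in>carrier A. S (\<Lambda> y) = \<Lambda> (x \<otimes> y))"
    then show "S = T" using T by (intro bounded_clinear_eq_on_gns) auto
  qed (use T in blast)
  then show "bounded_clinear (lmul x)" "y \<in> carrier A \<Longrightarrow> lmul x (\<Lambda> y) = \<Lambda> (x \<otimes> y)"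
    "norm (lmul x v) \<le> anorm A x * norm v" using T by auto
qed

lemma continuous_lmul [continuous_intros]: "x \<in> carrier A \<Longrightarrow> continuous_on UNIV (lmul x)"
  by (intro linear_continuous_on bounded_clinear_imp_bounded_linear lmul_properties)

lemma cinner_lmul:
  assumes x: "x \<in> carrier A"
  shows "cinner u (lmul x v) = cinner (lmul (star A x) u) v"
proof (rule gns_induct[of "\<lambda>u. cinner u (lmul x v) = cinner (lmul (star A x) u) v"])
  note sx = star_closed[OF x]
  show "closed {u. cinner u (lmul x v) = cinner (lmul (star A x) u) v}"
    by (intro closed_Collect_eq continuous_intros sx)
  fix y assume y: "y \<in> carrier A"
  show "cinner (\<Lambda> y) (lmul x v) = cinner (lmul (star A x) (\<Lambda> y)) v"
  proof (rule gns_induct[of "\<lambda>v. cinner (\<Lambda> y) (lmul x v) = cinner (lmul (star A x) (\<Lambda> y)) v"])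
    show "closed {v. cinner (\<Lambda> y) (lmul x v) = cinner (lmul (star A x) (\<Lambda> y)) v}"
      by (intro closed_Collect_eq continuous_intros x)
    fix z assume z: "z \<in> carrier A"
    show "cinner (\<Lambda> y) (lmul x (\<Lambda> z)) = cinner (lmul (star A x) (\<Lambda> y)) (\<Lambda> z)"
      by (simp add: lmul_properties(2) x sx y z cinner_gns_mult)
  qed
qed

lemma lmul_mult:
  assumes "x \<in> carrier A" "y \<in> carrier A" shows "lmul (x \<otimes> y) = (\<lambda>v. lmul x (lmul y v))"
proof (rule bounded_clinear_eq_on_gns)
  show "bounded_clinear (lmul (x \<otimes> y))" "bounded_clinear (\<lambda>v. lmul x (lmul y v))"
    by (rule lmul_properties(1) bounded_clinear_compose[OF lmul_properties(1) lmul_properties(1)],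
        simp_all add: assms)+
qed (use assms in \<open>simp_all add: lmul_properties(2) A_m_assoc\<close>)

lemma lmul_diff:
  assumes "x \<in> carrier A" "y \<in> carrier A" shows "lmul (x \<ominus> y) v = lmul x v - lmul y v"
proof -
  have "bounded_clinear (\<lambda>v. lmul x v - lmul y v)"
    unfolding bounded_clinear_def
    using lmul_properties(1)[OF assms(1)] lmul_properties(1)[OF assms(2)]
    by (auto simp: bounded_clinear_def scaleC_diff_right intro: bounded_linear_sub)
  then have "lmul (x \<ominus> y) = (\<lambda>v. lmul x v - lmul y v)"
    by (intro bounded_clinear_eq_on_gns lmul_properties)
       (use assms in \<open>simp_all add: lmul_properties(2) gns_diff[symmetric] a_minus_def A_l_distr
          smult_mult_left flip: smul_minus_one\<close>)
  then show ?thesis by simp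
qed

lemma lmul_positive:
  assumes "b \<in> positive_elements A" shows "cinner v (lmul b v) \<in> \<real>\<^sub>\<ge>\<^sub>0"
proof -
  obtain x where x: "x \<in> carrier A" "b = star A x \<otimes> x" using assms by (auto simp: positive_elements_def)
  have "cinner v (lmul b v) = cinner (lmul x v) (lmul x v)"
    using cinner_lmul[of "star A x" v "lmul x v"] x by (simp add: lmul_mult star_closed star_star)
  then show ?thesis by (simp add: cinner_self)
qed

lemma positive_elements_closed: "b \<in> positive_elements A \<Longrightarrow> b \<in> carrier A"
  by (auto simp: positive_elements_def star_closed)

section \<open>The monomial basis and matrix entries of left multiplication\<close>

definition basis :: "int^('d::{finite,linorder}) \<Rightarrow> 'h" where
  "basis n = \<Lambda> (mono n)"

lemma trace_phase: "x \<asymp> y \<Longrightarrow> y \<in> carrier A \<Longrightarrow> \<exists>c. cmod c = 1 \<and> \<tau> x = c * \<tau> y"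
  by (auto simp: phase_eq_def trace_smul)

lemma star_mono_mult_mono: "star A (mono m) \<otimes> mono n \<asymp> mono (n - m)"
proof -
  have "star A (mono m) \<otimes> mono n \<asymp> mono (- m) \<otimes> mono n"
    by (rule phase_eq_mult_right[OF star_mono]) simp_all
  from phase_eq_trans[OF this mono_mult] show ?thesis by simp
qed

text \<open>Up to a phase, the inner product of two monomials is the trace of the monomial whose
  exponent is the difference.\<close>

lemma orthonormal_basis_family: "orthonormal_on UNIV basis"
proof -
  have "cinner (basis m) (basis n) = (if m = n then 1 else 0)" for m n
  proof (cases "m = n")
    case True
    then show ?thesis by (simp add: basis_def gns_cinner unitaries_star[OF mono_unitary] trace_one)
  next
    case False
    then have "\<tau> (mono (n - m)) = 0" by (intro trace_mono) simp
    then have "\<tau> (star A (mono m) \<otimes> mono n) = 0" using trace_phase[OF star_mono_mult_mono[of m n]] by auto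
    then show ?thesis using False by (simp add: basis_def gns_cinner)
  qed
  then show ?thesis by (simp add: orthonormal_on_def)
qed

text \<open>A vector orthogonal to all monomials is orthogonal to the images of trigonometric
  polynomials, hence to the dense image of \<Lambda>.\<close>

lemma total_basis_family: "total_family UNIV basis"
  unfolding total_family_def
proof (intro allI impI)
  fix v assume v: "\<forall>i\<in>UNIV. cinner (basis i) v = 0"
  have poly: "cinner (\<Lambda> p) v = 0" if "p \<in> trig_polys" for p
    using that
  proof (induction rule: trig_polys.induct)
    case zero
    have "\<Lambda> \<zero> = 0" using gns_smul[of \<one> 0] by (simp add: smul_zero_left)
    then show ?case by simp
  next
    case (step p c n)
    then show ?case
      using v by (simp add: gns_add gns_smul trig_polys_closed cinner_add_left cinner_scaleC_left flip: basis_def)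
  qed
  have "cinner u v = 0" for u
  proof (rule gns_induct[of "\<lambda>u. cinner u v = 0"])
    show "closed {u. cinner u v = 0}" by (intro closed_Collect_eq continuous_intros)
    fix y assume y: "y \<in> carrier A"
    have "cmod (cinner (\<Lambda> y) v) \<le> e" if e: "0 < e" for e
    proof -
      have "0 < e / (norm v + 1)" using e by (simp add: add_nonneg_pos)
      then obtain p where p: "p \<in> trig_polys" "anorm A (y \<ominus> p) < e / (norm v + 1)"
        using trig_polys_dense[OF generated y] by blast
      note pc = trig_polys_closed[OF p(1)]
      have "cinner (\<Lambda> y) v = cinner (\<Lambda> (y \<ominus> p)) v"
        using poly[OF p(1)] y pc by (simp add: gns_diff cinner_diff_left)
      then have "cmod (cinner (\<Lambda> y) v) \<le> norm (\<Lambda> (y \<ominus> p)) * norm v" by (simp add: cinner_Cauchy_Schwarz)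
      also have "\<dots> \<le> e / (norm v + 1) * norm v"
        using norm_gns_le[of "y \<ominus> p"] p(2) y pc by (intro mult_right_mono) auto
      also have "\<dots> = e * (norm v / (norm v + 1))" by simp
      also have "\<dots> \<le> e * 1" using e by (intro mult_left_mono) (auto simp: divide_le_eq_1 add_nonneg_pos)
      also have "\<dots> = e" by simp
      finally show ?thesis .
    qed
    then have "cmod (cinner (\<Lambda> y) v) \<le> 0" by (rule field_le_epsilon[of _ 0, simplified])
    then show "cinner (\<Lambda> y) v = 0" by simp
  qed
  from this[of v] show "v = 0" by (simp add: cinner_self)
qed

lemma lmul_matrix:
  assumes "x \<in> carrier A"
  shows "cinner (basis m) (lmul x (basis n)) = \<tau> (star A (mono m) \<otimes> (x \<otimes> mono n))"
  using assms by (simp add: basis_def lmul_properties(2) gns_cinner)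

text \<open>By traciality, conjugation with a unitary monomial preserves the trace. All diagonal
  entries thus coincide, which fixes the sum of the eigenvalues of a block.\<close>

lemma lmul_diagonal:
  assumes x: "x \<in> carrier A" shows "cinner (basis n) (lmul x (basis n)) = \<tau> x"
proof -
  have "\<tau> (star A (mono n) \<otimes> (x \<otimes> mono n)) = \<tau> ((x \<otimes> mono n) \<otimes> star A (mono n))"
    by (rule trace_commute) (simp_all add: x)
  also have "(x \<otimes> mono n) \<otimes> star A (mono n) = x"
    using x by (simp add: A_m_assoc unitaries_star[OF mono_unitary])
  finally show ?thesis by (simp add: lmul_matrix x)
qed

text \<open>Right multiplication by a monomial commutes with left multiplication.\<close>

lemma lmul_translate:
  "\<exists>\<alpha>. (\<forall>n. cmod (\<alpha> n) = 1) \<and> (\<forall>x\<in>carrier A. \<forall>m n.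
    cinner (basis (m + k)) (lmul x (basis (n + k))) = cnj (\<alpha> m) * \<alpha> n * cinner (basis m) (lmul x (basis n)))"
proof -
  have "\<exists>c. cmod c = 1 \<and> mono (n + k) = c \<odot> (mono n \<otimes> mono k)" for n
    using phase_eq_sym[OF mono_mult[of n k]] by (simp add: phase_eq_def)
  then obtain \<alpha> where \<alpha>: "\<And>n. cmod (\<alpha> n) = 1" "\<And>n. mono (n + k) = \<alpha> n \<odot> (mono n \<otimes> mono k)" by metis
  have "cinner (basis (m + k)) (lmul x (basis (n + k))) = cnj (\<alpha> m) * \<alpha> n * cinner (basis m) (lmul x (basis n))"
    if x: "x \<in> carrier A" for x m n
  proof -
    let ?w = "star A (mono m) \<otimes> (x \<otimes> mono n)"
    have "star A (mono (m + k)) \<otimes> (x \<otimes> mono (n + k)) =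
        (cnj (\<alpha> m) * \<alpha> n) \<odot> (star A (mono k) \<otimes> (?w \<otimes> mono k))"
      using x by (simp add: \<alpha>(2) star_smult star_mult smult_mult_left smult_mult_right smul_smul A_m_assoc mult.commute)
    then have "\<tau> (star A (mono (m + k)) \<otimes> (x \<otimes> mono (n + k)))
        = cnj (\<alpha> m) * \<alpha> n * \<tau> (star A (mono k) \<otimes> (?w \<otimes> mono k))"
      using x by (simp add: trace_smul)
    \<comment> \<open>Traciality moves \<open>star A (mono k)\<close> to the right, where it cancels
      \<open>mono k\<close>.\<close>
    also have "\<tau> (star A (mono k) \<otimes> (?w \<otimes> mono k)) = \<tau> ((?w \<otimes> mono k) \<otimes> star A (mono k))"
      by (rule trace_commute) (simp_all add: x)
    also have "(?w \<otimes> mono k) \<otimes> star A (mono k) = ?w"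
      using x by (simp add: A_m_assoc unitaries_star[OF mono_unitary])
    finally show ?thesis by (simp add: lmul_matrix x)
  qed
  then show ?thesis using \<alpha>(1) by blast
qed

text \<open>A monomial with exponent \<open>k\<close> shifts the basis by \<open>k\<close> up to
  phases, so its matrix lives on a single diagonal.\<close>

lemma trig_poly_banded:
  assumes "p \<in> trig_polys"
  shows "\<exists>K. \<forall>m n. (\<exists>j. K < \<bar>m $ j - n $ j\<bar>) \<longrightarrow> cinner (basis m) (lmul p (basis n)) = 0"
  using assms
proof (induction rule: trig_polys.induct)
  case zero
  have "\<tau> \<zero> = 0" using trace_smul[of \<one> 0] by (simp add: smul_zero_left)
  then show ?case by (simp add: lmul_matrix)
next
  case (step p c k)
  then obtain K where K: "\<And>m n. \<exists>j. K < \<bar>m $ j - n $ j\<bar> \<Longrightarrow> cinner (basis m) (lmul p (basis n)) = 0" by blast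
  \<comment> \<open>The sum bounds every coordinate of \<open>k\<close> at once; the maximum retains
    the band of \<open>p\<close>.\<close>
  define K' where "K' = max K (\<Sum>j\<in>UNIV. \<bar>k $ j\<bar>)"
  have "cinner (basis m) (lmul (c \<odot> mono k \<oplus> p) (basis n)) = 0" if j: "K' < \<bar>m $ j - n $ j\<bar>" for m n j
  proof -
    note pc = trig_polys_closed[OF step(1)]
    have "\<bar>k $ j\<bar> \<le> (\<Sum>j\<in>UNIV. \<bar>k $ j\<bar>)" by (rule member_le_sum) auto
    then have "m $ j - n $ j \<noteq> k $ j" using j by (auto simp: K'_def)
    then have ne: "k + n - m \<noteq> 0" by (auto simp: vec_eq_iff intro!: exI[of _ j])
    have "star A (mono m) \<otimes> (mono k \<otimes> mono n) \<asymp> star A (mono m) \<otimes> mono (k + n)"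
      by (rule phase_eq_mult_left[OF mono_mult]) simp_all
    from phase_eq_trans[OF this star_mono_mult_mono]
    have "\<tau> (star A (mono m) \<otimes> (mono k \<otimes> mono n)) = 0"
      using trace_phase[of "star A (mono m) \<otimes> (mono k \<otimes> mono n)" "mono (k + n - m)"] trace_mono[OF ne] by auto
    moreover have "\<tau> (star A (mono m) \<otimes> (p \<otimes> mono n)) = 0"
      using K[of m n] j pc by (auto simp: K'_def lmul_matrix)
    ultimately show ?thesis
      using pc by (simp add: lmul_matrix A_l_distr A_r_distr smult_mult_left smult_mult_right trace_add trace_smul)
  qed
  then show ?case by blast
qed

lemma lmul_banded_approx:
  assumes x: "x \<in> carrier A" and "0 < \<epsilon>"
  shows "\<exists>P K. bounded_clinear P \<and> (\<forall>v. norm (lmul x v - P v) \<le> \<epsilon> * norm v) \<and>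
    (\<forall>m n. (\<exists>j. K < \<bar>m $ j - n $ j\<bar>) \<longrightarrow> cinner (basis m) (P (basis n)) = 0)"
proof -
  obtain p where p: "p \<in> trig_polys" "anorm A (x \<ominus> p) < \<epsilon>"
    using trig_polys_dense[OF generated x assms(2)] by blast
  note pc = trig_polys_closed[OF p(1)]
  have "norm (lmul x v - lmul p v) \<le> \<epsilon> * norm v" for v
  proof -
    have "norm (lmul x v - lmul p v) \<le> anorm A (x \<ominus> p) * norm v"
      using lmul_properties(3)[of "x \<ominus> p" v] x pc by (simp add: lmul_diff)
    also have "\<dots> \<le> \<epsilon> * norm v" using p(2) by (intro mult_right_mono) auto
    finally show ?thesis .
  qed
  then show ?thesis using lmul_properties(1)[OF pc] trig_poly_banded[OF p(1)] by blast
qed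

end

section \<open>Diagonal operators\<close>

locale hilbert_basis =
  fixes e :: "'i \<Rightarrow> 'h::chilbert_space"
  assumes on: "orthonormal_on UNIV e" and total: "total_family UNIV e"
begin

lemma coeff_basis: "cinner (e m) (e n) = (if m = n then 1 else 0)"
  using orthonormal_onD[OF on] by simp

lemma coeff_eqI:
  assumes "\<And>n. cinner (e n) x = cinner (e n) y" shows "x = y"
proof -
  have "cinner (e n) (x - y) = 0" for n using assms by (simp add: cinner_diff_right)
  then have "x - y = 0" using total unfolding total_family_def by blast
  then show ?thesis by simp
qed

lemma orthonormal_basis_exists: "\<exists>E :: 'h set. orthonormal_basis E"
proof -
  have inj: "e m = e n \<longleftrightarrow> m = n" for m n
    using coeff_basis[of m m] coeff_basis[of m n] by (metis zero_neq_one)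
  have "orthonormal_basis (range e)"
    unfolding orthonormal_basis_def
    using total by (auto simp: coeff_basis inj total_family_def)
  then show ?thesis by blast
qed

text \<open>A coordinatewise comparison summed by Parseval's identity; the norm estimates for
  coordinate projections and for \<open>D\<close> are read off from it.\<close>

lemma weighted_norm_mono:
  assumes "\<And>n. a * (cmod (cinner (e n) x))\<^sup>2 \<le> b * (cmod (cinner (e n) y))\<^sup>2"
  shows "a * (norm x)\<^sup>2 \<le> b * (norm y)\<^sup>2"
  by (rule has_sum_mono[OF has_sum_cmult_right[OF Parseval[OF on total]]
        has_sum_cmult_right[OF Parseval[OF on total]]]) (rule assms)

lemma cinner_disjoint_supports:
  assumes "\<And>n. cinner (e n) x = 0 \<or> cinner (e n) y = 0" shows "cinner x y = 0"
proof -
  have "((\<lambda>n. cnj (cinner (e n) x) * cinner (e n) y) has_sum 0) UNIV"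
    by (rule has_sum_0) (use assms in auto)
  then show ?thesis using Parseval_cinner[OF on total, of x y] has_sum_unique by blast
qed

lemma norm_sum_disjoint_supports:
  assumes "finite I" "\<And>c n. c \<in> I \<Longrightarrow> n \<notin> S c \<Longrightarrow> cinner (e n) (u c) = 0"
    "\<And>c d. c \<in> I \<Longrightarrow> d \<in> I \<Longrightarrow> c \<noteq> d \<Longrightarrow> S c \<inter> S d = {}"
  shows "(norm (\<Sum>c\<in>I. u c))\<^sup>2 = (\<Sum>c\<in>I. (norm (u c))\<^sup>2)"
  using assms
proof (induction I rule: finite_induct)
  case (insert c I)
  have "cinner (u c) (u d) = 0" if d: "d \<in> I" for d
  proof (rule cinner_disjoint_supports)
    fix n
    have "c \<noteq> d" using insert.hyps d by auto
    then have "S c \<inter> S d = {}" using insert.prems(2) d by blast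
    then have "n \<notin> S c \<or> n \<notin> S d" by blast
    then show "cinner (e n) (u c) = 0 \<or> cinner (e n) (u d) = 0" using insert.prems(1) d by blast
  qed
  then have "cinner (u c) (\<Sum>c\<in>I. u c) = 0" by (simp add: cinner_sum_right)
  moreover have "(norm (\<Sum>c\<in>I. u c))\<^sup>2 = (\<Sum>c\<in>I. (norm (u c))\<^sup>2)"
    by (rule insert.IH) (use insert.prems in blast)+
  ultimately show ?case using insert.hyps by (simp add: norm_add_square)
qed simp

definition fproj :: "'i set \<Rightarrow> 'h \<Rightarrow> 'h" where
  "fproj S v = (\<Sum>n\<in>S. cinner (e n) v *\<^sub>C e n)"

lemma coeff_sum: "finite S \<Longrightarrow> cinner (e n) (\<Sum>m\<in>S. c m *\<^sub>C e m) = (if n \<in> S then c n else 0)"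
  by (rule orthonormal_coeff[OF on]) auto

lemma fproj_coeff: "finite S \<Longrightarrow> cinner (e n) (fproj S v) = (if n \<in> S then cinner (e n) v else 0)"
  by (simp add: fproj_def coeff_sum)

lemma fproj_eq:
  assumes "finite S" "\<And>n. n \<notin> S \<Longrightarrow> cinner (e n) v = 0" shows "fproj S v = v"
  by (rule coeff_eqI) (use assms in \<open>simp add: fproj_coeff\<close>)

lemma cinner_fproj: "cinner x (fproj S y) = cinner (fproj S x) y"
  by (simp add: fproj_def cinner_sum_right cinner_sum_left cinner_scaleC_left cinner_scaleC_right
      cinner_commute[of x] mult.commute)

lemma bounded_clinear_fproj: assumes "finite S" shows "bounded_clinear (fproj S)"
proof (rule bounded_clinearI)
  show "fproj S (x + y) = fproj S x + fproj S y" for x y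
    by (simp add: fproj_def cinner_add_right scaleC_add_left sum.distrib)
  show "fproj S (c *\<^sub>C x) = c *\<^sub>C fproj S x" for c x
    by (simp add: fproj_def cinner_scaleC_right scaleC_sum_right scaleC_scaleC)
  show "norm (fproj S x) \<le> norm x * 1" for x
    using weighted_norm_mono[of 1 "fproj S x" 1 x]
    by (simp add: fproj_coeff assms)
qed

text \<open>Discs times basis vectors are compact, and sums of compact sets are compact. The
  compactness of the diagonal operator and of the block operators rests on this.\<close>

lemma finite_combinations_compact:
  assumes "finite F"
  shows "\<exists>C. compact C \<and> (\<forall>c. (\<forall>n\<in>F. cmod (c n) \<le> 1) \<longrightarrow> (\<Sum>n\<in>F. c n *\<^sub>C e n) \<in> C)"
  using assms
proof (induction F rule: finite_induct)
  case empty
  show ?case by (intro exI[of _ "{0}"]) simp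
next
  case (insert k F)
  then obtain C where C: "compact C" "\<And>c. \<forall>n\<in>F. cmod (c n) \<le> 1 \<Longrightarrow> (\<Sum>n\<in>F. c n *\<^sub>C e n) \<in> C" by blast
  define S where "S = (\<lambda>a :: complex. a *\<^sub>C e k) ` cball 0 1"
  have "compact S" unfolding S_def
    by (intro compact_continuous_image continuous_intros compact_cball)
  then have "compact {x + y |x y. x \<in> S \<and> y \<in> C}" by (rule compact_sums[OF _ C(1)])
  moreover have "(\<Sum>n\<in>insert k F. c n *\<^sub>C e n) \<in> {x + y |x y. x \<in> S \<and> y \<in> C}"
    if "\<forall>n\<in>insert k F. cmod (c n) \<le> 1" for c
  proof -
    have "c k *\<^sub>C e k \<in> S" using that by (auto simp: S_def)
    moreover have "(\<Sum>n\<in>F. c n *\<^sub>C e n) \<in> C" using that C(2) by blast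
    ultimately show ?thesis using insert.hyps by auto
  qed
  ultimately show ?case by blast
qed

lemma cmod_coeff_le: "cmod (cinner (e n) v) \<le> norm v"
  using cinner_Cauchy_Schwarz[of "e n" v] orthonormal_on_norm[OF on, of n] by simp

end

definition diag_op :: "('i \<Rightarrow> 'h::chilbert_space) \<Rightarrow> ('i \<Rightarrow> real) \<Rightarrow> 'h \<Rightarrow> 'h" where
  "diag_op e w v = (\<Sum>\<^sub>\<infinity>n. w n *\<^sub>R (cinner (e n) v *\<^sub>C e n))"

text \<open>\<open>w_null\<close> lets the weights tend to 0 along the index set, which makes the
  diagonal operator compact.\<close>

locale weighted_basis = hilbert_basis e for e :: "'i \<Rightarrow> 'h::chilbert_space" +
  fixes w :: "'i \<Rightarrow> real"
  assumes w_pos: "0 < w n" and w_le: "w n \<le> 1"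
    and w_null: "0 < \<epsilon> \<Longrightarrow> finite {n. \<epsilon> \<le> w n}"
begin

abbreviation D :: "'h \<Rightarrow> 'h" where "D \<equiv> diag_op e w"

lemma D_coeff: "cinner (e n) (D v) = of_real (w n) * cinner (e n) v"
proof -
  have "(\<Sum>n\<in>F. (cmod (of_real (w n) * cinner (e n) v))\<^sup>2) \<le> (norm v)\<^sup>2" if F: "finite F" for F
  proof -
    have "(\<Sum>n\<in>F. (cmod (of_real (w n) * cinner (e n) v))\<^sup>2) \<le> (\<Sum>n\<in>F. (cmod (cinner (e n) v))\<^sup>2)"
      using w_pos w_le
      by (intro sum_mono power_mono) (auto simp: norm_mult less_imp_le intro!: mult_left_le_one_le)
    also have "\<dots> \<le> (norm v)\<^sup>2" by (rule Bessel_inequality[OF on F]) simp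
    finally show ?thesis .
  qed
  then have "(\<lambda>n. (of_real (w n) * cinner (e n) v) *\<^sub>C e n) summable_on UNIV"
    by (intro orthonormal_has_sum_exists[OF on])
  then have "((\<lambda>n. (of_real (w n) * cinner (e n) v) *\<^sub>C e n) has_sum
      (\<Sum>\<^sub>\<infinity>n. (of_real (w n) * cinner (e n) v) *\<^sub>C e n)) UNIV" by (rule has_sum_infsum)
  moreover have "(\<Sum>\<^sub>\<infinity>n. (of_real (w n) * cinner (e n) v) *\<^sub>C e n) = D v"
    by (simp add: diag_op_def scaleR_as_scaleC scaleC_scaleC)
  ultimately show ?thesis using orthonormal_coeff_has_sum[OF on] by simp
qed

lemma D_symmetric: "cinner (D x) y = cinner x (D y)"
proof -
  have "(\<lambda>n. cnj (cinner (e n) (D x)) * cinner (e n) y) = (\<lambda>n. cnj (cinner (e n) x) * cinner (e n) (D y))"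
    by (simp add: D_coeff mult_ac)
  then show ?thesis
    using Parseval_cinner[OF on total, of "D x" y] Parseval_cinner[OF on total, of x "D y"] has_sum_unique
    by metis
qed

lemma D_clinear: "bounded_clinear D"
proof (rule bounded_clinearI)
  show "D (x + y) = D x + D y" for x y
    by (rule coeff_eqI) (simp add: D_coeff cinner_add_right distrib_left)
  show "D (c *\<^sub>C x) = c *\<^sub>C D x" for c x
    by (rule coeff_eqI) (simp add: D_coeff cinner_scaleC_right)
  show "norm (D x) \<le> norm x * 1" for x
  proof -
    have "1 * (norm (D x))\<^sup>2 \<le> 1 * (norm x)\<^sup>2"
    proof (rule weighted_norm_mono)
      fix n
      have "w n * cmod (cinner (e n) x) \<le> cmod (cinner (e n) x)"
        using w_pos[of n] w_le[of n] by (intro mult_left_le_one_le) auto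
      then show "1 * (cmod (cinner (e n) (D x)))\<^sup>2 \<le> 1 * (cmod (cinner (e n) x))\<^sup>2"
        using w_pos[of n] by (simp add: D_coeff norm_mult power_mono)
    qed
    then show ?thesis by simp
  qed
qed

lemma norm_D_coeff_square: "(cmod (cinner (e n) (D v)))\<^sup>2 = (w n)\<^sup>2 * (cmod (cinner (e n) v))\<^sup>2"
  by (simp add: D_coeff norm_mult power_mult_distrib)

text \<open>A bound by \<open>m\<close> for the form of \<open>B\<close> at \<open>D v\<close>
  becomes a bound by \<open>s\<close> at \<open>v\<close> if \<open>m\<close> compensates the
  weights on the support of \<open>v\<close>. This and its counterpart below replace freezing the
  weight on a block.\<close>

lemma D_norm_lower:
  assumes "\<And>n. cinner (e n) v \<noteq> 0 \<Longrightarrow> s \<le> m * (w n)\<^sup>2"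
  shows "s * (norm v)\<^sup>2 \<le> m * (norm (D v))\<^sup>2"
proof (rule weighted_norm_mono)
  fix n show "s * (cmod (cinner (e n) v))\<^sup>2 \<le> m * (cmod (cinner (e n) (D v)))\<^sup>2"
    using mult_right_mono[OF assms[of n], of "(cmod (cinner (e n) v))\<^sup>2"]
    by (cases "cinner (e n) v = 0") (auto simp: norm_D_coeff_square mult.assoc)
qed

lemma D_norm_upper:
  assumes "\<And>n. cinner (e n) v \<noteq> 0 \<Longrightarrow> m * (w n)\<^sup>2 \<le> s"
  shows "m * (norm (D v))\<^sup>2 \<le> s * (norm v)\<^sup>2"
proof (rule weighted_norm_mono)
  fix n show "m * (cmod (cinner (e n) (D v)))\<^sup>2 \<le> s * (cmod (cinner (e n) v))\<^sup>2"
    using mult_right_mono[OF assms[of n], of "(cmod (cinner (e n) v))\<^sup>2"]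
    by (cases "cinner (e n) v = 0") (auto simp: norm_D_coeff_square mult.assoc)
qed

text \<open>Total boundedness: the coordinates with weight below \<open>\<epsilon> / 4\<close>
  contribute at most that much on the unit ball, and the finitely many others stay in a compact
  set.\<close>

lemma D_compact: "compact (closure (D ` cball 0 1))"
  unfolding compact_eq_totally_bounded
proof (intro conjI allI impI)
  show "complete (closure (D ` cball 0 1))"
    by (simp add: complete_eq_closed)
  fix \<epsilon> :: real assume \<epsilon>: "0 < \<epsilon>"
  define F where "F = {n. \<epsilon> / 4 \<le> w n}"
  have F: "finite F" unfolding F_def using \<epsilon> by (intro w_null) simp
  obtain C where C: "compact C" "\<And>c. \<forall>n\<in>F. cmod (c n) \<le> 1 \<Longrightarrow> (\<Sum>n\<in>F. c n *\<^sub>C e n) \<in> C"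
    using finite_combinations_compact[OF F] by blast
  obtain k where k: "finite k" "C \<subseteq> (\<Union>x\<in>k. ball x (\<epsilon> / 4))"
    using C(1) \<epsilon> unfolding compact_eq_totally_bounded by (metis zero_less_divide_iff zero_less_numeral)
  have "D v \<in> (\<Union>x\<in>k. cball x (\<epsilon> / 2))" if v: "v \<in> cball 0 1" for v
  proof -
    have "cmod (cinner (e n) (D v)) \<le> 1" for n
    proof -
      have "w n * cmod (cinner (e n) v) \<le> 1 * norm v"
        using w_pos[of n] w_le[of n] by (intro mult_mono cmod_coeff_le) auto
      then show ?thesis using v w_pos[of n] by (simp add: D_coeff norm_mult)
    qed
    then have "fproj F (D v) \<in> C" unfolding fproj_def by (intro C(2)) blast
    then obtain x where x: "x \<in> k" "dist x (fproj F (D v)) < \<epsilon> / 4" using k(2) by auto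
    have "1 * (norm (fproj F (D v) - D v))\<^sup>2 \<le> (\<epsilon> / 4)\<^sup>2 * (norm v)\<^sup>2"
    proof (rule weighted_norm_mono)
      fix n
      show "1 * (cmod (cinner (e n) (fproj F (D v) - D v)))\<^sup>2 \<le> (\<epsilon> / 4)\<^sup>2 * (cmod (cinner (e n) v))\<^sup>2"
      proof (cases "n \<in> F")
        case False
        then have "w n \<le> \<epsilon> / 4" by (simp add: F_def)
        then have "(w n)\<^sup>2 \<le> (\<epsilon> / 4)\<^sup>2" using w_pos[of n] by (intro power_mono) auto
        then show ?thesis
          using False mult_right_mono[of "(w n)\<^sup>2" "(\<epsilon> / 4)\<^sup>2" "(cmod (cinner (e n) v))\<^sup>2"]
          by (simp add: cinner_diff_right fproj_coeff F norm_D_coeff_square)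
      qed (simp add: cinner_diff_right fproj_coeff F)
    qed
    also have "\<dots> \<le> (\<epsilon> / 4)\<^sup>2 * 1"
      using v by (intro mult_left_mono) (auto simp: power_le_one)
    finally have "dist (fproj F (D v)) (D v) \<le> \<epsilon> / 4"
      using \<epsilon> by (simp add: dist_norm power2_le_iff_abs_le abs_le_iff)
    then have "dist x (D v) \<le> \<epsilon> / 2" using x(2) dist_triangle[of x "D v" "fproj F (D v)"] by linarith
    then show ?thesis using x(1) by auto
  qed
  then have "D ` cball 0 1 \<subseteq> (\<Union>x\<in>k. cball x (\<epsilon> / 2))" by blast
  moreover have "closed (\<Union>x\<in>k. cball x (\<epsilon> / 2))" using k(1) by (intro closed_UN) auto
  ultimately have "closure (D ` cball 0 1) \<subseteq> (\<Union>x\<in>k. cball x (\<epsilon> / 2))" by (rule closure_minimal)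
  also have "\<dots> \<subseteq> (\<Union>x\<in>k. ball x \<epsilon>)" using \<epsilon> by force
  finally show "\<exists>k. finite k \<and> closure (D ` cball 0 1) \<subseteq> (\<Union>x\<in>k. ball x \<epsilon>)" using k(1) by blast
qed

lemma compact_positive_sandwich:
  assumes B: "bounded_clinear B" "\<And>v. cinner v (B v) \<in> \<real>\<^sub>\<ge>\<^sub>0"
  shows "compact_positive (D \<circ> B \<circ> D)"
proof
  show "bounded_clinear (D \<circ> B \<circ> D)"
    using bounded_clinear_compose[OF D_clinear bounded_clinear_compose[OF B(1) D_clinear]]
    by (simp add: o_def)
  show "cinner x ((D \<circ> B \<circ> D) x) \<in> \<real>\<^sub>\<ge>\<^sub>0" for x
    using B(2)[of "D x"] by (simp add: D_symmetric)
  fix X :: "nat \<Rightarrow> 'h" assume X: "\<And>n. norm (X n) \<le> 1"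
  have "\<forall>n. D (X n) \<in> closure (D ` cball 0 1)"
    using X by (intro allI subsetD[OF closure_subset] imageI) simp
  then obtain l r where r: "strict_mono r" "((\<lambda>n. D (X n)) \<circ> r) \<longlonglongrightarrow> l"
    using D_compact unfolding compact_def by metis
  have "(\<lambda>n. D (B (D (X (r n))))) \<longlonglongrightarrow> D (B l)"
    by (intro bounded_linear.tendsto[OF bounded_clinear_imp_bounded_linear[OF D_clinear]]
        bounded_linear.tendsto[OF bounded_clinear_imp_bounded_linear[OF B(1)]])
       (use r(2) in \<open>simp add: o_def\<close>)
  then show "\<exists>r l. strict_mono r \<and> (\<lambda>n. (D \<circ> B \<circ> D) (X (r n))) \<longlonglongrightarrow> l"
    using r(1) by (auto simp: o_def)
qed

end

section \<open>Spectra of finite blocks\<close>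

context hilbert_basis
begin

text \<open>Adding the identity to the compressed operator keeps the kernel of the compression among the
  eigenvectors with positive eigenvalue, so that these form a full basis of the block.\<close>

lemma compact_positive_block:
  assumes B: "bounded_clinear B" "\<And>v. cinner v (B v) \<in> \<real>\<^sub>\<ge>\<^sub>0" and Q: "finite Q"
  shows "compact_positive (\<lambda>v. fproj Q (B (fproj Q v) + fproj Q v))"
proof
  note P = bounded_clinear_fproj[OF Q]
  have BI: "bounded_clinear (\<lambda>v. B v + v)"
    using B(1) unfolding bounded_clinear_def
    by (auto simp: scaleC_add_right intro: bounded_linear_add bounded_linear_ident)
  show lin: "bounded_clinear (\<lambda>v. fproj Q (B (fproj Q v) + fproj Q v))"
    using bounded_clinear_compose[OF P bounded_clinear_compose[OF BI P]] .
  show "cinner x (fproj Q (B (fproj Q x) + fproj Q x)) \<in> \<real>\<^sub>\<ge>\<^sub>0" for x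
    using B(2)[of "fproj Q x"]
    by (simp add: cinner_fproj cinner_add_right cinner_self nonneg_Reals_add_I)
  fix X :: "nat \<Rightarrow> 'h" assume X: "\<And>n. norm (X n) \<le> 1"
  obtain C where C: "compact C" "\<And>c. \<forall>n\<in>Q. cmod (c n) \<le> 1 \<Longrightarrow> (\<Sum>n\<in>Q. c n *\<^sub>C e n) \<in> C"
    using finite_combinations_compact[OF Q] by blast
  have "\<forall>n. fproj Q (X n) \<in> C"
    unfolding fproj_def using X cmod_coeff_le order_trans by (intro allI C(2)) blast
  then obtain l r where r: "strict_mono r" "((\<lambda>n. fproj Q (X n)) \<circ> r) \<longlonglongrightarrow> l"
    using C(1) unfolding compact_def by metis
  then have lim: "(\<lambda>n. fproj Q (X (r n))) \<longlonglongrightarrow> l" by (simp add: o_def)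
  have "(\<lambda>n. fproj Q (B (fproj Q (X (r n))) + fproj Q (X (r n)))) \<longlonglongrightarrow> fproj Q (B l + l)"
    by (intro bounded_linear.tendsto[OF bounded_clinear_imp_bounded_linear[OF P]] tendsto_add lim
        bounded_linear.tendsto[OF bounded_clinear_imp_bounded_linear[OF B(1)]])
  then show "\<exists>r l. strict_mono r \<and> (\<lambda>n. fproj Q (B (fproj Q (X (r n))) + fproj Q (X (r n)))) \<longlonglongrightarrow> l"
    using r(1) by blast
qed

text \<open>The diagonalization of the compression of \<open>B\<close> to the coordinates in
  \<open>Q\<close> is phrased through quadratic forms, because the counting compares forms and
  because this version can be transported by translations.\<close>

lemma block_spectrum:
  assumes B: "bounded_clinear B" "\<And>v. cinner v (B v) \<in> \<real>\<^sub>\<ge>\<^sub>0" and Q: "finite Q"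
    and diag: "\<And>n. n \<in> Q \<Longrightarrow> Re (cinner (e n) (B (e n))) = \<beta>"
  obtains G and r :: "'h \<Rightarrow> real" where "finite G" "card G = card Q" "orthonormal_on G (\<lambda>g. g)"
    and "\<And>g. g \<in> G \<Longrightarrow> 0 \<le> r g" "\<And>g n. g \<in> G \<Longrightarrow> n \<notin> Q \<Longrightarrow> cinner (e n) g = 0"
    and "sum r G = real (card Q) * \<beta>"
    and "\<And>u. (\<And>n. n \<notin> Q \<Longrightarrow> cinner (e n) u = 0) \<Longrightarrow>
      (norm u)\<^sup>2 = (\<Sum>g\<in>G. (cmod (cinner g u))\<^sup>2) \<and>
      Re (cinner u (B u)) = (\<Sum>g\<in>G. r g * (cmod (cinner g u))\<^sup>2)"
proof -
  define T where "T v = fproj Q (B (fproj Q v) + fproj Q v)" for v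
  interpret T: compact_positive T
    unfolding T_def[abs_def] by (rule compact_positive_block[OF B Q])
  have card_le: "card G \<le> card Q" if "eigen_family T 0 G" for G
  proof (rule T.eigen_family_small[OF Q _ that, of e])
    fix v assume v: "\<And>k. k \<in> Q \<Longrightarrow> cinner (e k) v = 0"
    have "fproj Q v = 0" by (rule coeff_eqI) (use v in \<open>simp add: fproj_coeff Q\<close>)
    then have "T v = 0"
      by (simp add: T_def bounded_clinear_zero[OF B(1)] bounded_clinear_zero[OF bounded_clinear_fproj[OF Q]])
    then show "Re (cinner v (T v)) \<le> 0 * (norm v)\<^sup>2" by simp
  qed
  obtain G where G: "eigen_family T 0 G"
    and max: "\<And>w r. norm w = 1 \<Longrightarrow> T w = r *\<^sub>R w \<Longrightarrow> 0 < r \<Longrightarrow> \<exists>g\<in>G. cinner g w \<noteq> 0"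
    using T.maximal_eigen_family[OF card_le] by blast
  have fG: "finite G" and oG: "orthonormal_on G (\<lambda>g. g)" using G by (auto simp: eigen_family_def)
  obtain p where p: "\<And>g. g \<in> G \<Longrightarrow> 0 < p g" "\<And>g. g \<in> G \<Longrightarrow> T g = p g *\<^sub>R g"
    using G unfolding eigen_family_def by metis
  have supp: "cinner (e n) g = 0" if "g \<in> G" "n \<notin> Q" for g n
  proof -
    have "cinner (e n) (T g) = 0" using that(2) by (simp add: T_def fproj_coeff Q)
    then show ?thesis using p[OF that(1)] by (simp add: cinner_scaleR_right)
  qed
  have form: "Re (cinner u (T u)) = Re (cinner u (B u)) + (norm u)\<^sup>2"
    if "\<And>n. n \<notin> Q \<Longrightarrow> cinner (e n) u = 0" for u
  proof -
    have u: "fproj Q u = u" by (rule fproj_eq[OF Q that])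
    then show ?thesis by (simp add: T_def cinner_fproj cinner_add_right)
  qed
  have expand: "u = (\<Sum>g\<in>G. cinner g u *\<^sub>C g)" if u: "\<And>n. n \<notin> Q \<Longrightarrow> cinner (e n) u = 0" for u
  proof -
    define z where "z = u - (\<Sum>g\<in>G. cinner g u *\<^sub>C g)"
    have zQ: "cinner (e n) z = 0" if "n \<notin> Q" for n
      using u[OF that] supp that by (simp add: z_def cinner_diff_right cinner_sum_right cinner_scaleC_right)
    have zG: "cinner g z = 0" if "g \<in> G" for g
      using orthonormal_coeff[OF oG fG order_refl that, of "\<lambda>g. cinner g u"] that
      by (simp add: z_def cinner_diff_right)
    \<comment> \<open>On the block the form of \<open>T\<close> is at least
      \<open>(norm z)\<^sup>2\<close>, so a nonzero residual \<open>z\<close> would produce one more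
      orthogonal eigenvector.\<close>
    have "\<not> 0 * (norm z)\<^sup>2 < Re (cinner z (T z))"
    proof
      assume "0 * (norm z)\<^sup>2 < Re (cinner z (T z))"
      then obtain w r where "norm w = 1" "0 < r" "T w = r *\<^sub>R w" "\<forall>g\<in>G. cinner g w = 0"
        using T.eigenvector_orthogonal_exists[of G z 0] p(2) zG by blast
      then show False using max by blast
    qed
    moreover have "0 \<le> Re (cinner z (B z))" using B(2)[of z] by (simp add: complex_nonneg_Reals_iff)
    moreover have "Re (cinner z (T z)) = Re (cinner z (B z)) + (norm z)\<^sup>2" by (rule form[OF zQ])
    ultimately have "(norm z)\<^sup>2 \<le> 0" by linarith
    then show ?thesis by (simp add: z_def)
  qed
  \<comment> \<open>This removes the identity that was added in \<open>T\<close>.\<close>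
  define r where "r g = p g - 1" for g
  have block: "(norm u)\<^sup>2 = (\<Sum>g\<in>G. (cmod (cinner g u))\<^sup>2) \<and>
      Re (cinner u (B u)) = (\<Sum>g\<in>G. r g * (cmod (cinner g u))\<^sup>2)"
    if u: "\<And>n. n \<notin> Q \<Longrightarrow> cinner (e n) u = 0" for u
  proof -
    define c where "c g = cinner g u" for g
    have uc: "u = (\<Sum>g\<in>G. c g *\<^sub>C g)" unfolding c_def by (rule expand[OF u])
    have nu: "(norm u)\<^sup>2 = (\<Sum>g\<in>G. (cmod (c g))\<^sup>2)"
      by (subst uc) (rule norm_orthonormal_sum[OF oG fG order_refl])
    have "T u = (\<Sum>g\<in>G. (of_real (p g) * c g) *\<^sub>C g)"
      by (subst uc, subst T.T_sum)
         (auto simp: T.T_scaleC p(2) scaleR_as_scaleC scaleC_scaleC mult.commute intro: sum.cong)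
    then have "cinner u (T u) = (\<Sum>g\<in>G. cnj (c g) * (of_real (p g) * c g))"
      using cinner_orthonormal_sums[OF oG fG order_refl, of c "\<lambda>g. of_real (p g) * c g"] uc by simp
    then have "Re (cinner u (T u)) = (\<Sum>g\<in>G. Re (cnj (c g) * (of_real (p g) * c g)))" by simp
    also have "\<dots> = (\<Sum>g\<in>G. p g * (cmod (c g))\<^sup>2)"
      unfolding cmod_power2 by (rule sum.cong) (auto simp: power2_eq_square algebra_simps)
    finally have "Re (cinner u (B u)) = (\<Sum>g\<in>G. p g * (cmod (c g))\<^sup>2) - (\<Sum>g\<in>G. (cmod (c g))\<^sup>2)"
      using form[OF u] nu by simp
    also have "\<dots> = (\<Sum>g\<in>G. r g * (cmod (c g))\<^sup>2)"
      by (simp add: r_def left_diff_distrib sum_subtractf)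
    finally show ?thesis using nu by (simp add: c_def)
  qed
  have r0: "0 \<le> r g" if g: "g \<in> G" for g
  proof -
    have "Re (cinner g (B g)) = (\<Sum>h\<in>G. r h * (cmod (cinner h g))\<^sup>2)"
      using block[of g] supp[OF g] by blast
    also have "\<dots> = (\<Sum>h\<in>G. if h = g then r h else 0)"
      by (rule sum.cong) (use orthonormal_onD[OF oG _ g] in auto)
    finally have "Re (cinner g (B g)) = r g" using fG g by (simp add: sum.delta')
    then show ?thesis using B(2)[of g] by (simp add: complex_nonneg_Reals_iff)
  qed
  have eQ: "cinner (e m) (e n) = 0" if "n \<in> Q" "m \<notin> Q" for m n using that by (auto simp: coeff_basis)
  have gn: "(\<Sum>n\<in>Q. (cmod (cinner g (e n)))\<^sup>2) = 1" if g: "g \<in> G" for g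
  proof -
    have "fproj Q g = g" by (rule fproj_eq[OF Q]) (rule supp[OF g])
    then have "(norm g)\<^sup>2 = (\<Sum>n\<in>Q. (cmod (cinner (e n) g))\<^sup>2)"
      using norm_orthonormal_sum[OF on Q, of "\<lambda>n. cinner (e n) g"] by (simp add: fproj_def)
    then show ?thesis using orthonormal_on_norm[OF oG g] by (simp add: cmod_cinner_commute[of g])
  qed
  \<comment> \<open>Summing \<open>(cmod (cinner g (e n)))\<^sup>2\<close> over both bases in either
    order compares the dimensions; the same sum weighted with \<open>r\<close> compares the
    traces.\<close>
  have "real (card Q) = (\<Sum>n\<in>Q. (norm (e n))\<^sup>2)" using orthonormal_on_norm[OF on] by simp
  also have "\<dots> = (\<Sum>n\<in>Q. \<Sum>g\<in>G. (cmod (cinner g (e n)))\<^sup>2)"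
    by (rule sum.cong) (use block eQ in blast)+
  also have "\<dots> = (\<Sum>g\<in>G. \<Sum>n\<in>Q. (cmod (cinner g (e n)))\<^sup>2)" by (rule sum.swap)
  also have "\<dots> = real (card G)" by (simp add: gn)
  finally have card: "card G = card Q" by simp
  have "real (card Q) * \<beta> = (\<Sum>n\<in>Q. Re (cinner (e n) (B (e n))))" by (simp add: diag)
  also have "\<dots> = (\<Sum>n\<in>Q. \<Sum>g\<in>G. r g * (cmod (cinner g (e n)))\<^sup>2)"
    by (rule sum.cong) (use block eQ in blast)+
  also have "\<dots> = (\<Sum>g\<in>G. \<Sum>n\<in>Q. r g * (cmod (cinner g (e n)))\<^sup>2)" by (rule sum.swap)
  also have "\<dots> = sum r G" by (simp add: gn flip: sum_distrib_left)
  finally have "sum r G = real (card Q) * \<beta>" by simp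
  then show ?thesis using that[of G r] fG card oG r0 supp block by blast
qed

text \<open>The map \<open>V\<close> below carries vectors supported on the translated block
  isometrically to vectors supported on \<open>Q\<close>, and the phases \<alpha> are built in so
  that it intertwines the forms of \<open>B\<close>. The family \<open>f\<close> is the image of
  \<open>G\<close> under the adjoint of \<open>V\<close>.\<close>

lemma block_translate:
  assumes B: "bounded_clinear B" and Q: "finite Q" and \<sigma>: "inj_on \<sigma> Q"
    and G: "finite G" "orthonormal_on G (\<lambda>g. g)" "\<And>g n. g \<in> G \<Longrightarrow> n \<notin> Q \<Longrightarrow> cinner (e n) g = 0"
    and block: "\<And>u. (\<And>n. n \<notin> Q \<Longrightarrow> cinner (e n) u = 0) \<Longrightarrow>
      (norm u)\<^sup>2 = (\<Sum>g\<in>G. (cmod (cinner g u))\<^sup>2) \<and>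
      Re (cinner u (B u)) = (\<Sum>g\<in>G. r g * (cmod (cinner g u))\<^sup>2)"
    and \<alpha>: "\<And>n. cmod (\<alpha> n) = 1" "\<And>m n. m \<in> Q \<Longrightarrow> n \<in> Q \<Longrightarrow>
      cinner (e (\<sigma> m)) (B (e (\<sigma> n))) = cnj (\<alpha> m) * \<alpha> n * cinner (e m) (B (e n))"
  obtains f where "orthonormal_on G f" "\<And>g n. g \<in> G \<Longrightarrow> n \<notin> \<sigma> ` Q \<Longrightarrow> cinner (e n) (f g) = 0"
    and "\<And>u. (\<And>n. n \<notin> \<sigma> ` Q \<Longrightarrow> cinner (e n) u = 0) \<Longrightarrow>
      (norm u)\<^sup>2 = (\<Sum>g\<in>G. (cmod (cinner (f g) u))\<^sup>2) \<and>
      Re (cinner u (B u)) = (\<Sum>g\<in>G. r g * (cmod (cinner (f g) u))\<^sup>2)"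
proof -
  have on\<sigma>: "orthonormal_on Q (\<lambda>n. e (\<sigma> n))"
    using \<sigma> by (auto simp: orthonormal_on_def coeff_basis inj_on_eq_iff)
  have onQ: "orthonormal_on Q e" by (rule orthonormal_on_subset[OF on]) simp
  have unit: "\<alpha> n * cnj (\<alpha> n) = 1" for n
    using \<alpha>(1)[of n] by (simp flip: complex_norm_square)
  define f where "f g = (\<Sum>n\<in>Q. (cnj (\<alpha> n) * cinner (e n) g) *\<^sub>C e (\<sigma> n))" for g
  define V where "V u = (\<Sum>n\<in>Q. (\<alpha> n * cinner (e (\<sigma> n)) u) *\<^sub>C e n)" for u
  have gexp: "g = (\<Sum>n\<in>Q. cinner (e n) g *\<^sub>C e n)" if "g \<in> G" for g
    using fproj_eq[OF Q, of g] G(3)[OF that] by (simp add: fproj_def)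
  have uexp: "u = (\<Sum>n\<in>Q. cinner (e (\<sigma> n)) u *\<^sub>C e (\<sigma> n))"
    if "\<And>n. n \<notin> \<sigma> ` Q \<Longrightarrow> cinner (e n) u = 0" for u
    using fproj_eq[of "\<sigma> ` Q" u] that Q \<sigma> by (simp add: fproj_def sum.reindex)
  have Vf: "cinner g (V u) = cinner (f g) u" for g u
  proof -
    have "cinner g (V u) = (\<Sum>n\<in>Q. \<alpha> n * cinner (e (\<sigma> n)) u * cinner g (e n))"
      by (simp add: V_def cinner_sum_right cinner_scaleC_right)
    also have "\<dots> = (\<Sum>n\<in>Q. cnj (cnj (\<alpha> n) * cinner (e n) g) * cinner (e (\<sigma> n)) u)"
      by (rule sum.cong) (simp_all add: cinner_commute[of g])
    also have "\<dots> = cinner (f g) u" by (simp add: f_def cinner_sum_left cinner_scaleC_left)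
    finally show ?thesis .
  qed
  show ?thesis
  proof
    show "orthonormal_on G f"
      unfolding orthonormal_on_def
    proof (intro ballI)
      fix g h assume g: "g \<in> G" and h: "h \<in> G"
      have "cinner (f g) (f h) = (\<Sum>n\<in>Q. cnj (cnj (\<alpha> n) * cinner (e n) g) * (cnj (\<alpha> n) * cinner (e n) h))"
        unfolding f_def by (rule cinner_orthonormal_sums[OF on\<sigma> Q order_refl])
      also have "\<dots> = (\<Sum>n\<in>Q. cnj (cinner (e n) g) * cinner (e n) h)"
      proof (rule sum.cong[OF refl])
        fix n
        have "cnj (cnj (\<alpha> n) * cinner (e n) g) * (cnj (\<alpha> n) * cinner (e n) h)
          = (\<alpha> n * cnj (\<alpha> n)) * (cnj (cinner (e n) g) * cinner (e n) h)" by (simp add: mult_ac)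
        then show "cnj (cnj (\<alpha> n) * cinner (e n) g) * (cnj (\<alpha> n) * cinner (e n) h)
          = cnj (cinner (e n) g) * cinner (e n) h" by (simp add: unit)
      qed
      also have "\<dots> = cinner (\<Sum>n\<in>Q. cinner (e n) g *\<^sub>C e n) (\<Sum>n\<in>Q. cinner (e n) h *\<^sub>C e n)"
        by (rule cinner_orthonormal_sums[OF onQ Q order_refl, symmetric])
      also have "\<dots> = cinner g h" by (simp only: gexp[OF g, symmetric] gexp[OF h, symmetric])
      finally show "cinner (f g) (f h) = (if g = h then 1 else 0)" using orthonormal_onD[OF G(2) g h] by simp
    qed
    show "cinner (e n) (f g) = 0" if "n \<notin> \<sigma> ` Q" for g n
      using that by (auto simp: f_def cinner_sum_right cinner_scaleC_right coeff_basis intro!: sum.neutral)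
    fix u assume u: "\<And>n. n \<notin> \<sigma> ` Q \<Longrightarrow> cinner (e n) u = 0"
    define a where "a n = cinner (e (\<sigma> n)) u" for n
    have ua: "u = (\<Sum>n\<in>Q. a n *\<^sub>C e (\<sigma> n))" unfolding a_def by (rule uexp[OF u])
    have Va: "V u = (\<Sum>n\<in>Q. (\<alpha> n * a n) *\<^sub>C e n)" by (simp add: V_def a_def)
    have supp: "cinner (e n) (V u) = 0" if "n \<notin> Q" for n
      using that by (simp add: Va coeff_sum Q)
    have "(norm (V u))\<^sup>2 = (\<Sum>n\<in>Q. (cmod (a n))\<^sup>2)"
      unfolding Va norm_orthonormal_sum[OF onQ Q order_refl] by (simp add: norm_mult \<alpha>(1))
    also have "\<dots> = (norm u)\<^sup>2"
      by (subst ua) (rule norm_orthonormal_sum[OF on\<sigma> Q order_refl, symmetric])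
    finally have nV: "(norm (V u))\<^sup>2 = (norm u)\<^sup>2" .
    have form_sum: "cinner (\<Sum>n\<in>Q. c n *\<^sub>C x n) (B (\<Sum>n\<in>Q. c n *\<^sub>C x n))
        = (\<Sum>m\<in>Q. \<Sum>n\<in>Q. cnj (c m) * (c n * cinner (x m) (B (x n))))" for c and x :: "'i \<Rightarrow> 'h"
      by (simp add: bounded_clinear_sum[OF B] bounded_clinear_scaleC[OF B] cinner_sum_left cinner_sum_right
          cinner_scaleC_left cinner_scaleC_right sum_distrib_left sum_distrib_right mult_ac)
         (rule sum.swap)
    have "cinner (V u) (B (V u)) = (\<Sum>m\<in>Q. \<Sum>n\<in>Q. cnj (\<alpha> m * a m) * ((\<alpha> n * a n) * cinner (e m) (B (e n))))"
      unfolding Va by (rule form_sum)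
    also have "\<dots> = (\<Sum>m\<in>Q. \<Sum>n\<in>Q. cnj (a m) * (a n * cinner (e (\<sigma> m)) (B (e (\<sigma> n)))))"
      by (intro sum.cong) (simp_all add: \<alpha>(2) mult_ac)
    also have "\<dots> = cinner u (B u)"
      unfolding form_sum[of a "\<lambda>n. e (\<sigma> n)", symmetric] by (simp only: ua[symmetric])
    finally have "cinner (V u) (B (V u)) = cinner u (B u)" .
    then show "(norm u)\<^sup>2 = (\<Sum>g\<in>G. (cmod (cinner (f g) u))\<^sup>2) \<and>
      Re (cinner u (B u)) = (\<Sum>g\<in>G. r g * (cmod (cinner (f g) u))\<^sup>2)"
      using block[OF supp] nV by (simp add: Vf)
  qed
qed

text \<open>The banded \<open>P\<close> has no cross terms between different pieces. Replacing
  \<open>B\<close> by \<open>P\<close> costs \<epsilon> in the whole form and \<epsilon> again over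
  all pieces together, whence the factor 2.\<close>

lemma decoupling:
  assumes B: "bounded_clinear B" and P: "bounded_clinear P"
    and close: "\<And>v. norm (B v - P v) \<le> \<epsilon> * norm v"
    and I: "finite I" and supp: "\<And>c n. c \<in> I \<Longrightarrow> n \<notin> S c \<Longrightarrow> cinner (e n) (u c) = 0"
    and disj: "\<And>c d. c \<in> I \<Longrightarrow> d \<in> I \<Longrightarrow> c \<noteq> d \<Longrightarrow> S c \<inter> S d = {}"
    and sep: "\<And>c d m n. c \<in> I \<Longrightarrow> d \<in> I \<Longrightarrow> c \<noteq> d \<Longrightarrow> m \<in> S c \<Longrightarrow> n \<in> S d \<Longrightarrow> cinner (e m) (P (e n)) = 0"
  shows "\<bar>Re (cinner (\<Sum>c\<in>I. u c) (B (\<Sum>c\<in>I. u c))) - (\<Sum>c\<in>I. Re (cinner (u c) (B (u c))))\<bar>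
    \<le> 2 * \<epsilon> * (\<Sum>c\<in>I. (norm (u c))\<^sup>2)"
proof -
  define U where "U = (\<Sum>c\<in>I. u c)"
  have nU: "(norm U)\<^sup>2 = (\<Sum>c\<in>I. (norm (u c))\<^sup>2)"
    unfolding U_def by (rule norm_sum_disjoint_supports[OF I supp disj])
  have close': "\<bar>Re (cinner v (B v)) - Re (cinner v (P v))\<bar> \<le> \<epsilon> * (norm v)\<^sup>2" for v
  proof -
    have "\<bar>Re (cinner v (B v)) - Re (cinner v (P v))\<bar> = \<bar>Re (cinner v (B v - P v))\<bar>"
      by (simp add: cinner_diff_right)
    also have "\<dots> \<le> cmod (cinner v (B v - P v))" by (rule abs_Re_le_cmod)
    also have "\<dots> \<le> norm v * norm (B v - P v)" by (rule cinner_Cauchy_Schwarz)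
    also have "\<dots> \<le> norm v * (\<epsilon> * norm v)" by (intro mult_left_mono close) simp
    finally show ?thesis by (simp add: power2_eq_square mult_ac)
  qed
  have cross: "cinner (u c) (P (u d)) = 0" if c: "c \<in> I" and d: "d \<in> I" and "c \<noteq> d" for c d
  proof (rule cinner_disjoint_supports)
    fix m
    show "cinner (e m) (u c) = 0 \<or> cinner (e m) (P (u d)) = 0"
    proof (cases "m \<in> S c")
      case True
      have "((\<lambda>n. P (cinner (e n) (u d) *\<^sub>C e n)) has_sum P (u d)) UNIV"
        by (rule has_sum_bounded_linear[OF bounded_clinear_imp_bounded_linear[OF P]])
           (rule orthonormal_expansion[OF on total])
      then have "((\<lambda>n. cinner (e m) (P (cinner (e n) (u d) *\<^sub>C e n))) has_sum cinner (e m) (P (u d))) UNIV"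
        by (rule has_sum_cinner)
      moreover have "cinner (e m) (P (cinner (e n) (u d) *\<^sub>C e n)) = 0" for n
        using supp[OF d, of n] sep[OF c d \<open>c \<noteq> d\<close> True, of n]
        by (cases "n \<in> S d") (auto simp: bounded_clinear_scaleC[OF P] cinner_scaleC_right bounded_clinear_zero[OF P])
      ultimately have "((\<lambda>n :: 'i. 0) has_sum cinner (e m) (P (u d))) UNIV" by simp
      then show ?thesis using has_sum_unique has_sum_0_simp by blast
    qed (use supp[OF c] in blast)
  qed
  have "cinner U (P U) = (\<Sum>c\<in>I. \<Sum>d\<in>I. cinner (u c) (P (u d)))"
    by (simp add: U_def bounded_clinear_sum[OF P] cinner_sum_left cinner_sum_right) (rule sum.swap)
  also have "\<dots> = (\<Sum>c\<in>I. \<Sum>d\<in>I. if d = c then cinner (u c) (P (u c)) else 0)"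
    by (intro sum.cong) (auto simp: cross)
  also have "\<dots> = (\<Sum>c\<in>I. cinner (u c) (P (u c)))" using I by (simp add: sum.delta)
  finally have PU: "Re (cinner U (P U)) = (\<Sum>c\<in>I. Re (cinner (u c) (P (u c))))" by simp
  have "\<bar>(\<Sum>c\<in>I. Re (cinner (u c) (B (u c)))) - (\<Sum>c\<in>I. Re (cinner (u c) (P (u c))))\<bar>
      \<le> (\<Sum>c\<in>I. \<bar>Re (cinner (u c) (B (u c))) - Re (cinner (u c) (P (u c)))\<bar>)"
    unfolding sum_subtractf[symmetric] by (rule sum_abs)
  also have "\<dots> \<le> (\<Sum>c\<in>I. \<epsilon> * (norm (u c))\<^sup>2)" by (intro sum_mono close')
  finally have "\<bar>(\<Sum>c\<in>I. Re (cinner (u c) (B (u c)))) - Re (cinner U (P U))\<bar> \<le> \<epsilon> * (norm U)\<^sup>2"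
    by (simp add: PU nU sum_distrib_left)
  then show ?thesis
    using close'[of U] unfolding nU[symmetric] U_def[symmetric] by linarith
qed

end

section \<open>Counting eigenvalues block by block\<close>

text \<open>The eigenvalues \<open>r\<close> do not depend on the cell \<open>q\<close>, only the
  eigenvectors \<open>f q\<close> do. \<open>separated\<close> relates a block to everything outside
  its cell, so that the part of a vector in far cells can be one more piece in
  \<open>decoupling\<close>.\<close>

locale block_decomposition = weighted_basis e w
  for e :: "'i \<Rightarrow> 'h::chilbert_space" and w :: "'i \<Rightarrow> real" +
  fixes B P :: "'h \<Rightarrow> 'h" and \<epsilon> :: real
    and cell :: "'i \<Rightarrow> 'q" and bl :: "'q \<Rightarrow> 'i set"
    and G :: "'g set" and r :: "'g \<Rightarrow> real" and f :: "'q \<Rightarrow> 'g \<Rightarrow> 'h"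
  assumes B: "bounded_clinear B" and B_pos: "\<And>v. cinner v (B v) \<in> \<real>\<^sub>\<ge>\<^sub>0"
    and P: "bounded_clinear P" and close: "\<And>v. norm (B v - P v) \<le> \<epsilon> * norm v"
    and cell: "n \<in> bl q \<Longrightarrow> cell n = q"
    and separated: "n \<in> bl q \<Longrightarrow> cell m \<noteq> q \<Longrightarrow> cinner (e n) (P (e m)) = 0"
      "n \<in> bl q \<Longrightarrow> cell m \<noteq> q \<Longrightarrow> cinner (e m) (P (e n)) = 0"
    and bl_finite: "finite (bl q)"
    and G_finite: "finite G" and f_orthonormal: "orthonormal_on G (f q)"
    and f_support: "g \<in> G \<Longrightarrow> n \<notin> bl q \<Longrightarrow> cinner (e n) (f q g) = 0"
    and f_block: "(\<And>n. n \<notin> bl q \<Longrightarrow> cinner (e n) u = 0) \<Longrightarrow>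
      (norm u)\<^sup>2 = (\<Sum>g\<in>G. (cmod (cinner (f q g) u))\<^sup>2) \<and>
      Re (cinner u (B u)) = (\<Sum>g\<in>G. r g * (cmod (cinner (f q g) u))\<^sup>2)"
begin

abbreviation T :: "'h \<Rightarrow> 'h" where "T \<equiv> D \<circ> B \<circ> D"

sublocale T: compact_positive T
  by (rule compact_positive_sandwich[OF B B_pos])

lemma form_T: "cinner v (T v) = cinner (D v) (B (D v))"
  by (simp add: D_symmetric)

lemma bl_disjoint: "q \<noteq> q' \<Longrightarrow> bl q \<inter> bl q' = {}"
  using cell by blast

lemma f_pairs_orthonormal: "orthonormal_on (UNIV \<times> G) (\<lambda>(q, g). f q g)"
proof -
  have "cinner (f q g) (f q' g') = 0" if "g \<in> G" "g' \<in> G" "q \<noteq> q'" for q g q' g'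
  proof (rule cinner_disjoint_supports)
    fix n
    have "n \<notin> bl q \<or> n \<notin> bl q'" using bl_disjoint[OF that(3)] by blast
    then show "cinner (e n) (f q g) = 0 \<or> cinner (e n) (f q' g') = 0" using f_support that by blast
  qed
  then have "cinner (f q g) (f q' g') = (if (q, g) = (q', g') then 1 else 0)"
    if "g \<in> G" "g' \<in> G" for q g q' g'
    using orthonormal_onD[OF f_orthonormal that] that by (cases "q = q'") auto
  then show ?thesis by (auto simp: orthonormal_on_def)
qed

text \<open>Each pair of a cell and a block eigenvector contributes one trial vector. The threshold
  \<open>m q\<close> lies below the block eigenvalue after the decoupling loss, and above
  \<open>s\<close> divided by the squared weight on the block.\<close>

lemma singular_value_ge_count:
  assumes t: "0 \<le> t" "t < real (card I)" and I: "finite I" "I \<subseteq> UNIV \<times> G" and s: "0 \<le> s"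
    and m: "\<And>q g. (q, g) \<in> I \<Longrightarrow> m q \<le> r g - 2 * \<epsilon>"
    and weight: "\<And>q g n. (q, g) \<in> I \<Longrightarrow> n \<in> bl q \<Longrightarrow> s \<le> m q * (w n)\<^sup>2"
  shows "s \<le> singular_value_fn t T"
proof (cases "s = 0")
  case True
  then show ?thesis using T.singular_value_fn_nonneg[OF orthonormal_basis_exists] by simp
next
  case False
  then have s0: "0 < s" using s by simp
  define F where "F = (\<lambda>(q, g). f q g)"
  have onF: "orthonormal_on (UNIV \<times> G) F" unfolding F_def by (rule f_pairs_orthonormal)
  \<comment> \<open>The preimage of \<open>F i\<close> under \<open>D\<close>, a finite sum because
    blocks are finite.\<close>
  define x where "x i = (\<Sum>n\<in>bl (fst i). (of_real (1 / w n) * cinner (e n) (F i)) *\<^sub>C e n)" for i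
  have Dx: "D (x i) = F i" if "i \<in> I" for i
  proof (rule coeff_eqI)
    fix n
    have "snd i \<in> G" using that I(2) by auto
    then have "n \<notin> bl (fst i) \<Longrightarrow> cinner (e n) (F i) = 0" using f_support by (cases i) (simp add: F_def)
    then show "cinner (e n) (D (x i)) = cinner (e n) (F i)"
      using w_pos[of n] by (auto simp: D_coeff x_def coeff_sum bl_finite)
  qed
  show ?thesis
  \<comment> \<open>The form on the trial space is at least \<open>s\<close> only weakly, while
    \<open>singular_value_fn_ge\<close> asks for a strict inequality, hence the detour through
    \<open>s' < s\<close>.\<close>
  proof (rule dense_le_bounded[OF s0])
    fix s' assume s': "0 < s'" "s' < s"
    show "s' \<le> singular_value_fn t T"
    proof (rule T.singular_value_fn_ge[OF orthonormal_basis_exists _ t(1) I(1) t(2), where x = x])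
      show "0 \<le> s'" using s' by simp
      fix c v assume v: "v = (\<Sum>i\<in>I. c i *\<^sub>C x i)" and c: "\<exists>i\<in>I. c i \<noteq> 0"
      define Qs where "Qs = fst ` I"
      define Iq where "Iq q = {i \<in> I. fst i = q}" for q
      define vq where "vq q = (\<Sum>i\<in>Iq q. c i *\<^sub>C x i)" for q
      define uq where "uq q = (\<Sum>i\<in>Iq q. c i *\<^sub>C F i)" for q
      have fin: "finite Qs" "finite (Iq q)" for q using I(1) by (auto simp: Qs_def Iq_def)
      have group: "(\<Sum>q\<in>Qs. \<Sum>i\<in>Iq q. h i) = sum h I" for h :: "_ \<Rightarrow> 'z::comm_monoid_add"
        unfolding Iq_def by (rule sum.group[OF I(1) fin(1)]) (simp add: Qs_def)
      have vv: "v = (\<Sum>q\<in>Qs. vq q)" unfolding v vq_def by (rule group[symmetric])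
      have uv: "D (vq q) = uq q" for q
        unfolding vq_def uq_def bounded_clinear_sum[OF D_clinear]
        by (rule sum.cong) (auto simp: bounded_clinear_scaleC[OF D_clinear] Dx Iq_def)
      have Dv: "D v = (\<Sum>q\<in>Qs. uq q)" unfolding vv bounded_clinear_sum[OF D_clinear] by (simp add: uv)
      have v_supp: "cinner (e n) (vq q) = 0" if "n \<notin> bl q" for q n
        using that by (auto simp: vq_def x_def Iq_def cinner_sum_right cinner_scaleC_right coeff_basis
            intro!: sum.neutral)
      have u_supp: "cinner (e n) (uq q) = 0" if "n \<notin> bl q" for q n
        using v_supp[OF that] by (simp add: D_coeff flip: uv)
      have Isub: "Iq q \<subseteq> UNIV \<times> G" for q using I(2) by (auto simp: Iq_def)
      have u_norm: "(norm (uq q))\<^sup>2 = (\<Sum>i\<in>Iq q. (cmod (c i))\<^sup>2)" for q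
        unfolding uq_def by (rule norm_orthonormal_sum[OF onF fin(2) Isub])
      have u_form: "Re (cinner (uq q) (B (uq q))) = (\<Sum>i\<in>Iq q. r (snd i) * (cmod (c i))\<^sup>2)" for q
      proof -
        have "Re (cinner (uq q) (B (uq q))) = (\<Sum>g\<in>G. r g * (cmod (cinner (f q g) (uq q)))\<^sup>2)"
          using f_block[of q "uq q"] u_supp by blast
        also have "\<dots> = (\<Sum>g\<in>G. if (q, g) \<in> I then r g * (cmod (c (q, g)))\<^sup>2 else 0)"
        proof (rule sum.cong[OF refl])
          fix g assume "g \<in> G"
          then have "cinner (F (q, g)) (uq q) = (if (q, g) \<in> Iq q then c (q, g) else 0)"
            unfolding uq_def by (intro orthonormal_coeff[OF onF fin(2) Isub]) simp
          then show "r g * (cmod (cinner (f q g) (uq q)))\<^sup>2 = (if (q, g) \<in> I then r g * (cmod (c (q, g)))\<^sup>2 else 0)"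
            by (simp add: F_def Iq_def)
        qed
        also have "\<dots> = (\<Sum>g\<in>{g\<in>G. (q, g) \<in> I}. r g * (cmod (c (q, g)))\<^sup>2)"
          by (rule sum.inter_filter[OF G_finite, symmetric])
        also have "\<dots> = (\<Sum>i\<in>Pair q ` {g\<in>G. (q, g) \<in> I}. r (snd i) * (cmod (c i))\<^sup>2)"
          by (simp add: sum.reindex inj_on_def)
        also have "Pair q ` {g\<in>G. (q, g) \<in> I} = Iq q" using I(2) by (force simp: Iq_def)
        finally show ?thesis .
      qed
      have per_block: "s * (norm (vq q))\<^sup>2 \<le> (\<Sum>i\<in>Iq q. (r (snd i) - 2 * \<epsilon>) * (cmod (c i))\<^sup>2)"
        if q: "q \<in> Qs" for q
      proof -
        obtain g where g: "(q, g) \<in> I" using q by (auto simp: Qs_def)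
        have "s * (norm (vq q))\<^sup>2 \<le> m q * (norm (D (vq q)))\<^sup>2"
          by (rule D_norm_lower) (use v_supp weight[OF g] in blast)
        also have "\<dots> = (\<Sum>i\<in>Iq q. m q * (cmod (c i))\<^sup>2)"
          by (simp add: uv u_norm sum_distrib_left)
        also have "\<dots> \<le> (\<Sum>i\<in>Iq q. (r (snd i) - 2 * \<epsilon>) * (cmod (c i))\<^sup>2)"
          by (intro sum_mono mult_right_mono) (auto simp: Iq_def intro: m)
        finally show ?thesis .
      qed
      have "s * (norm v)\<^sup>2 = (\<Sum>q\<in>Qs. s * (norm (vq q))\<^sup>2)"
        unfolding vv sum_distrib_left[symmetric]
        by (subst norm_sum_disjoint_supports[OF fin(1), where S = bl]) (use v_supp bl_disjoint in auto)
      also have "\<dots> \<le> (\<Sum>q\<in>Qs. \<Sum>i\<in>Iq q. (r (snd i) - 2 * \<epsilon>) * (cmod (c i))\<^sup>2)"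
        by (intro sum_mono per_block)
      also have "\<dots> = (\<Sum>q\<in>Qs. Re (cinner (uq q) (B (uq q)))) - 2 * \<epsilon> * (\<Sum>q\<in>Qs. (norm (uq q))\<^sup>2)"
        unfolding u_form u_norm group by (simp add: left_diff_distrib sum_subtractf sum_distrib_left mult.assoc)
      also have "\<dots> \<le> Re (cinner (\<Sum>q\<in>Qs. uq q) (B (\<Sum>q\<in>Qs. uq q)))"
      proof -
        have "\<bar>Re (cinner (\<Sum>q\<in>Qs. uq q) (B (\<Sum>q\<in>Qs. uq q))) - (\<Sum>q\<in>Qs. Re (cinner (uq q) (B (uq q))))\<bar>
            \<le> 2 * \<epsilon> * (\<Sum>q\<in>Qs. (norm (uq q))\<^sup>2)"
          by (rule decoupling[OF B P close fin(1), where S = bl])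
             (use u_supp bl_disjoint separated cell in blast)+
        then show ?thesis by linarith
      qed
      also have "\<dots> = Re (cinner v (T v))" by (simp only: form_T Dv)
      finally have le: "s * (norm v)\<^sup>2 \<le> Re (cinner v (T v))" .
      \<comment> \<open>Because \<open>D v\<close> is a nontrivial combination of orthonormal
        vectors.\<close>
      have "v \<noteq> 0"
      proof
        assume "v = 0"
        then have "(\<Sum>q\<in>Qs. uq q) = 0" using Dv bounded_clinear_zero[OF D_clinear] by simp
        then have "(\<Sum>i\<in>I. c i *\<^sub>C F i) = 0" unfolding uq_def group .
        then have "(\<Sum>i\<in>I. (cmod (c i))\<^sup>2) = 0"
          using norm_orthonormal_sum[OF onF I] by (metis norm_zero power_zero_numeral)
        then show False using c I(1) by (simp add: sum_nonneg_eq_0_iff)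
      qed
      then have "s' * (norm v)\<^sup>2 < s * (norm v)\<^sup>2" using s'(2) by simp
      then show "s' * (norm v)\<^sup>2 < Re (cinner v (T v))" using le by linarith
    qed
  qed
qed

text \<open>Constraints are imposed for the pairs in \<open>I\<close>, whose eigenvalues are too
  large, and for the margin points in \<open>N\<close>. What remains splits into the blocks of the
  cells in \<open>C\<close>, where the surviving eigenvalues stay below \<open>m q\<close>, and the
  part in all other cells, where the norm bound \<open>M\<close> suffices.\<close>

lemma singular_value_le_count:
  assumes C: "finite C" and I: "finite I" and N: "finite N"
    and buffer: "\<And>n. cell n \<in> C \<Longrightarrow> n \<notin> bl (cell n) \<Longrightarrow> n \<in> N"
    and t: "real (card I) + real (card N) \<le> t" and s: "0 \<le> s"
    and m: "\<And>q g. q \<in> C \<Longrightarrow> g \<in> G \<Longrightarrow> (q, g) \<notin> I \<Longrightarrow> r g + 2 * \<epsilon> \<le> m q"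
    and weight: "\<And>q n. q \<in> C \<Longrightarrow> n \<in> bl q \<Longrightarrow> m q * (w n)\<^sup>2 \<le> s"
    and bound: "\<And>v. norm (B v) \<le> M * norm v"
    and tail: "\<And>n. cell n \<notin> C \<Longrightarrow> (M + 2 * \<epsilon>) * (w n)\<^sup>2 \<le> s"
  shows "singular_value_fn t T \<le> s"
proof -
  \<comment> \<open>By symmetry, orthogonality of \<open>v\<close> to \<open>D (f q g)\<close> is
    orthogonality of \<open>D v\<close> to \<open>f q g\<close>, which is what the form of
    \<open>B\<close> sees.\<close>
  define y where "y = case_sum (\<lambda>(q, g). D (f q g)) e"
  have card: "card (I <+> N) = card I + card N" by (rule card_Plus[OF I N])
  show ?thesis
  proof (rule T.singular_value_fn_le[OF orthonormal_basis_exists s, where K = "I <+> N" and y = y])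
    show "finite (I <+> N)" using I N by simp
    show "real (card (I <+> N)) \<le> t" using t by (simp add: card)
    fix v assume v: "\<And>k. k \<in> I <+> N \<Longrightarrow> cinner (y k) v = 0"
    have vI: "cinner (f q g) (D v) = 0" if "(q, g) \<in> I" for q g
      using v[of "Inl (q, g)"] that by (auto simp: y_def D_symmetric)
    have vN: "cinner (e n) v = 0" if "n \<in> N" for n
      using v[of "Inr n"] that by (auto simp: y_def)
    \<comment> \<open>\<open>None\<close> stands for the cells outside \<open>C\<close>,
      \<open>Some q\<close> for the block of \<open>q\<close>. The margins of cells in
      \<open>C\<close> carry no support, by the constraints in \<open>N\<close>.\<close>
    define S where "S = case_option {n. cell n \<notin> C} bl"
    define J where "J = insert None (Some ` C)"
    define V where "V = case_option (v - (\<Sum>q\<in>C. fproj (bl q) v)) (\<lambda>q. fproj (bl q) v)"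
    have J: "finite J" using C by (simp add: J_def)
    have sumJ: "(\<Sum>c\<in>J. h c) = h None + (\<Sum>q\<in>C. h (Some q))" for h :: "_ \<Rightarrow> 'z::comm_monoid_add"
      using C by (simp add: J_def sum.reindex)
    have vV: "(\<Sum>c\<in>J. V c) = v" unfolding sumJ by (simp add: V_def)
    have V_supp: "cinner (e n) (V c) = 0" if c: "c \<in> J" and n: "n \<notin> S c" for c n
    proof (cases c)
      case (Some q)
      then show ?thesis using n by (simp add: V_def S_def fproj_coeff bl_finite)
    next
      case None
      then have nC: "cell n \<in> C" using n by (simp add: S_def)
      have "(\<Sum>q\<in>C. cinner (e n) (fproj (bl q) v)) = (\<Sum>q\<in>C. if q = cell n then cinner (e n) (fproj (bl q) v) else 0)"
        by (rule sum.cong) (auto simp: fproj_coeff bl_finite dest: cell)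
      also have "\<dots> = cinner (e n) (fproj (bl (cell n)) v)" using C nC by (simp add: sum.delta')
      also have "\<dots> = cinner (e n) v"
        using vN buffer[OF nC] by (auto simp: fproj_coeff bl_finite)
      finally show ?thesis using None by (simp add: V_def cinner_diff_right cinner_sum_right)
    qed
    have S_disj: "S c \<inter> S d = {}" if "c \<in> J" "d \<in> J" "c \<noteq> d" for c d
      using that bl_disjoint cell by (auto simp: S_def J_def split: option.splits)
    have S_sep: "cinner (e k) (P (e n)) = 0" if cd: "c \<in> J" "d \<in> J" "c \<noteq> d" "k \<in> S c" "n \<in> S d" for c d k n
    proof (cases c)
      case None
      then obtain q where q: "d = Some q" "q \<in> C" using cd by (auto simp: J_def)
      then show ?thesis using cd None separated(2)[of n q k] by (auto simp: S_def)
    next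
      case (Some q)
      then have "cell n \<noteq> q" using cd cell by (auto simp: S_def J_def split: option.splits)
      then show ?thesis using cd Some separated(1)[of k q n] by (auto simp: S_def)
    qed
    define u where "u c = D (V c)" for c
    have u_supp: "cinner (e n) (u c) = 0" if "c \<in> J" "n \<notin> S c" for c n
      using V_supp[OF that] by (simp add: u_def D_coeff)
    have Dv: "D v = (\<Sum>c\<in>J. u c)"
      unfolding u_def bounded_clinear_sum[OF D_clinear, symmetric] vV ..
    have form: "Re (cinner (u c) (B (u c))) + 2 * \<epsilon> * (norm (u c))\<^sup>2 \<le> s * (norm (V c))\<^sup>2" if c: "c \<in> J" for c
    proof (cases c)
      case None
      have "Re (cinner (u c) (B (u c))) \<le> cmod (cinner (u c) (B (u c)))" by (rule complex_Re_le_cmod)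
      also have "\<dots> \<le> norm (u c) * norm (B (u c))" by (rule cinner_Cauchy_Schwarz)
      also have "\<dots> \<le> norm (u c) * (M * norm (u c))" by (intro mult_left_mono bound) simp
      finally have "Re (cinner (u c) (B (u c))) + 2 * \<epsilon> * (norm (u c))\<^sup>2 \<le> (M + 2 * \<epsilon>) * (norm (u c))\<^sup>2"
        by (simp add: power2_eq_square algebra_simps)
      also have "\<dots> \<le> s * (norm (V c))\<^sup>2"
        unfolding u_def
      proof (rule D_norm_upper)
        fix n assume "cinner (e n) (V c) \<noteq> 0"
        then have "n \<in> S c" using V_supp[OF c] by blast
        then show "(M + 2 * \<epsilon>) * (w n)\<^sup>2 \<le> s" using tail None by (simp add: S_def)
      qed
      finally show ?thesis .
    next
      case (Some q)
      then have q: "q \<in> C" using c by (auto simp: J_def)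
      have uS: "cinner (e n) (u c) = 0" if "n \<notin> bl q" for n
        using u_supp[OF c] that Some by (simp add: S_def)
      have block: "(norm (u c))\<^sup>2 = (\<Sum>g\<in>G. (cmod (cinner (f q g) (u c)))\<^sup>2)"
        "Re (cinner (u c) (B (u c))) = (\<Sum>g\<in>G. r g * (cmod (cinner (f q g) (u c)))\<^sup>2)"
        using f_block[of q "u c"] uS by blast+
      have killed: "cinner (f q g) (u c) = 0" if g: "g \<in> G" "(q, g) \<in> I" for g
      proof -
        \<comment> \<open>\<open>D v\<close> and \<open>u c\<close> have the same coefficients on
          the block of \<open>q\<close>, which supports \<open>f q g\<close>.\<close>
        have "cinner (f q g) (D v - u c) = 0"
        proof (rule cinner_disjoint_supports)
          fix n
          show "cinner (e n) (f q g) = 0 \<or> cinner (e n) (D v - u c) = 0"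
          proof (cases "n \<in> bl q")
            case True
            then have "cinner (e n) (V c) = cinner (e n) v"
              using Some by (simp add: V_def fproj_coeff bl_finite)
            then show ?thesis by (simp add: u_def cinner_diff_right D_coeff)
          qed (use f_support[OF g(1)] in blast)
        qed
        then show ?thesis using vI[OF g(2)] by (simp add: cinner_diff_right)
      qed
      have "Re (cinner (u c) (B (u c))) + 2 * \<epsilon> * (norm (u c))\<^sup>2
          = (\<Sum>g\<in>G. (r g + 2 * \<epsilon>) * (cmod (cinner (f q g) (u c)))\<^sup>2)"
        unfolding block by (simp add: distrib_right sum.distrib sum_distrib_left)
      also have "\<dots> \<le> (\<Sum>g\<in>G. m q * (cmod (cinner (f q g) (u c)))\<^sup>2)"
      proof (rule sum_mono)
        fix g assume g: "g \<in> G"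
        show "(r g + 2 * \<epsilon>) * (cmod (cinner (f q g) (u c)))\<^sup>2 \<le> m q * (cmod (cinner (f q g) (u c)))\<^sup>2"
          using m[OF q g] killed[OF g] by (cases "(q, g) \<in> I") (auto intro: mult_right_mono)
      qed
      also have "\<dots> = m q * (norm (u c))\<^sup>2" unfolding block(1) by (simp add: sum_distrib_left)
      also have "\<dots> \<le> s * (norm (V c))\<^sup>2"
        unfolding u_def
      proof (rule D_norm_upper)
        fix n assume "cinner (e n) (V c) \<noteq> 0"
        then have "n \<in> bl q" using V_supp[OF c] Some by (auto simp: S_def)
        then show "m q * (w n)\<^sup>2 \<le> s" by (rule weight[OF q])
      qed
      finally show ?thesis .
    qed
    have dec: "\<bar>Re (cinner (\<Sum>c\<in>J. u c) (B (\<Sum>c\<in>J. u c))) - (\<Sum>c\<in>J. Re (cinner (u c) (B (u c))))\<bar>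
        \<le> 2 * \<epsilon> * (\<Sum>c\<in>J. (norm (u c))\<^sup>2)"
      by (rule decoupling[OF B P close J u_supp S_disj S_sep])
    have "Re (cinner v (T v)) = Re (cinner (\<Sum>c\<in>J. u c) (B (\<Sum>c\<in>J. u c)))" by (simp only: form_T Dv)
    also have "\<dots> \<le> (\<Sum>c\<in>J. Re (cinner (u c) (B (u c)))) + 2 * \<epsilon> * (\<Sum>c\<in>J. (norm (u c))\<^sup>2)"
      using dec by linarith
    also have "\<dots> = (\<Sum>c\<in>J. Re (cinner (u c) (B (u c))) + 2 * \<epsilon> * (norm (u c))\<^sup>2)"
      by (simp add: sum.distrib sum_distrib_left)
    also have "\<dots> \<le> (\<Sum>c\<in>J. s * (norm (V c))\<^sup>2)" by (intro sum_mono form)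
    also have "\<dots> = s * (norm v)\<^sup>2"
    proof -
      have "(norm (\<Sum>c\<in>J. V c))\<^sup>2 = (\<Sum>c\<in>J. (norm (V c))\<^sup>2)"
        by (rule norm_sum_disjoint_supports[OF J, of S]) (rule V_supp S_disj, assumption+)+
      then show ?thesis by (simp add: vV sum_distrib_left)
    qed
    finally show "Re (cinner v (T v)) \<le> s * (norm v)\<^sup>2" .
  qed
qed

end

section \<open>Eigenvalue asymptotics\<close>

text \<open>The hypotheses say that the counting function at \<open>s\<close> is close to
  \<open>c / s\<close>. Substituting \<open>s = a / t\<close> with \<open>a\<close> close to
  \<open>c\<close> inverts this relation.\<close>

lemma tendsto_from_counting:
  fixes \<mu> :: "real \<Rightarrow> real"
  assumes nonneg: "\<And>t. 0 \<le> \<mu> t" and c: "0 \<le> c"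
    and upper: "\<And>\<eta>. 0 < \<eta> \<Longrightarrow> \<forall>\<^sub>F s in at_right 0. \<forall>t. c + \<eta> \<le> s * t \<longrightarrow> \<mu> t \<le> s"
    and lower: "\<And>\<eta>. 0 < \<eta> \<Longrightarrow> \<forall>\<^sub>F s in at_right 0. \<forall>t\<ge>0. s * t < c - \<eta> \<longrightarrow> s \<le> \<mu> t"
  shows "((\<lambda>t. t * \<mu> t) \<longlongrightarrow> c) at_top"
proof (rule tendstoI)
  fix e :: real assume e: "0 < e"
  have lim: "filterlim (\<lambda>t. a / t) (at_right 0) at_top" if "0 < a" for a :: real
    unfolding filterlim_at
  proof
    show "\<forall>\<^sub>F t in at_top. a / t \<in> {0<..} \<and> a / t \<noteq> 0"
      using eventually_gt_at_top[of "0::real"] by eventually_elim (use that in auto)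
    show "((\<lambda>t. a / t) \<longlongrightarrow> 0) at_top"
      by (intro tendsto_divide_0[OF tendsto_const] filterlim_at_top_imp_at_infinity filterlim_ident)
  qed
  have up: "\<forall>\<^sub>F t in at_top. t * \<mu> t \<le> c + e / 2"
  proof -
    have pos: "0 < c + e / 2" using c e by simp
    have "\<forall>\<^sub>F t in at_top. \<forall>t'. c + e / 2 \<le> (c + e / 2) / t * t' \<longrightarrow> \<mu> t' \<le> (c + e / 2) / t"
      by (rule eventually_compose_filterlim[OF upper lim[OF pos]]) (use e in simp)
    with eventually_gt_at_top[of "0::real"] show ?thesis
    proof eventually_elim
      case (elim t)
      then have "\<mu> t \<le> (c + e / 2) / t" by simp
      then show ?case using elim(1) by (simp add: pos_le_divide_eq mult.commute)
    qed
  qed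
  have lo: "\<forall>\<^sub>F t in at_top. c - e / 2 \<le> t * \<mu> t"
  proof (cases "0 < c - e / 2")
    case True
    \<comment> \<open>The hypothesis \<open>lower\<close> is used with slack \<open>e / 3\<close>,
      so that its strict inequality holds at the point \<open>(c - e / 2) / t\<close>.\<close>
    have "\<forall>\<^sub>F t in at_top. \<forall>t'\<ge>0. (c - e / 2) / t * t' < c - e / 3 \<longrightarrow> (c - e / 2) / t \<le> \<mu> t'"
      by (rule eventually_compose_filterlim[OF lower lim[OF True]]) (use e in simp)
    with eventually_gt_at_top[of "0::real"] show ?thesis
    proof eventually_elim
      case (elim t)
      then have "(c - e / 2) / t \<le> \<mu> t" using e by simp
      then show ?case using elim(1) by (simp add: pos_divide_le_eq mult.commute)
    qed
  next
    case False
    show ?thesis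
      using eventually_gt_at_top[of "0::real"]
    proof eventually_elim
      case (elim t)
      then have "0 \<le> t * \<mu> t" using nonneg by simp
      then show ?case using False by linarith
    qed
  qed
  show "\<forall>\<^sub>F t in at_top. dist (t * \<mu> t) c < e"
    using up lo by eventually_elim (use e in \<open>auto simp: dist_real_def\<close>)
qed

section \<open>The weights of the Laplacian\<close>

definition laplace_weight :: "int^'d::finite \<Rightarrow> real" where
  "laplace_weight n = (1 + (norm (lattice_vec n))\<^sup>2) powr (- real CARD('d) / 4)"

lemma laplace_weight_square:
  "(laplace_weight (n :: int^'d::finite))\<^sup>2 = 1 / sqrt (1 + (norm (lattice_vec n))\<^sup>2) ^ CARD('d)"
proof -
  define x where "x = 1 + (norm (lattice_vec n))\<^sup>2"
  have x: "0 < x" by (simp add: x_def add_pos_nonneg)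
  have "sqrt x ^ CARD('d) = x powr (real CARD('d) / 2)"
    using x by (simp add: powr_half_sqrt[symmetric] powr_powr flip: powr_realpow)
  moreover have "(x powr (- real CARD('d) / 4))\<^sup>2 = x powr (- (real CARD('d) / 2))"
    by (simp add: power2_eq_square flip: powr_add)
  ultimately show ?thesis by (simp add: laplace_weight_def powr_minus_divide flip: x_def)
qed

lemma laplace_weight_pos: "0 < laplace_weight n"
proof -
  have "1 + (norm (lattice_vec n))\<^sup>2 \<noteq> 0" by (smt (verit) zero_le_power2)
  then show ?thesis by (simp add: laplace_weight_def)
qed

text \<open>From \<open>sqrt (1 + x\<^sup>2) \<le> 1 + x\<close> for nonnegative \<open>x\<close>.
  The added 1 reappears as the correction \<open>- 1 / l\<close> of the radius in
  \<open>singular_value_lower\<close>.\<close>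

lemma laplace_weight_lower:
  assumes "norm (lattice_vec n) \<le> y"
  shows "1 \<le> (1 + y) ^ CARD('d) * (laplace_weight (n :: int^'d::finite))\<^sup>2"
proof -
  let ?x = "sqrt (1 + (norm (lattice_vec n))\<^sup>2)"
  have y: "0 \<le> y" using assms norm_ge_zero order_trans by blast
  have "1 + (norm (lattice_vec n))\<^sup>2 \<le> (1 + norm (lattice_vec n))\<^sup>2" by (simp add: power2_sum)
  then have "?x \<le> 1 + norm (lattice_vec n)" by (simp add: real_le_lsqrt)
  also have "\<dots> \<le> 1 + y" using assms by simp
  finally have "?x ^ CARD('d) \<le> (1 + y) ^ CARD('d)" by (intro power_mono) auto
  moreover have "0 < ?x ^ CARD('d)" by (simp add: add_pos_nonneg)
  ultimately show ?thesis by (simp add: laplace_weight_square)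
qed

lemma laplace_weight_upper:
  assumes "0 \<le> y" "y \<le> norm (lattice_vec n)"
  shows "y ^ CARD('d) * (laplace_weight (n :: int^'d::finite))\<^sup>2 \<le> 1"
proof -
  let ?x = "sqrt (1 + (norm (lattice_vec n))\<^sup>2)"
  have "norm (lattice_vec n) \<le> ?x" by (simp add: real_le_rsqrt)
  then have "y ^ CARD('d) \<le> ?x ^ CARD('d)" using assms by (intro power_mono) auto
  moreover have "0 < ?x ^ CARD('d)" by (simp add: add_pos_nonneg)
  ultimately show ?thesis by (simp add: laplace_weight_square)
qed

lemma laplace_weight_le_one: "laplace_weight (n :: int^'d::finite) \<le> 1"
proof -
  have "1 + (norm (lattice_vec n))\<^sup>2 \<ge> 1" by simp
  then show ?thesis unfolding laplace_weight_def
    using powr_mono[of "- real CARD('d) / 4" 0 "1 + (norm (lattice_vec n))\<^sup>2"] by (simp split: if_splits)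
qed

lemma laplace_weight_null:
  assumes "0 < \<epsilon>" shows "finite {n :: int^'d::finite. \<epsilon> \<le> laplace_weight n}"
proof (rule finite_subset[OF _ finite_lattice_ball[of "max 1 (1 / \<epsilon>\<^sup>2)"]])
  show "{n :: int^'d. \<epsilon> \<le> laplace_weight n} \<subseteq> {n. norm (lattice_vec n) \<le> max 1 (1 / \<epsilon>\<^sup>2)}"
  proof (intro subsetI CollectI)
    fix n :: "int^'d" assume "n \<in> {n. \<epsilon> \<le> laplace_weight n}"
    then have "\<epsilon>\<^sup>2 \<le> (laplace_weight n)\<^sup>2" using assms by (intro power_mono) auto
    then have "norm (lattice_vec n) ^ CARD('d) * \<epsilon>\<^sup>2 \<le> norm (lattice_vec n) ^ CARD('d) * (laplace_weight n)\<^sup>2"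
      by (intro mult_left_mono) auto
    also have "\<dots> \<le> 1" by (intro laplace_weight_upper) auto
    finally have "norm (lattice_vec n) ^ CARD('d) \<le> 1 / \<epsilon>\<^sup>2" using assms by (simp add: pos_le_divide_eq)
    moreover have "norm (lattice_vec n) \<le> norm (lattice_vec n) ^ CARD('d)" if "1 \<le> norm (lattice_vec n)"
      using that power_increasing[of 1 "CARD('d)" "norm (lattice_vec n)"] by (simp add: Suc_leI)
    ultimately show "norm (lattice_vec n) \<le> max 1 (1 / \<epsilon>\<^sup>2)" by linarith
  qed
qed

text \<open>The lattice is cut into cells of side length \<open>L\<close>; the block of a cell consists of its
  points at distance at least \<open>K\<close> from the other cells.\<close>

definition lattice_cell :: "int \<Rightarrow> int^'d \<Rightarrow> int^'d::finite" where
  "lattice_cell L n = (\<chi> j. n $ j div L)"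

definition cell_corner :: "int \<Rightarrow> int^'d \<Rightarrow> int^'d::finite" where
  "cell_corner L q = (\<chi> j. L * q $ j)"

definition int_box :: "int \<Rightarrow> int \<Rightarrow> (int^'d::finite) set" where
  "int_box a b = {n. \<forall>j. a \<le> n $ j \<and> n $ j < b}"

definition cell_block :: "int \<Rightarrow> int \<Rightarrow> int^'d \<Rightarrow> (int^'d::finite) set" where
  "cell_block K L q = (\<lambda>n. n + cell_corner L q) ` int_box K (L - K)"

lemma card_int_box: "finite (int_box a b :: (int^'d::finite) set)"
  "card (int_box a b :: (int^'d::finite) set) = nat (b - a) ^ CARD('d)"
proof -
  have "bij_betw vec_lambda (UNIV \<rightarrow>\<^sub>E {a..<b}) (int_box a b :: (int^'d) set)"
    by (rule bij_betw_byWitness[where f' = vec_nth]) (auto simp: int_box_def vec_lambda_inverse)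
  moreover have "finite ((UNIV :: 'd set) \<rightarrow>\<^sub>E {a..<b})" by (intro finite_PiE) auto
  moreover have "card ((UNIV :: 'd set) \<rightarrow>\<^sub>E {a..<b}) = nat (b - a) ^ CARD('d)"
    by (simp add: card_PiE)
  ultimately show "finite (int_box a b :: (int^'d) set)"
    "card (int_box a b :: (int^'d) set) = nat (b - a) ^ CARD('d)"
    using bij_betw_finite bij_betw_same_card by metis+
qed

lemma in_cell_block: "n \<in> cell_block K L q \<longleftrightarrow> (\<forall>j. K \<le> n $ j - L * q $ j \<and> n $ j - L * q $ j < L - K)"
proof -
  have "n \<in> cell_block K L q \<longleftrightarrow> n - cell_corner L q \<in> int_box K (L - K)"
    unfolding cell_block_def by (auto intro: image_eqI[of _ _ "n - cell_corner L q"])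
  then show ?thesis by (simp add: int_box_def cell_corner_def)
qed

lemma lattice_cell_eq:
  assumes "0 < L"
  shows "lattice_cell L n = q \<longleftrightarrow> (\<forall>j. 0 \<le> n $ j - L * q $ j \<and> n $ j - L * q $ j < L)"
proof -
  have "n $ j div L = q $ j \<longleftrightarrow> 0 \<le> n $ j - L * q $ j \<and> n $ j - L * q $ j < L" for j
  proof
    assume "n $ j div L = q $ j"
    then have "n $ j - L * q $ j = n $ j mod L" by (simp add: minus_mult_div_eq_mod flip: \<open>n $ j div L = q $ j\<close>)
    then show "0 \<le> n $ j - L * q $ j \<and> n $ j - L * q $ j < L" using assms by simp
  next
    assume "0 \<le> n $ j - L * q $ j \<and> n $ j - L * q $ j < L"
    then show "n $ j div L = q $ j"
      by (intro int_div_pos_eq[of _ _ _ "n $ j - L * q $ j"]) auto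
  qed
  then show ?thesis by (simp add: lattice_cell_def vec_eq_iff)
qed

lemma cell_block_cell:
  assumes "0 \<le> K" "0 < L" "n \<in> cell_block K L q" shows "lattice_cell L n = q"
  unfolding lattice_cell_eq[OF assms(2)]
proof
  fix j show "0 \<le> n $ j - L * q $ j \<and> n $ j - L * q $ j < L"
    using assms(1) spec[OF assms(3)[unfolded in_cell_block], of j] by linarith
qed

lemma cell_block_separated:
  assumes "0 < L" "n \<in> cell_block K L q" "lattice_cell L m \<noteq> q"
  shows "\<exists>j. K \<le> \<bar>n $ j - m $ j\<bar>"
proof -
  obtain j where j: "\<not> (0 \<le> m $ j - L * q $ j \<and> m $ j - L * q $ j < L)"
    using assms(3) by (auto simp: lattice_cell_eq[OF assms(1)])
  have "K \<le> n $ j - L * q $ j \<and> n $ j - L * q $ j < L - K" using assms(2) by (simp add: in_cell_block)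
  then have "K \<le> \<bar>n $ j - m $ j\<bar>" using j by linarith
  then show ?thesis by blast
qed

lemma cell_buffer:
  assumes "finite C" "0 \<le> K" "0 < L"
  shows "finite {n :: int^'d::finite. lattice_cell L n \<in> C \<and> n \<notin> cell_block K L (lattice_cell L n)}"
    "card {n :: int^'d::finite. lattice_cell L n \<in> C \<and> n \<notin> cell_block K L (lattice_cell L n)}
      \<le> card C * (nat L ^ CARD('d) - nat (L - 2 * K) ^ CARD('d))"
proof -
  define N where "N q = (\<lambda>n. n + cell_corner L q) ` (int_box 0 L - int_box K (L - K))" for q :: "int^'d"
  have sub: "{n. lattice_cell L n \<in> C \<and> n \<notin> cell_block K L (lattice_cell L n)} \<subseteq> (\<Union>q\<in>C. N q)"
  proof
    fix n assume n: "n \<in> {n. lattice_cell L n \<in> C \<and> n \<notin> cell_block K L (lattice_cell L n)}"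
    define q where "q = lattice_cell L n"
    have "n - cell_corner L q \<in> int_box 0 L - int_box K (L - K)"
      using n lattice_cell_eq[OF assms(3), of n q]
      by (auto simp: q_def[symmetric] int_box_def cell_corner_def in_cell_block)
    then have "n \<in> N q" unfolding N_def by (auto intro: image_eqI[of _ _ "n - cell_corner L q"])
    then show "n \<in> (\<Union>q\<in>C. N q)" using n by (auto simp: q_def)
  qed
  have fin: "finite (N q)" for q by (simp add: N_def card_int_box)
  have cardN: "card (N q) \<le> nat L ^ CARD('d) - nat (L - 2 * K) ^ CARD('d)" for q
  proof -
    have "card (N q) \<le> card (int_box 0 L - int_box K (L - K) :: (int^'d) set)"
      unfolding N_def by (rule card_image_le) (simp add: card_int_box)
    also have "\<dots> = card (int_box 0 L :: (int^'d) set) - card (int_box K (L - K) :: (int^'d) set)"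
    proof (rule card_Diff_subset)
      show "int_box K (L - K) \<subseteq> (int_box 0 L :: (int^'d) set)"
      proof
        fix n :: "int^'d" assume "n \<in> int_box K (L - K)"
        then have "K \<le> n $ j \<and> n $ j < L - K" for j by (simp add: int_box_def)
        then have "0 \<le> n $ j \<and> n $ j < L" for j using assms(2) by (smt (verit))
        then show "n \<in> int_box 0 L" by (simp add: int_box_def)
      qed
    qed (rule card_int_box)
    finally show ?thesis by (simp add: card_int_box algebra_simps)
  qed
  show "finite {n. lattice_cell L n \<in> C \<and> n \<notin> cell_block K L (lattice_cell L n)}"
    by (rule finite_subset[OF sub]) (use assms(1) fin in simp)
  have "card {n. lattice_cell L n \<in> C \<and> n \<notin> cell_block K L (lattice_cell L n)} \<le> card (\<Union>q\<in>C. N q)"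
    by (rule card_mono[OF _ sub]) (use assms(1) fin in simp)
  also have "\<dots> \<le> (\<Sum>q\<in>C. card (N q))" by (rule card_UN_le[OF assms(1)])
  also have "\<dots> \<le> (\<Sum>q\<in>C. nat L ^ CARD('d) - nat (L - 2 * K) ^ CARD('d))" by (intro sum_mono cardN)
  finally show "card {n. lattice_cell L n \<in> C \<and> n \<notin> cell_block K L (lattice_cell L n)}
      \<le> card C * (nat L ^ CARD('d) - nat (L - 2 * K) ^ CARD('d))" by simp
qed

text \<open>The l1 norm bounds the offset of a point inside its cell. In units of cells this is the
  shift by \<open>CARD('d)\<close> in the radii of the two counting bounds.\<close>

lemma norm_lattice_cell:
  fixes n :: "int^'d::finite"
  assumes "0 < L"
  shows "\<bar>norm (lattice_vec n) - real_of_int L * norm (lattice_vec (lattice_cell L n))\<bar>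
    \<le> real_of_int L * real CARD('d)"
proof -
  let ?q = "lattice_cell L n"
  let ?z = "lattice_vec n - real_of_int L *\<^sub>R lattice_vec ?q"
  have "\<bar>?z $ j\<bar> \<le> real_of_int L" for j
  proof -
    have "0 \<le> n $ j - L * ?q $ j \<and> n $ j - L * ?q $ j < L" using lattice_cell_eq[OF assms, of n ?q] by simp
    then have "\<bar>real_of_int (n $ j - L * ?q $ j)\<bar> \<le> real_of_int L" by linarith
    then show ?thesis by simp
  qed
  then have "(\<Sum>j\<in>UNIV. \<bar>?z $ j\<bar>) \<le> (\<Sum>j\<in>(UNIV :: 'd set). real_of_int L)" by (intro sum_mono)
  then have "norm ?z \<le> real CARD('d) * real_of_int L" using norm_le_l1_cart[of ?z] by simp
  moreover have "\<bar>norm (lattice_vec n) - norm (real_of_int L *\<^sub>R lattice_vec ?q)\<bar> \<le> norm ?z"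
    by (rule norm_triangle_ineq3)
  ultimately show ?thesis using assms by (simp add: mult.commute)
qed

text \<open>The interface between the algebra and the counting: \<open>B\<close> will be left
  multiplication by \<open>b\<close>, \<open>M\<close> the norm of \<open>b\<close> and
  \<open>\<beta>\<close> its trace.\<close>

locale translation_covariant = hilbert_basis e
  for e :: "int^'d::finite \<Rightarrow> 'h::chilbert_space" +
  fixes B :: "'h \<Rightarrow> 'h" and M \<beta> :: real
  assumes B: "bounded_clinear B" and B_pos: "\<And>v. cinner v (B v) \<in> \<real>\<^sub>\<ge>\<^sub>0"
    and B_bound: "\<And>v. norm (B v) \<le> M * norm v" and M: "0 \<le> M"
    and diagonal: "\<And>n. Re (cinner (e n) (B (e n))) = \<beta>"
    and translate: "\<And>k. \<exists>\<alpha>. (\<forall>n. cmod (\<alpha> n) = 1) \<and>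
      (\<forall>m n. cinner (e (m + k)) (B (e (n + k))) = cnj (\<alpha> m) * \<alpha> n * cinner (e m) (B (e n)))"
    and banded_approx: "\<And>\<epsilon>. 0 < \<epsilon> \<Longrightarrow> \<exists>P K. bounded_clinear P \<and> (\<forall>v. norm (B v - P v) \<le> \<epsilon> * norm v) \<and>
      (\<forall>m n. (\<exists>j. K < \<bar>m $ j - n $ j\<bar>) \<longrightarrow> cinner (e m) (P (e n)) = 0)"
begin

sublocale weighted_basis e laplace_weight
  by unfold_locales (rule laplace_weight_pos laplace_weight_le_one laplace_weight_null; assumption?)+

lemma trace_nonneg: "0 \<le> \<beta>"
  using B_pos[of "e 0"] diagonal[of 0] by (simp add: complex_nonneg_Reals_iff)

text \<open>The order of choices matters: \<open>\<epsilon>\<close> determines the banded operator,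
  its band width determines \<open>K\<close>, and only then is \<open>L\<close> taken so large that
  the margins occupy at most the proportion \<open>\<delta>\<close>.\<close>

lemma block_decomposition_exists:
  assumes "0 < \<epsilon>" "0 < \<delta>"
  obtains P K L and G :: "'h set" and r f where
    "block_decomposition e laplace_weight B P \<epsilon> (lattice_cell L) (cell_block K L) G r f"
    "0 \<le> K" "0 < L" "2 * K < L" "1 - (real_of_int (L - 2 * K) / real_of_int L) ^ CARD('d) \<le> \<delta>"
    "card G = nat (L - 2 * K) ^ CARD('d)" "sum r G = real (card G) * \<beta>" "\<And>g. g \<in> G \<Longrightarrow> 0 \<le> r g"
proof -
  obtain P K0 where P: "bounded_clinear P" "\<And>v. norm (B v - P v) \<le> \<epsilon> * norm v"
    "\<And>m n. \<exists>j. K0 < \<bar>m $ j - n $ j\<bar> \<Longrightarrow> cinner (e m) (P (e n)) = 0"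
    using banded_approx[OF assms(1)] by blast
  \<comment> \<open>A block point and a point of another cell differ by at least \<open>K\<close> in
    some coordinate, whereas the entries of \<open>P\<close> vanish for differences above
    \<open>K0\<close>. The absolute value covers a negative \<open>K0\<close>.\<close>
  define K where "K = \<bar>K0\<bar> + 1"
  have K: "0 \<le> K" "K0 < K" by (auto simp: K_def)
  have "(\<lambda>l. 1 - (1 - real_of_int (2 * K) * inverse (real (Suc l))) ^ CARD('d)) \<longlonglongrightarrow>
      1 - (1 - real_of_int (2 * K) * 0) ^ CARD('d)"
    by (intro tendsto_intros LIMSEQ_inverse_real_of_nat)
  then have "\<forall>\<^sub>F l in sequentially. 1 - (1 - real_of_int (2 * K) * inverse (real (Suc l))) ^ CARD('d) < \<delta>"
    using assms(2) by (intro order_tendstoD) auto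
  then have "\<forall>\<^sub>F l in sequentially. 1 - (1 - real_of_int (2 * K) * inverse (real (Suc l))) ^ CARD('d) < \<delta>
      \<and> nat (2 * K) \<le> l"
    using eventually_ge_at_top by (rule eventually_conj)
  then obtain l where l: "1 - (1 - real_of_int (2 * K) * inverse (real (Suc l))) ^ CARD('d) < \<delta>"
    "nat (2 * K) \<le> l" using eventually_happens'[OF sequentially_bot] by blast
  define L where "L = int (Suc l)"
  have L: "0 < L" "2 * K < L" using l(2) by (auto simp: L_def)
  have "1 - real_of_int (2 * K) * inverse (real (Suc l)) = real_of_int (L - 2 * K) / real_of_int L"
    using L(1) by (simp add: L_def field_simps)
  then have \<theta>: "1 - (real_of_int (L - 2 * K) / real_of_int L) ^ CARD('d) \<le> \<delta>" using l(1) by simp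
  define Q where "Q = (int_box K (L - K) :: (int^'d) set)"
  have Q: "finite Q" by (simp add: Q_def card_int_box)
  obtain G r where G: "finite G" "card G = card Q" "orthonormal_on G (\<lambda>g. g)"
    "\<And>g. g \<in> G \<Longrightarrow> 0 \<le> r g" "\<And>g n. g \<in> G \<Longrightarrow> n \<notin> Q \<Longrightarrow> cinner (e n) g = 0"
    "sum r G = real (card Q) * \<beta>"
    "\<And>u. (\<And>n. n \<notin> Q \<Longrightarrow> cinner (e n) u = 0) \<Longrightarrow>
      (norm u)\<^sup>2 = (\<Sum>g\<in>G. (cmod (cinner g u))\<^sup>2) \<and>
      Re (cinner u (B u)) = (\<Sum>g\<in>G. r g * (cmod (cinner g u))\<^sup>2)"
    by (rule block_spectrum[OF B B_pos Q diagonal]) blast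
  \<comment> \<open>Stated for a single cell, so that the families for all cells are obtained by one
    application of choice.\<close>
  define block_basis where "block_basis q f \<longleftrightarrow> orthonormal_on G f \<and>
     (\<forall>g n. g \<in> G \<longrightarrow> n \<notin> cell_block K L q \<longrightarrow> cinner (e n) (f g) = 0) \<and>
     (\<forall>u. (\<forall>n. n \<notin> cell_block K L q \<longrightarrow> cinner (e n) u = 0) \<longrightarrow>
      (norm u)\<^sup>2 = (\<Sum>g\<in>G. (cmod (cinner (f g) u))\<^sup>2) \<and>
      Re (cinner u (B u)) = (\<Sum>g\<in>G. r g * (cmod (cinner (f g) u))\<^sup>2))" for q f
  have "\<exists>f. block_basis q f" for q
  proof -
    obtain \<alpha> where \<alpha>: "\<And>n. cmod (\<alpha> n) = 1" "\<And>m n. cinner (e (m + cell_corner L q)) (B (e (n + cell_corner L q)))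
        = cnj (\<alpha> m) * \<alpha> n * cinner (e m) (B (e n))" using translate by blast
    obtain f where "orthonormal_on G f"
      "\<And>g n. g \<in> G \<Longrightarrow> n \<notin> (\<lambda>n. n + cell_corner L q) ` Q \<Longrightarrow> cinner (e n) (f g) = 0"
      "\<And>u. (\<And>n. n \<notin> (\<lambda>n. n + cell_corner L q) ` Q \<Longrightarrow> cinner (e n) u = 0) \<Longrightarrow>
      (norm u)\<^sup>2 = (\<Sum>g\<in>G. (cmod (cinner (f g) u))\<^sup>2) \<and>
      Re (cinner u (B u)) = (\<Sum>g\<in>G. r g * (cmod (cinner (f g) u))\<^sup>2)"
      by (rule block_translate[OF B Q _ G(1,3,5,7) \<alpha>]) (auto simp: inj_on_def)
    then show ?thesis unfolding block_basis_def cell_block_def Q_def[symmetric] by blast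
  qed
  then obtain f where "\<And>q. block_basis q (f q)" by metis
  then have f: "\<And>q. orthonormal_on G (f q)"
    "\<And>q g n. g \<in> G \<Longrightarrow> n \<notin> cell_block K L q \<Longrightarrow> cinner (e n) (f q g) = 0"
    "\<And>q u. (\<And>n. n \<notin> cell_block K L q \<Longrightarrow> cinner (e n) u = 0) \<Longrightarrow>
      (norm u)\<^sup>2 = (\<Sum>g\<in>G. (cmod (cinner (f q g) u))\<^sup>2) \<and>
      Re (cinner u (B u)) = (\<Sum>g\<in>G. r g * (cmod (cinner (f q g) u))\<^sup>2)"
    unfolding block_basis_def by blast+
  have sep: "\<exists>j. K0 < \<bar>n $ j - m $ j\<bar>" if n: "n \<in> cell_block K L q" and m: "lattice_cell L m \<noteq> q" for n m q
    using cell_block_separated[OF L(1) n m] K(2) by (meson less_le_trans)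
  have "block_decomposition e laplace_weight B P \<epsilon> (lattice_cell L) (cell_block K L) G r f"
  proof unfold_locales
    show "cinner (e n) (P (e m)) = 0" if "n \<in> cell_block K L q" "lattice_cell L m \<noteq> q" for n m q
      by (rule P(3)[OF sep[OF that]])
    show "cinner (e m) (P (e n)) = 0" if "n \<in> cell_block K L q" "lattice_cell L m \<noteq> q" for n m q
      using sep[OF that] by (intro P(3)) (simp add: abs_minus_commute)
    show "finite (cell_block K L q)" for q by (simp add: cell_block_def card_int_box)
    show "(norm u)\<^sup>2 = (\<Sum>g\<in>G. (cmod (cinner (f q g) u))\<^sup>2) \<and>
      Re (cinner u (B u)) = (\<Sum>g\<in>G. r g * (cmod (cinner (f q g) u))\<^sup>2)"
      if "\<And>n. n \<notin> cell_block K L q \<Longrightarrow> cinner (e n) u = 0" for q u by (rule f(3)[OF that])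
  qed (use B B_pos P(1,2) f(1,2) G(1) cell_block_cell[OF K(1) L(1)] in auto)
  moreover have "card Q = nat (L - 2 * K) ^ CARD('d)" by (simp add: Q_def card_int_box algebra_simps)
  ultimately show ?thesis using that[of P L K G r f] K(1) L \<theta> G by simp
qed

abbreviation T :: "'h \<Rightarrow> 'h" where "T \<equiv> D \<circ> B \<circ> D"

text \<open>\<open>\<Phi> s\<close> is \<open>s\<close> times a bound for the number of constraints
  in \<open>singular_value_le_count\<close>; once it is below the target, every \<open>t\<close> in
  question allows that many constraints. Its limit is the main term plus the decoupling loss plus
  the cost of the margins.\<close>

lemma singular_value_upper:
  assumes \<eta>: "0 < \<eta>"
  shows "\<forall>\<^sub>F s in at_right 0. \<forall>t. unit_ball_vol (real CARD('d)) * \<beta> + \<eta> \<le> s * t \<longrightarrow> singular_value_fn t T \<le> s"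
proof -
  let ?n = "CARD('d)" and ?\<omega> = "unit_ball_vol (real CARD('d))"
  have \<omega>: "0 \<le> ?\<omega>" by simp
  \<comment> \<open>The 8 is the 2 of the decoupling loss times 4, for a quarter of
    \<open>\<eta>\<close>; the added 1 keeps the denominator positive.\<close>
  define \<epsilon> where "\<epsilon> = \<eta> / (8 * (?\<omega> + 1))"
  have \<epsilon>: "0 < \<epsilon>" "2 * \<epsilon> * ?\<omega> \<le> \<eta> / 4"
    using \<eta> \<omega> by (auto simp: \<epsilon>_def field_simps add_nonneg_pos)
  have M\<epsilon>: "0 < M + 2 * \<epsilon>" using M \<epsilon>(1) by simp
  \<comment> \<open>Margin points are counted in all cells of the ball that belongs to
    \<open>M + 2 * \<epsilon>\<close>, hence this factor.\<close>
  define \<delta> where "\<delta> = \<eta> / (4 * (?\<omega> * (M + 2 * \<epsilon>) + 1))"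
  have den: "0 < ?\<omega> * (M + 2 * \<epsilon>) + 1" using \<omega> M\<epsilon> by (simp add: add_nonneg_pos)
  have \<delta>: "0 < \<delta>" "?\<omega> * (M + 2 * \<epsilon>) * \<delta> \<le> \<eta> / 4"
    using \<eta> den by (auto simp: \<delta>_def field_simps)
  obtain P K L and G :: "'h set" and r f where
    dec: "block_decomposition e laplace_weight B P \<epsilon> (lattice_cell L) (cell_block K L) G r f"
    and KL: "0 \<le> K" "0 < L" "2 * K < L" "1 - (real_of_int (L - 2 * K) / real_of_int L) ^ ?n \<le> \<delta>"
    and G: "card G = nat (L - 2 * K) ^ ?n" "sum r G = real (card G) * \<beta>" "\<And>g. g \<in> G \<Longrightarrow> 0 \<le> r g"
    by (rule block_decomposition_exists[OF \<epsilon>(1) \<delta>(1)]) blast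
  interpret dec: block_decomposition e laplace_weight B P \<epsilon> "lattice_cell L" "cell_block K L" G r f
    by (rule dec)
  define l where "l = real_of_int L"
  have l: "0 < l" using KL(2) by (simp add: l_def)
  define \<theta> where "\<theta> = (real_of_int (L - 2 * K) / l) ^ ?n"
  have \<theta>: "1 - \<theta> \<le> \<delta>" "\<theta> \<le> 1" using KL(1,3,4) l
    by (auto simp: \<theta>_def l_def intro!: power_le_one)
  have cardG: "real (card G) = \<theta> * l ^ ?n"
    using KL(3) l by (simp add: G(1) \<theta>_def power_divide)
  \<comment> \<open>Beyond this radius, in units of cells,
    \<open>(l * (norm (lattice_vec q) - real ?n)) ^ ?n\<close> exceeds \<open>a / s\<close>; the
    added \<open>real ?n\<close> allows for the position of a point inside its cell.\<close>
  define \<rho> where "\<rho> a s = (a / s) powr (1 / real ?n) / l + real ?n" for a s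
  define \<Phi> where "\<Phi> s = (\<Sum>g\<in>G. s * real (lattice_count TYPE('d) (\<rho> (r g + 2 * \<epsilon>) s)))
    + s * real (lattice_count TYPE('d) (\<rho> (M + 2 * \<epsilon>) s)) * (l ^ ?n * (1 - \<theta>))" for s
  have "(\<Phi> \<longlongrightarrow> (\<Sum>g\<in>G. ?\<omega> * (r g + 2 * \<epsilon>) / l ^ ?n) + ?\<omega> * (M + 2 * \<epsilon>) / l ^ ?n * (l ^ ?n * (1 - \<theta>))) (at_right 0)"
    unfolding \<Phi>_def \<rho>_def
    using G(3) \<epsilon>(1) M\<epsilon> l
    by (intro tendsto_add tendsto_sum tendsto_mult tendsto_const lattice_count_tendsto) (auto intro: add_nonneg_pos)
  moreover have "(\<Sum>g\<in>G. ?\<omega> * (r g + 2 * \<epsilon>) / l ^ ?n) + ?\<omega> * (M + 2 * \<epsilon>) / l ^ ?n * (l ^ ?n * (1 - \<theta>))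
      < ?\<omega> * \<beta> + \<eta>"
  proof -
    have "(\<Sum>g\<in>G. ?\<omega> * (r g + 2 * \<epsilon>) / l ^ ?n) = ?\<omega> * (sum r G + real (card G) * (2 * \<epsilon>)) / l ^ ?n"
      by (simp add: sum.distrib flip: sum_distrib_left sum_divide_distrib)
    also have "\<dots> = \<theta> * (?\<omega> * (\<beta> + 2 * \<epsilon>))"
      using l by (simp add: G(2) cardG field_simps)
    also have "\<dots> \<le> 1 * (?\<omega> * (\<beta> + 2 * \<epsilon>))"
      using \<theta>(2) \<omega> trace_nonneg \<epsilon>(1) by (intro mult_right_mono) auto
    also have "\<dots> \<le> ?\<omega> * \<beta> + \<eta> / 4" using \<epsilon>(2) by (simp add: algebra_simps)
    finally have 1: "(\<Sum>g\<in>G. ?\<omega> * (r g + 2 * \<epsilon>) / l ^ ?n) \<le> ?\<omega> * \<beta> + \<eta> / 4" .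
    have "?\<omega> * (M + 2 * \<epsilon>) / l ^ ?n * (l ^ ?n * (1 - \<theta>)) = ?\<omega> * (M + 2 * \<epsilon>) * (1 - \<theta>)"
      using l by simp
    also have "\<dots> \<le> ?\<omega> * (M + 2 * \<epsilon>) * \<delta>" using \<theta>(1) \<omega> M\<epsilon> by (intro mult_left_mono) auto
    finally show ?thesis using 1 \<delta>(2) \<eta> by linarith
  qed
  ultimately have "\<forall>\<^sub>F s in at_right 0. \<Phi> s < ?\<omega> * \<beta> + \<eta>" by (rule order_tendstoD(2))
  with eventually_at_right_less[of "0::real"] show ?thesis
  proof eventually_elim
    case (elim s)
    then have s: "0 < s" and \<Phi>s: "\<Phi> s < ?\<omega> * \<beta> + \<eta>" by auto
    show ?case
    proof (intro allI impI)
      fix t assume t: "?\<omega> * \<beta> + \<eta> \<le> s * t"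
      \<comment> \<open>Outside \<open>C\<close> the weights are so small that the norm bound
        \<open>M\<close> alone keeps the form below \<open>s\<close>.\<close>
      define C where "C = {q :: int^'d. norm (lattice_vec q) \<le> \<rho> (M + 2 * \<epsilon>) s}"
      define I where "I = (\<Union>g\<in>G. (\<lambda>q. (q :: int^'d, g)) ` {q. norm (lattice_vec q) \<le> \<rho> (r g + 2 * \<epsilon>) s})"
      define N where "N = {n :: int^'d. lattice_cell L n \<in> C \<and> n \<notin> cell_block K L (lattice_cell L n)}"
      \<comment> \<open>The cut at 0 matters near the origin: a negative base with an even exponent
        could violate \<open>m q * (laplace_weight n)\<^sup>2 \<le> s\<close>.\<close>
      define m where "m q = s * (max 0 (l * (norm (lattice_vec q) - real ?n))) ^ ?n" for q :: "int^'d"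
      have root: "((a / s) powr (1 / real ?n)) ^ ?n = a / s" if "0 < a" for a
        using that s by (simp add: powr_powr flip: powr_realpow)
      have far: "a \<le> s * (l * (norm (lattice_vec q) - real ?n)) ^ ?n \<and> 0 < l * (norm (lattice_vec q) - real ?n)"
        if a: "0 < a" and q: "\<not> norm (lattice_vec q) \<le> \<rho> a s" for a and q :: "int^'d"
      proof -
        have "(a / s) powr (1 / real ?n) < l * (norm (lattice_vec q) - real ?n)"
          using q l by (simp add: \<rho>_def field_simps)
        then have le: "(a / s) powr (1 / real ?n) \<le> l * (norm (lattice_vec q) - real ?n)"
          and pos: "0 < l * (norm (lattice_vec q) - real ?n)"
          using powr_ge_zero[of "a / s" "1 / real ?n"] by linarith+
        have "a = s * ((a / s) powr (1 / real ?n)) ^ ?n" using root[OF a] s by simp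
        also have "\<dots> \<le> s * (l * (norm (lattice_vec q) - real ?n)) ^ ?n"
          using le s by (intro mult_left_mono power_mono) auto
        finally show ?thesis using pos by blast
      qed
      have cell_norm: "l * (norm (lattice_vec (lattice_cell L n)) - real ?n) \<le> norm (lattice_vec n)" for n :: "int^'d"
        using norm_lattice_cell[OF KL(2), of n] by (simp add: l_def algebra_simps abs_le_iff)
      have C: "finite C" unfolding C_def by (rule finite_lattice_ball)
      have I: "finite I" unfolding I_def by (intro finite_UN_I dec.G_finite finite_imageI finite_lattice_ball)
      have N: "finite N" unfolding N_def by (rule cell_buffer(1)[OF C KL(1,2)])
      have "card I \<le> (\<Sum>g\<in>G. lattice_count TYPE('d) (\<rho> (r g + 2 * \<epsilon>) s))"
      proof -
        have "card I \<le> (\<Sum>g\<in>G. card ((\<lambda>q. (q :: int^'d, g)) ` {q. norm (lattice_vec q) \<le> \<rho> (r g + 2 * \<epsilon>) s}))"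
          unfolding I_def by (rule card_UN_le[OF dec.G_finite])
        also have "\<dots> \<le> (\<Sum>g\<in>G. lattice_count TYPE('d) (\<rho> (r g + 2 * \<epsilon>) s))"
          unfolding lattice_count_def by (intro sum_mono card_image_le finite_lattice_ball)
        finally show ?thesis .
      qed
      then have cI: "s * real (card I) \<le> (\<Sum>g\<in>G. s * real (lattice_count TYPE('d) (\<rho> (r g + 2 * \<epsilon>) s)))"
        using s by (simp flip: sum_distrib_left of_nat_sum)
      have "card N \<le> card C * (nat L ^ ?n - nat (L - 2 * K) ^ ?n)"
        unfolding N_def by (rule cell_buffer(2)[OF C KL(1,2)])
      then have "real (card N) \<le> real (card C * (nat L ^ ?n - nat (L - 2 * K) ^ ?n))" by (simp only: of_nat_le_iff)
      also have "\<dots> = real (card C) * (real (nat L ^ ?n) - real (nat (L - 2 * K) ^ ?n))"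
        using KL(1) by (simp add: of_nat_diff power_mono)
      also have "real (nat L ^ ?n) - real (nat (L - 2 * K) ^ ?n) = l ^ ?n * (1 - \<theta>)"
        using cardG KL(2) by (simp add: G(1) l_def algebra_simps)
      finally have "s * real (card N) \<le> s * (real (card C) * (l ^ ?n * (1 - \<theta>)))"
        using s by (intro mult_left_mono) auto
      then have "s * (real (card I) + real (card N)) \<le> \<Phi> s"
        using cI by (simp add: \<Phi>_def C_def lattice_count_def distrib_left mult.assoc)
      then have "s * (real (card I) + real (card N)) \<le> s * t" using \<Phi>s t by linarith
      then have tt: "real (card I) + real (card N) \<le> t" using s by simp
      show "singular_value_fn t T \<le> s"
      proof (rule dec.singular_value_le_count[OF C I N _ tt, of s m M])
        show "0 \<le> s" using s by simp
        show "n \<in> N" if "lattice_cell L n \<in> C" "n \<notin> cell_block K L (lattice_cell L n)" for n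
          using that by (simp add: N_def)
        show "norm (B v) \<le> M * norm v" for v by (rule B_bound)
        fix q g assume g: "g \<in> G" "(q, g) \<notin> I"
        then have "\<not> norm (lattice_vec q) \<le> \<rho> (r g + 2 * \<epsilon>) s" by (auto simp: I_def)
        then have "r g + 2 * \<epsilon> \<le> s * (l * (norm (lattice_vec q) - real ?n)) ^ ?n
          \<and> 0 < l * (norm (lattice_vec q) - real ?n)"
          using G(3)[OF g(1)] \<epsilon>(1) by (intro far) auto
        then show "r g + 2 * \<epsilon> \<le> m q" by (simp add: m_def max_def)
      next
        fix q n :: "int^'d" assume "n \<in> cell_block K L q"
        then have q: "lattice_cell L n = q" by (rule dec.cell)
        have "max 0 (l * (norm (lattice_vec q) - real ?n)) \<le> norm (lattice_vec n)"
          using cell_norm[of n] by (simp add: q)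
        then have "max 0 (l * (norm (lattice_vec q) - real ?n)) ^ ?n * (laplace_weight n)\<^sup>2 \<le> 1"
          by (intro laplace_weight_upper) auto
        then show "m q * (laplace_weight n)\<^sup>2 \<le> s"
          using s mult_left_mono[of _ 1 s] by (simp add: m_def mult.assoc)
      next
        fix n :: "int^'d" assume "lattice_cell L n \<notin> C"
        then have "M + 2 * \<epsilon> \<le> s * (l * (norm (lattice_vec (lattice_cell L n)) - real ?n)) ^ ?n
          \<and> 0 < l * (norm (lattice_vec (lattice_cell L n)) - real ?n)"
          by (intro far M\<epsilon>) (simp add: C_def)
        then have le: "(M + 2 * \<epsilon>) * (laplace_weight n)\<^sup>2
            \<le> s * (l * (norm (lattice_vec (lattice_cell L n)) - real ?n)) ^ ?n * (laplace_weight n)\<^sup>2"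
          and one: "(l * (norm (lattice_vec (lattice_cell L n)) - real ?n)) ^ ?n * (laplace_weight n)\<^sup>2 \<le> 1"
          using cell_norm[of n] by (auto intro!: mult_right_mono laplace_weight_upper)
        note le
        also have "s * (l * (norm (lattice_vec (lattice_cell L n)) - real ?n)) ^ ?n * (laplace_weight n)\<^sup>2 \<le> s"
          using s mult_left_mono[OF one, of s] by (simp add: mult.assoc)
        finally show "(M + 2 * \<epsilon>) * (laplace_weight n)\<^sup>2 \<le> s" .
      qed
    qed
  qed
qed

text \<open>The trial vectors live in the blocks alone, so the margins show up only as the
  proportion \<open>1 - \<theta>\<close> missing from the trace, which \<open>\<delta>\<close>
  controls.\<close>

lemma singular_value_lower:
  assumes \<eta>: "0 < \<eta>"
  shows "\<forall>\<^sub>F s in at_right 0. \<forall>t\<ge>0. s * t < unit_ball_vol (real CARD('d)) * \<beta> - \<eta> \<longrightarrow> s \<le> singular_value_fn t T"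
proof -
  let ?n = "CARD('d)" and ?\<omega> = "unit_ball_vol (real CARD('d))"
  have \<omega>: "0 \<le> ?\<omega>" by simp
  define \<epsilon> where "\<epsilon> = \<eta> / (8 * (?\<omega> + 1))"
  have \<epsilon>: "0 < \<epsilon>" "2 * \<epsilon> * ?\<omega> \<le> \<eta> / 4"
    using \<eta> \<omega> by (auto simp: \<epsilon>_def field_simps add_nonneg_pos)
  define \<delta> where "\<delta> = \<eta> / (4 * (?\<omega> * \<beta> + 1))"
  have den: "0 < ?\<omega> * \<beta> + 1" using \<omega> trace_nonneg by (simp add: add_nonneg_pos)
  have \<delta>: "0 < \<delta>" "?\<omega> * \<beta> * \<delta> \<le> \<eta> / 4"
    using \<eta> den by (auto simp: \<delta>_def field_simps)
  obtain P K L and G :: "'h set" and r f where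
    dec: "block_decomposition e laplace_weight B P \<epsilon> (lattice_cell L) (cell_block K L) G r f"
    and KL: "0 \<le> K" "0 < L" "2 * K < L" "1 - (real_of_int (L - 2 * K) / real_of_int L) ^ ?n \<le> \<delta>"
    and G: "card G = nat (L - 2 * K) ^ ?n" "sum r G = real (card G) * \<beta>" "\<And>g. g \<in> G \<Longrightarrow> 0 \<le> r g"
    by (rule block_decomposition_exists[OF \<epsilon>(1) \<delta>(1)]) blast
  interpret dec: block_decomposition e laplace_weight B P \<epsilon> "lattice_cell L" "cell_block K L" G r f
    by (rule dec)
  define l where "l = real_of_int L"
  have l: "0 < l" using KL(2) by (simp add: l_def)
  define \<theta> where "\<theta> = (real_of_int (L - 2 * K) / l) ^ ?n"
  have \<theta>: "1 - \<theta> \<le> \<delta>" "\<theta> \<le> 1" using KL(1,3,4) l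
    by (auto simp: \<theta>_def l_def intro!: power_le_one)
  have cardG: "real (card G) = \<theta> * l ^ ?n"
    using KL(3) l by (simp add: G(1) \<theta>_def power_divide)
  \<comment> \<open>Block eigenvalues up to \<open>2 * \<epsilon>\<close> do not survive the
    decoupling loss. Their terms in the sum are nonpositive, so leaving them out does not decrease
    it.\<close>
  define G' where "G' = {g\<in>G. 2 * \<epsilon> < r g}"
  have G': "finite G'" "G' \<subseteq> G" using dec.G_finite by (auto simp: G'_def)
  \<comment> \<open>The shift \<open>- 1 / l\<close> pays for the added 1 in
    \<open>laplace_weight_lower\<close>, and \<open>- real ?n\<close> for the position of a point
    inside its cell.\<close>
  define \<rho> where "\<rho> a s = (a / s) powr (1 / real ?n) / l + (- 1 / l - real ?n)" for a s
  define \<Phi> where "\<Phi> s = (\<Sum>g\<in>G'. s * real (lattice_count TYPE('d) (\<rho> (r g - 2 * \<epsilon>) s)))" for s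
  have "(\<Phi> \<longlongrightarrow> (\<Sum>g\<in>G'. ?\<omega> * (r g - 2 * \<epsilon>) / l ^ ?n)) (at_right 0)"
    unfolding \<Phi>_def \<rho>_def
    using l by (intro tendsto_sum lattice_count_tendsto) (auto simp: G'_def)
  moreover have "?\<omega> * \<beta> - \<eta> < (\<Sum>g\<in>G'. ?\<omega> * (r g - 2 * \<epsilon>) / l ^ ?n)"
  proof -
    have "?\<omega> * \<beta> * (1 - \<theta>) \<le> ?\<omega> * \<beta> * \<delta>" using \<theta>(1) \<omega> trace_nonneg by (intro mult_left_mono) auto
    then have "?\<omega> * \<beta> * (1 - \<theta>) \<le> \<eta> / 4" using \<delta>(2) by linarith
    moreover have "\<theta> * (2 * \<epsilon> * ?\<omega>) \<le> 1 * (2 * \<epsilon> * ?\<omega>)" using \<theta>(2) \<omega> \<epsilon>(1) by (intro mult_right_mono) auto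
    ultimately have "?\<omega> * \<beta> - \<eta> < \<theta> * (?\<omega> * (\<beta> - 2 * \<epsilon>))"
      using \<epsilon>(2) \<eta> by (simp add: algebra_simps)
    also have "\<dots> = ?\<omega> * (sum r G - real (card G) * (2 * \<epsilon>)) / l ^ ?n"
      using l by (simp add: G(2) cardG field_simps)
    also have "\<dots> = (\<Sum>g\<in>G. ?\<omega> * (r g - 2 * \<epsilon>) / l ^ ?n)"
      by (simp add: sum_subtractf flip: sum_distrib_left sum_divide_distrib)
    also have "\<dots> \<le> (\<Sum>g\<in>G. if 2 * \<epsilon> < r g then ?\<omega> * (r g - 2 * \<epsilon>) / l ^ ?n else 0)"
      using \<omega> l by (intro sum_mono) (auto intro!: divide_nonpos_pos mult_nonneg_nonpos)
    also have "\<dots> = (\<Sum>g\<in>G'. ?\<omega> * (r g - 2 * \<epsilon>) / l ^ ?n)"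
      unfolding G'_def by (rule sum.inter_filter[OF dec.G_finite, symmetric])
    finally show ?thesis .
  qed
  ultimately have "\<forall>\<^sub>F s in at_right 0. ?\<omega> * \<beta> - \<eta> < \<Phi> s" by (rule order_tendstoD(1))
  with eventually_at_right_less[of "0::real"] show ?thesis
  proof eventually_elim
    case (elim s)
    then have s: "0 < s" and \<Phi>s: "?\<omega> * \<beta> - \<eta> < \<Phi> s" by auto
    show ?case
    proof (intro allI impI)
      fix t :: real assume t0: "0 \<le> t" and t: "s * t < ?\<omega> * \<beta> - \<eta>"
      define I where "I = (\<Union>g\<in>G'. (\<lambda>q. (q :: int^'d, g)) ` {q. norm (lattice_vec q) \<le> \<rho> (r g - 2 * \<epsilon>) s})"
      define m where "m q = s * (1 + l * (norm (lattice_vec q) + real ?n)) ^ ?n" for q :: "int^'d"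
      have I: "finite I" unfolding I_def by (intro finite_UN_I G' finite_imageI finite_lattice_ball)
      have "card I = (\<Sum>g\<in>G'. card ((\<lambda>q. (q :: int^'d, g)) ` {q. norm (lattice_vec q) \<le> \<rho> (r g - 2 * \<epsilon>) s}))"
        unfolding I_def by (rule card_UN_disjoint) (auto simp: G' finite_lattice_ball)
      also have "\<dots> = (\<Sum>g\<in>G'. lattice_count TYPE('d) (\<rho> (r g - 2 * \<epsilon>) s))"
        unfolding lattice_count_def by (intro sum.cong refl card_image) (auto simp: inj_on_def)
      finally have "s * real (card I) = \<Phi> s" by (simp add: \<Phi>_def sum_distrib_left)
      then have "s * t < s * real (card I)" using t \<Phi>s by linarith
      then have tI: "t < real (card I)" using s by simp
      show "s \<le> singular_value_fn t T"
      proof (rule dec.singular_value_ge_count[OF t0 tI I, of s m])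
        show "I \<subseteq> UNIV \<times> G" using G'(2) by (auto simp: I_def)
        show "0 \<le> s" using s by simp
        fix q g assume "(q, g) \<in> I"
        then have g: "2 * \<epsilon> < r g" and q: "norm (lattice_vec q) \<le> \<rho> (r g - 2 * \<epsilon>) s" by (auto simp: I_def G'_def)
        define a where "a = r g - 2 * \<epsilon>"
        have a: "0 < a" using g by (simp add: a_def)
        have "norm (lattice_vec q) + real ?n \<le> ((a / s) powr (1 / real ?n) - 1) / l"
          using q by (simp add: \<rho>_def a_def diff_divide_distrib)
        then have "1 + l * (norm (lattice_vec q) + real ?n) \<le> (a / s) powr (1 / real ?n)"
          using l by (simp add: pos_le_divide_eq mult.commute)
        then have "m q \<le> s * ((a / s) powr (1 / real ?n)) ^ ?n"
          unfolding m_def using s l by (intro mult_left_mono power_mono) auto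
        also have "\<dots> = a" using a s by (simp add: powr_powr flip: powr_realpow)
        finally show "m q \<le> r g - 2 * \<epsilon>" by (simp add: a_def)
        fix n assume "n \<in> cell_block K L q"
        then have qn: "lattice_cell L n = q" by (rule dec.cell)
        have "norm (lattice_vec n) \<le> l * (norm (lattice_vec q) + real ?n)"
          using norm_lattice_cell[OF KL(2), of n] by (simp add: qn l_def algebra_simps abs_le_iff)
        then have "1 \<le> (1 + l * (norm (lattice_vec q) + real ?n)) ^ ?n * (laplace_weight n)\<^sup>2"
          by (rule laplace_weight_lower)
        then show "s \<le> m q * (laplace_weight n)\<^sup>2"
          using s mult_left_mono[of 1 _ s] by (simp add: m_def mult.assoc)
      qed
    qed
  qed
qed

lemma singular_value_asymptotics:
  "((\<lambda>t. t * singular_value_fn t T) \<longlongrightarrow> unit_ball_vol (real CARD('d)) * \<beta>) at_top"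
proof (rule tendsto_from_counting)
  interpret T: compact_positive T by (rule compact_positive_sandwich[OF B B_pos])
  show "0 \<le> singular_value_fn t T" for t
    by (rule T.singular_value_fn_nonneg[OF orthonormal_basis_exists])
  show "0 \<le> unit_ball_vol (real CARD('d)) * \<beta>" using trace_nonneg by simp
qed (rule singular_value_upper singular_value_lower, assumption)+

end

theorem theorem4p12:
  fixes \<theta> :: "real^('d::{finite,linorder})^('d::{finite,linorder})"
    and A :: "'a cstar" and U :: "'d \<Rightarrow> 'a"
    and \<tau> :: "'a \<Rightarrow> complex"
    and \<Lambda> :: "'a \<Rightarrow> 'h::chilbert_space"
    and b :: 'a
  assumes "2 \<le> CARD('d)"
    and "transpose \<theta> = - \<theta>"
    and "universal_nc_torus \<theta> A U"
    and "tracial_state A \<tau>"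
    and "\<And>n. n \<noteq> 0 \<Longrightarrow> \<tau> (torus_monomial A U n) = 0"
    and "gns_space A \<tau> \<Lambda>"
    and "b \<in> positive_elements A"
  shows "((\<lambda>t. complex_of_real (t * singular_value_fn t
             (one_minus_laplace_powr A U \<Lambda> (- real CARD('d) / 4) \<circ> left_mult A \<Lambda> b
               \<circ> one_minus_laplace_powr A U \<Lambda> (- real CARD('d) / 4))))
           \<longlongrightarrow> complex_of_real
               (surface_area (sphere (0 :: real^('d::{finite,linorder})) 1) / real CARD('d)) * \<tau> b)
         at_top"
proof -
  have "cstar_algebra A" using assms(3) by (simp add: universal_nc_torus_def)
  then interpret cstar_algebra A .
  have rel: "nc_torus_relations \<theta> A U" using assms(3) by (simp add: universal_nc_torus_def)
  interpret torus_gns A U \<tau> \<Lambda>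
  proof unfold_locales
    show "U j \<in> unitaries" for j using rel by (simp add: nc_torus_relations_def unitaries_def)
    show "U j \<otimes>\<^bsub>A\<^esub> U k \<asymp> U k \<otimes>\<^bsub>A\<^esub> U j" for j k
    proof -
      have "cmod (exp (2 * of_real pi * \<i> * of_real (\<theta> $ j $ k))) = 1"
        by (simp add: norm_exp_eq_Re)
      then show ?thesis using rel unfolding nc_torus_relations_def phase_eq_def by blast
    qed
    show "cstar_generated_by A (range U)" using assms(3) by (simp add: universal_nc_torus_def)
  qed (fact assms)+
  have bc: "b \<in> carrier A" by (rule positive_elements_closed[OF assms(7)])
  have \<tau>b: "\<tau> b \<in> \<real>\<^sub>\<ge>\<^sub>0" by (rule trace_positive[OF assms(7)])
  interpret B: translation_covariant basis "left_mult A \<Lambda> b" "anorm A b" "Re (\<tau> b)"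
  proof
    show "\<exists>\<alpha>. (\<forall>n. cmod (\<alpha> n) = 1) \<and> (\<forall>m n. cinner (basis (m + k)) (lmul b (basis (n + k)))
        = cnj (\<alpha> m) * \<alpha> n * cinner (basis m) (lmul b (basis n)))" for k
      using lmul_translate[of k] bc by blast
    show "\<exists>P K. bounded_clinear P \<and> (\<forall>v. norm (lmul b v - P v) \<le> \<epsilon> * norm v) \<and>
        (\<forall>m n. (\<exists>j. K < \<bar>m $ j - n $ j\<bar>) \<longrightarrow> cinner (basis m) (P (basis n)) = 0)"
      if "0 < \<epsilon>" for \<epsilon>
      by (rule lmul_banded_approx[OF bc that])
  qed (use bc in \<open>simp_all add: orthonormal_basis_family total_basis_family lmul_properties
      lmul_positive[OF assms(7)] anorm_nonneg lmul_diagonal\<close>)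
  have "one_minus_laplace_powr A U \<Lambda> (- real CARD('d) / 4) = B.D"
    by (rule ext) (simp add: one_minus_laplace_powr_def diag_op_def laplace_weight_def
        norm_lattice_vec_square basis_def)
  then have "((\<lambda>t. t * singular_value_fn t
             (one_minus_laplace_powr A U \<Lambda> (- real CARD('d) / 4) \<circ> left_mult A \<Lambda> b
               \<circ> one_minus_laplace_powr A U \<Lambda> (- real CARD('d) / 4)))
      \<longlongrightarrow> unit_ball_vol (real CARD('d)) * Re (\<tau> b)) at_top"
    using B.singular_value_asymptotics by simp
  then have "((\<lambda>t. complex_of_real (t * singular_value_fn t
             (one_minus_laplace_powr A U \<Lambda> (- real CARD('d) / 4) \<circ> left_mult A \<Lambda> b
               \<circ> one_minus_laplace_powr A U \<Lambda> (- real CARD('d) / 4))))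
      \<longlongrightarrow> complex_of_real (unit_ball_vol (real CARD('d)) * Re (\<tau> b))) at_top"
    by (rule tendsto_of_real)
  \<comment> \<open>Positivity makes \<open>\<tau> b\<close> real, and the surface area divided by
    the dimension is the volume of the unit ball.\<close>
  moreover have "complex_of_real (unit_ball_vol (real CARD('d)) * Re (\<tau> b))
      = complex_of_real (surface_area (sphere (0 :: real^('d::{finite,linorder})) 1) / real CARD('d)) * \<tau> b"
    using \<tau>b by (simp add: surface_area_unit_sphere complex_nonneg_Reals_iff complex_eq_iff)
  ultimately show ?thesis by simp
qed

end
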